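(* The reachability problem for layered grid graphs (given an $n\times n$ layered grid graph $G$ and two vertices $s,t$ of $G$, decide whether there is a directed path from $s$ to $t$ in $G$) belongs to $\mathrm{near}\text{-}\mathrm{SC}$. That is, for every constant $\epsilon>0$ it can be decided by a deterministic algorithm running simultaneously in time polynomial in $n$ and space $O(n^{\epsilon})$.
   Context: An $n\times n$ layered grid graph is a directed graph $G$ whose vertices are the lattice points $(i,j)$ with $0\le i,j\le n$ and in which every edge is of the form $(i,j)\to(i+1,j)$ (east) or $(i,j)\to(i,j+1)$ (north); any subset of such edges may be present. Space is measured in the standard model: the input is on a read-only tape, output on a write-only tape, and only the work tape counts toward space. $\mathrm{TISP}(t(n),s(n))$ is the class of languages decided by a deterministic Turing machine running simultaneously in time $O(t(n))$ and space $O(s(n))$. For fixed $\epsilon>0$, $\mathrm{near}\text{-}\mathrm{SC}_\epsilon:=\mathrm{TISP}(n^{O(1)},n^{\epsilon})$, and $\mathrm{near}\text{-}\mathrm{SC}:=\bigcap_{\epsilon>0}\mathrm{near}\text{-}\mathrm{SC}_\epsilon$. *)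

theory Defs
  imports Complex_Main
begin

definition grid_vertices :: "nat \<Rightarrow> (nat \<times> nat) set" where
  "grid_vertices n = {(i, j). i \<le> n \<and> j \<le> n}"

definition grid_edges :: "nat \<Rightarrow> ((nat \<times> nat) \<times> (nat \<times> nat)) set" where
  "grid_edges n =
     {((i, j), (i + 1, j)) | i j. i < n \<and> j \<le> n} \<union>
     {((i, j), (i, j + 1)) | i j. i \<le> n \<and> j < n}"

text \<open>A layered grid graph is given by any subset E of grid_edges n.
  Reachability: a directed path (possibly of length 0) from s to t.\<close>
definition grid_reach ::
  "((nat \<times> nat) \<times> (nat \<times> nat)) set \<Rightarrow> nat \<times> nat \<Rightarrow> nat \<times> nat \<Rightarrow> bool" where
  "grid_reach E s t \<longleftrightarrow> (s, t) \<in> E\<^sup>*"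

definition unary :: "nat \<Rightarrow> bool list" where
  "unary m = replicate m True @ [False]"

definition encode_instance ::
  "nat \<Rightarrow> ((nat \<times> nat) \<times> (nat \<times> nat)) set \<Rightarrow> nat \<times> nat \<Rightarrow> nat \<times> nat \<Rightarrow> bool list" where
  "encode_instance n E s t =
     unary n
     @ concat (map (\<lambda>i. concat (map (\<lambda>j.
           [((i, j), (i + 1, j)) \<in> E, ((i, j), (i, j + 1)) \<in> E]) [0..<n + 1])) [0..<n + 1])
     @ unary (fst s) @ unary (snd s) @ unary (fst t) @ unary (snd t)"

text \<open>States are 0..<tm_states (0 = start, 1 = accept, 2 = reject), work-tape symbols
  are 0..<tm_syms (0 = blank). The input tape holds the input word; cells beyond
  it read None (blank). The transition function maps (state, input symbol,
  work symbol) to (new state, input-head move, written work symbol, work-head move),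
  moves in {-1,0,1}. Only the work tape counts toward space.\<close>
record tm =
  tm_states :: nat
  tm_syms :: nat
  tm_delta :: "nat \<Rightarrow> bool option \<Rightarrow> nat \<Rightarrow> nat \<times> int \<times> nat \<times> int"

definition wf_tm :: "tm \<Rightarrow> bool" where
  "wf_tm M \<longleftrightarrow> 3 \<le> tm_states M \<and> 1 \<le> tm_syms M \<and>
     (\<forall>q a w. q < tm_states M \<longrightarrow> w < tm_syms M \<longrightarrow>
        (case tm_delta M q a w of (q', d1, b, d2) \<Rightarrow>
           q' < tm_states M \<and> b < tm_syms M \<and> d1 \<in> {-1, 0, 1} \<and> d2 \<in> {-1, 0, 1}))"

text \<open>Configuration: (state, input head, work tape contents, work head).\<close>
type_synonym config = "nat \<times> nat \<times> (nat \<Rightarrow> nat) \<times> nat"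

definition input_sym :: "bool list \<Rightarrow> nat \<Rightarrow> bool option" where
  "input_sym xs i = (if i < length xs then Some (xs ! i) else None)"

definition move :: "nat \<Rightarrow> int \<Rightarrow> nat" where
  "move p d = nat (int p + d)"

definition tm_step :: "tm \<Rightarrow> bool list \<Rightarrow> config \<Rightarrow> config" where
  "tm_step M xs c = (case c of (q, i, w, h) \<Rightarrow>
     if q = 1 \<or> q = 2 then c
     else (case tm_delta M q (input_sym xs i) (w h) of (q', d1, b, d2) \<Rightarrow>
       (q', move i d1, w(h := b), move h d2)))"

definition tm_init :: config where
  "tm_init = (0, 0, \<lambda>_. 0, 0)"

definition tm_run :: "tm \<Rightarrow> bool list \<Rightarrow> nat \<Rightarrow> config" where
  "tm_run M xs t = (tm_step M xs ^^ t) tm_init"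

definition work_head :: "config \<Rightarrow> nat" where
  "work_head c = snd (snd (snd c))"

definition state_of :: "config \<Rightarrow> nat" where
  "state_of c = fst c"

definition tm_decides_within ::
  "tm \<Rightarrow> bool list \<Rightarrow> bool \<Rightarrow> real \<Rightarrow> real \<Rightarrow> bool" where
  "tm_decides_within M xs b T S \<longleftrightarrow>
     (\<exists>t. real t \<le> T \<and> state_of (tm_run M xs t) = (if b then 1 else 2) \<and>
        (\<forall>t' \<le> t. real (work_head (tm_run M xs t') + 1) \<le> S))"

end

theory Submission
  imports Defs
begin

text \<open>Cut the columns between source and target into \<open>k\<close> slabs of equal width and search depth
  first, highest row first, through the lines separating them. By planarity two paths that change
  sides meet, so a row at or above an already visited row of the same line leads to nothing new:
  one mark per line, the lowest row visited, replaces the set of visited vertices. The marks on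
  the current path are the path itself, and every mark only decreases, so a search visits at
  most \<open>k (n + 1)\<close> rows. A single step across a slab asks for the highest reachable row below the
  mark of the next line and is answered by the same search on a slab \<open>k\<close> times narrower. With
  \<open>k\<close> about \<open>n\<close> to the power \<open>1 / d\<close> the recursion has constant depth \<open>d\<close>, hence polynomial time, and
  stores \<open>O(d k)\<close> numbers of \<open>O(log n)\<close> bits.

  The algorithm is written in a structured language on stacks of numbers, which is compiled to a
  language on stacks of symbols and from there to a Turing machine.\<close>

subsection \<open>Structured programs and their Turing machines\<close>

text \<open>Neither classical extreme meets both bounds at once: remembering visited vertices costs
  a fixed positive power of n in space, while halving the distance recursively saves space at the
  price of superpolynomial time. The compromise rests on the property \<open>noncross\<close>. It
  holds for a single column and survives composition, so one search argument serves every level,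
  with whole slabs in the role of edges. Nothing is kept of a finished sub-search except one row.
  The same question may be asked again and is then computed again; since the depth is constant, the
  repeated work stays polynomial. The depth \<open>d\<close> is fixed by the exponent before the
  machine is built, so there is one machine per exponent, whereas \<open>k\<close> depends on the
  input and is computed at run time. Half of the exponent pays for the number of stack entries, the
  other half for their logarithmic length. Time and space must be bounded along the same run, so
  both languages carry a cost, and their steps are blocked when a stack would become too
  high.\<close>

datatype ('b, 't) com =
    Skip
  | Basic 'b
  | Seq "('b, 't) com" "('b, 't) com"  (infixr ";;" 60)
  | Cond 't "('b, 't) com" "('b, 't) com"
  | Loop 't "('b, 't) com"

text \<open>Steps and tests are parameters, so that both languages are instances. \<open>stp\<close>
  is a relation because a step can then be refused, which is how space limits enter the
  semantics.\<close>

inductive exec :: "('b \<Rightarrow> 'x \<Rightarrow> 'x \<Rightarrow> bool) \<Rightarrow> ('t \<Rightarrow> 'x \<Rightarrow> bool) \<Rightarrow>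
    ('b, 't) com \<Rightarrow> 'x \<Rightarrow> nat \<Rightarrow> 'x \<Rightarrow> bool" for stp tst where
  exec_Skip: "exec stp tst Skip x 1 x"
| exec_Basic: "stp b x y \<Longrightarrow> exec stp tst (Basic b) x 1 y"
| exec_Seq: "exec stp tst c x m y \<Longrightarrow> exec stp tst d y n z \<Longrightarrow> exec stp tst (c ;; d) x (Suc (m + n)) z"
| exec_CondT: "tst t x \<Longrightarrow> exec stp tst c x n y \<Longrightarrow> exec stp tst (Cond t c d) x (Suc n) y"
| exec_CondF: "\<not> tst t x \<Longrightarrow> exec stp tst d x n y \<Longrightarrow> exec stp tst (Cond t c d) x (Suc n) y"
| exec_LoopF: "\<not> tst t x \<Longrightarrow> exec stp tst (Loop t c) x 1 x"
| exec_LoopT: "tst t x \<Longrightarrow> exec stp tst c x m y \<Longrightarrow> exec stp tst (Loop t c) y n z \<Longrightarrow>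
    exec stp tst (Loop t c) x (Suc (m + n)) z"

text \<open>An upper bound in place of the exact cost, so that costs can be rounded up at any point
  of a derivation.\<close>

definition runs :: "('b \<Rightarrow> 'x \<Rightarrow> 'x \<Rightarrow> bool) \<Rightarrow> ('t \<Rightarrow> 'x \<Rightarrow> bool) \<Rightarrow>
    ('b, 't) com \<Rightarrow> 'x \<Rightarrow> nat \<Rightarrow> 'x \<Rightarrow> bool" where
  "runs stp tst c x T y \<longleftrightarrow> (\<exists>n\<le>T. exec stp tst c x n y)"

lemma runs_mono: "runs stp tst c x T y \<Longrightarrow> T \<le> T' \<Longrightarrow> runs stp tst c x T' y"
  by (auto simp: runs_def intro: le_trans)

lemma runs_Skip: "runs stp tst Skip x 1 x"
  unfolding runs_def by (intro exI[of _ 1] conjI order_refl exec_Skip)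

lemma runs_Basic: "stp b x y \<Longrightarrow> runs stp tst (Basic b) x 1 y"
  unfolding runs_def by (intro exI[of _ 1] conjI order_refl exec_Basic)

lemma runs_Seq:
  "runs stp tst c x m y \<Longrightarrow> runs stp tst d y n z \<Longrightarrow> runs stp tst (c ;; d) x (m + n + 1) z"
  unfolding runs_def by (metis exec_Seq Suc_eq_plus1 add_mono_thms_linordered_semiring(1) Suc_le_mono)

lemma runs_CondT:
  "tst t x \<Longrightarrow> runs stp tst c x n y \<Longrightarrow> runs stp tst (Cond t c d) x (n + 1) y"
  unfolding runs_def by (metis exec_CondT Suc_eq_plus1 Suc_le_mono)

lemma runs_CondF:
  "\<not> tst t x \<Longrightarrow> runs stp tst d x n y \<Longrightarrow> runs stp tst (Cond t c d) x (n + 1) y"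
  unfolding runs_def by (metis exec_CondF Suc_eq_plus1 Suc_le_mono)

lemma runs_LoopF: "\<not> tst t x \<Longrightarrow> runs stp tst (Loop t c) x 1 x"
  unfolding runs_def by (metis exec_LoopF order_refl)

lemma runs_LoopT:
  "tst t x \<Longrightarrow> runs stp tst c x m y \<Longrightarrow> runs stp tst (Loop t c) y n z \<Longrightarrow>
   runs stp tst (Loop t c) x (m + n + 1) z"
  unfolding runs_def by (metis exec_LoopT Suc_eq_plus1 add_mono_thms_linordered_semiring(1) Suc_le_mono)

section \<open>Programs on bounded stacks of symbols\<close>

datatype sym = Bit bool | Sep

instance sym :: finite
proof
  have "(UNIV :: sym set) \<subseteq> {Sep, Bit True, Bit False}"
    by (auto, metis (full_types) sym.exhaust)
  then show "finite (UNIV :: sym set)" by (rule finite_subset) simp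
qed

datatype 's op1 = Push 's sym | Pop 's | InL | InR | Halt bool

datatype 's tst1 = Top 's "sym option \<Rightarrow> bool" | Inp "bool option \<Rightarrow> bool"

type_synonym 's com1 = "('s op1, 's tst1) com"

type_synonym 's state1 = "('s \<Rightarrow> sym list) \<times> nat"

definition peek :: "'a list \<Rightarrow> 'a option" where
  "peek xs = (case xs of [] \<Rightarrow> None | x # _ \<Rightarrow> Some x)"

lemma peek_simps [simp]: "peek [] = None" "peek (x # xs) = Some x"
  by (simp_all add: peek_def)

fun eff1 :: "'s op1 \<Rightarrow> 's state1 \<Rightarrow> 's state1" where
  "eff1 (Push s x) (S, h) = (S(s := x # S s), h)"
| "eff1 (Pop s) (S, h) = (S(s := tl (S s)), h)"
| "eff1 InL (S, h) = (S, h - 1)"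
| "eff1 InR (S, h) = (S, h + 1)"
| "eff1 (Halt b) (S, h) = (S, h)"

text \<open>Every reachable state keeps all stacks within \<open>B\<close>, so an execution is
  itself a space certificate. \<open>Halt\<close> has no step; it occurs only in the verdict
  appended by \<open>tm_of_com1\<close>.\<close>

definition stp1 :: "nat \<Rightarrow> 's op1 \<Rightarrow> 's state1 \<Rightarrow> 's state1 \<Rightarrow> bool" where
  "stp1 B b x y \<longleftrightarrow> (\<forall>r. b \<noteq> Halt r) \<and> y = eff1 b x \<and> (\<forall>s. length (fst y s) \<le> B)"

fun holds1 :: "bool list \<Rightarrow> 's tst1 \<Rightarrow> 's state1 \<Rightarrow> bool" where
  "holds1 xs (Top s P) (S, h) = P (peek (S s))"
| "holds1 xs (Inp P) (S, h) = P (input_sym xs h)"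

text \<open>A control state of the Turing machine is a continuation, that is, the list of commands still to
  be executed; only finitely many continuations arise from a given program. All stacks share
  the work tape, one track each, bottom element next to cell 0, which carries a mark. To access
  the top of a stack the head walks from cell 0 to the end of its track (\<open>Seek\<close>, \<open>Edge\<close>) and
  returns (\<open>Back\<close>).\<close>

datatype phase = Home | Seek | Edge | Back

datatype 's ctrl = Start | Acc | Rej | Run "'s com1 list" phase

type_synonym 's cell = "bool \<times> ('s \<Rightarrow> sym option)"

text \<open>The stack whose top the next command needs; \<open>None\<close> if the command can be
  carried out with the work head at cell 0.\<close>

fun focus :: "'s com1 list \<Rightarrow> 's option" where
  "focus (Basic (Push s x) # ks) = Some s"
| "focus (Basic (Pop s) # ks) = Some s"
| "focus (Cond (Top s P) c d # ks) = Some s"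
| "focus (Loop (Top s P) c # ks) = Some s"
| "focus _ = None"

fun after :: "'s com1 list \<Rightarrow> sym option \<Rightarrow> 's com1 list" where
  "after (Basic b # ks) y = ks"
| "after (Cond (Top s P) c d # ks) y = (if P y then c # ks else d # ks)"
| "after (Loop (Top s P) c # ks) y = (if P y then c # Loop (Top s P) c # ks else ks)"
| "after ks y = ks"

fun erase :: "'s com1 list \<Rightarrow> ('s \<Rightarrow> sym option) \<Rightarrow> ('s \<Rightarrow> sym option)" where
  "erase (Basic (Pop s) # ks) g = g(s := None)"
| "erase _ g = g"

fun plain :: "'s com1 list \<Rightarrow> bool option \<Rightarrow> 's ctrl \<times> int" where
  "plain (Skip # ks) a = (Run ks Home, 0)"
| "plain ((c ;; d) # ks) a = (Run (c # d # ks) Home, 0)"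
| "plain (Basic InL # ks) a = (Run ks Home, -1)"
| "plain (Basic InR # ks) a = (Run ks Home, 1)"
| "plain (Basic (Halt b) # ks) a = (if b then Acc else Rej, 0)"
| "plain (Cond (Inp P) c d # ks) a = (if P a then Run (c # ks) Home else Run (d # ks) Home, 0)"
| "plain (Loop (Inp P) c # ks) a =
    (if P a then Run (c # Loop (Inp P) c # ks) Home else Run ks Home, 0)"
| "plain ks a = (Run ks Home, 0)"

text \<open>A push writes into the first empty cell of its track, where \<open>Seek\<close> ends; a
  pop or a test needs the cell before it, hence the extra phase \<open>Edge\<close>. For an empty
  stack that cell is cell 0, whose tracks are all \<open>None\<close>, so the symbol read agrees
  with \<open>peek []\<close>.\<close>

fun delta :: "'s com1 \<Rightarrow> 's ctrl \<Rightarrow> bool option \<Rightarrow> 's cell \<Rightarrow> 's ctrl \<times> int \<times> 's cell \<times> int" where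
  "delta p Start a g = (Run [p] Home, 0, (True, \<lambda>_. None), 0)"
| "delta p Acc a g = (Acc, 0, g, 0)"
| "delta p Rej a g = (Rej, 0, g, 0)"
| "delta p (Run ks Home) a g =
    (case focus ks of None \<Rightarrow> (case plain ks a of (q, d) \<Rightarrow> (q, d, g, 0))
     | Some s \<Rightarrow> (Run ks Seek, 0, g, 1))"
| "delta p (Run ks Seek) a g =
    (if snd g (the (focus ks)) \<noteq> None then (Run ks Seek, 0, g, 1)
     else (case ks of Basic (Push s x) # ks' \<Rightarrow> (Run ks' Back, 0, (fst g, (snd g)(s := Some x)), -1)
       | _ \<Rightarrow> (Run ks Edge, 0, g, -1)))"
| "delta p (Run ks Edge) a g =
    (Run (after ks (snd g (the (focus ks)))) Back, 0, (fst g, erase ks (snd g)), 0)"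
| "delta p (Run ks Back) a g = (if fst g then (Run ks Home, 0, g, 0) else (Run ks Back, 0, g, -1))"

section \<open>Runs of the abstract machine with simultaneous time and space bounds\<close>

type_synonym 's aconfig = "'s ctrl \<times> nat \<times> (nat \<Rightarrow> 's cell) \<times> nat"

definition astep :: "'s com1 \<Rightarrow> bool list \<Rightarrow> 's aconfig \<Rightarrow> 's aconfig" where
  "astep p xs = (\<lambda>(q, i, w, h). case delta p q (input_sym xs i) (w h) of
     (q', d1, b, d2) \<Rightarrow> (q', move i d1, w(h := b), move h d2))"

definition ahead :: "'s aconfig \<Rightarrow> nat" where
  "ahead c = snd (snd (snd c))"

text \<open>The head position is bounded at all intermediate configurations and at both ends, which
  lets runs be glued together without losing the space bound.\<close>

definition areach :: "'s com1 \<Rightarrow> bool list \<Rightarrow> nat \<Rightarrow> nat \<Rightarrow> 's aconfig \<Rightarrow> 's aconfig \<Rightarrow> bool" where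
  "areach p xs W m c c' \<longleftrightarrow> (\<exists>t\<le>m. c' = (astep p xs ^^ t) c \<and>
     (\<forall>t'\<le>t. ahead ((astep p xs ^^ t') c) \<le> W))"

lemma areach_refl: "ahead c \<le> W \<Longrightarrow> areach p xs W m c c"
  by (auto simp: areach_def intro!: exI[of _ 0])

lemma areach_trans:
  assumes "areach p xs W m c c'" "areach p xs W n c' c''"
  shows "areach p xs W (m + n) c c''"
proof -
  let ?f = "astep p xs"
  obtain t where t: "t \<le> m" "c' = (?f ^^ t) c" "\<And>t'. t' \<le> t \<Longrightarrow> ahead ((?f ^^ t') c) \<le> W"
    using assms(1) by (auto simp: areach_def)
  obtain u where u: "u \<le> n" "c'' = (?f ^^ u) c'" "\<And>t'. t' \<le> u \<Longrightarrow> ahead ((?f ^^ t') c') \<le> W"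
    using assms(2) by (auto simp: areach_def)
  have "ahead ((?f ^^ t') c) \<le> W" if "t' \<le> t + u" for t'
  proof (cases "t' \<le> t")
    case False
    define v where "v = t' - t"
    have v: "t' = v + t" "v \<le> u" using that False by (auto simp: v_def)
    then show ?thesis using u(3)[OF v(2)] by (simp only: t(2) v(1) funpow_add comp_apply)
  qed (use t(3) in auto)
  moreover have "c'' = (?f ^^ (t + u)) c" using t(2) u(2) by (simp add: funpow_add add.commute[of t u])
  ultimately show ?thesis unfolding areach_def using t(1) u(1)
    by (intro exI[of _ "t + u"]) auto
qed

lemma areach_mono: "areach p xs W m c c' \<Longrightarrow> m \<le> n \<Longrightarrow> areach p xs W n c c'"
  by (auto simp: areach_def intro: le_trans)

lemma areach_step:
  "ahead c \<le> W \<Longrightarrow> ahead (astep p xs c) \<le> W \<Longrightarrow> areach p xs W 1 c (astep p xs c)"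
  unfolding areach_def by (rule exI[of _ 1]) (auto simp: le_Suc_eq)

lemma areach_cons:
  assumes "ahead c \<le> W" "areach p xs W m (astep p xs c) c'"
  shows "areach p xs W (Suc m) c c'"
proof -
  have "ahead (astep p xs c) \<le> W" using assms(2) by (auto simp: areach_def)
  then show ?thesis using areach_trans[OF areach_step[OF assms(1)] assms(2)] by simp
qed

lemma move_simps [simp]: "move i 0 = i" "move i 1 = Suc i" "move i (-1) = i - 1" "move (Suc i) (-1) = i"
  by (auto simp: move_def)

definition tape :: "('s \<Rightarrow> sym list) \<Rightarrow> nat \<Rightarrow> 's cell" where
  "tape S i = (case i of 0 \<Rightarrow> (True, \<lambda>_. None)
     | Suc j \<Rightarrow> (False, \<lambda>s. if j < length (S s) then Some (rev (S s) ! j) else None))"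

lemma tape_0 [simp]: "tape S 0 = (True, \<lambda>_. None)"
  by (simp add: tape_def)

lemma tape_Suc: "tape S (Suc j) =
    (False, \<lambda>s. if j < length (S s) then Some (rev (S s) ! j) else None)"
  by (simp add: tape_def)

lemma tape_length: "snd (tape S (length (S s))) s = peek (S s)"
  by (cases "S s") (auto simp: tape_Suc nth_append)

lemma tape_push:
  "(tape S)(Suc (length (S s)) := (False, (snd (tape S (Suc (length (S s)))))(s := Some x)))
     = tape (S(s := x # S s))" (is "?l = ?r")
proof
  fix i show "?l i = ?r i"
    by (cases i) (auto simp: tape_Suc nth_append fun_eq_iff)
qed

lemma tape_pop:
  "(tape S)(length (S s) := (fst (tape S (length (S s))), (snd (tape S (length (S s))))(s := None)))
     = tape (S(s := tl (S s)))" (is "?l = ?r")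
proof
  fix i show "?l i = ?r i"
  proof (cases "S s")
    case Nil
    then show ?thesis by (cases i) (auto simp: tape_Suc fun_eq_iff)
  next
    case (Cons a l)
    then show ?thesis
      by (cases i) (auto simp: tape_Suc fun_eq_iff nth_append)
  qed
qed

lemma areach_back:
  "j \<le> W \<Longrightarrow> areach p xs W (Suc j) (Run ks Back, h, tape S, j) (Run ks Home, h, tape S, 0)"
proof (induction j)
  case 0
  have "astep p xs (Run ks Back, h, tape S, 0) = (Run ks Home, h, tape S, 0)"
    by (auto simp: astep_def fun_eq_iff)
  then show ?case using areach_step[of "(Run ks Back, h, tape S, 0)" W p xs] by (simp add: ahead_def)
next
  case (Suc j)
  have "astep p xs (Run ks Back, h, tape S, Suc j) = (Run ks Back, h, tape S, j)"
    by (auto simp: astep_def tape_Suc fun_eq_iff)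
  then show ?case using areach_cons[of "(Run ks Back, h, tape S, Suc j)" W p xs] Suc
    by (simp add: ahead_def)
qed

lemma areach_seek:
  assumes "focus ks = Some s" "length (S s) < W"
  shows "areach p xs W (Suc (length (S s))) (Run ks Home, h, tape S, 0)
     (Run ks Seek, h, tape S, Suc (length (S s)))"
proof -
  \<comment> \<open>Here \<open>j\<close> is the number of cells still to be passed, so the
    induction runs backwards from the end of the track.\<close>
  have "areach p xs W j (Run ks Seek, h, tape S, Suc (length (S s)) - j) (Run ks Seek, h, tape S, Suc (length (S s)))"
    if "j \<le> length (S s)" for j
    using that
  proof (induction j)
    case 0
    show ?case using assms by (auto simp: ahead_def intro!: areach_refl)
  next
    case (Suc j)
    then obtain i where i: "Suc (length (S s)) - Suc j = Suc i" "Suc (length (S s)) - j = Suc (Suc i)" "i < length (S s)"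
      by (intro that[of "length (S s) - Suc j"]) auto
    have "astep p xs (Run ks Seek, h, tape S, Suc i) = (Run ks Seek, h, tape S, Suc (Suc i))"
      using assms(1) i(3) by (auto simp: astep_def tape_Suc fun_eq_iff)
    then show ?case using Suc i assms(2)
      by (auto intro!: areach_cons simp: ahead_def)
  qed
  from this[of "length (S s)"] have *: "areach p xs W (length (S s)) (Run ks Seek, h, tape S, 1) (Run ks Seek, h, tape S, Suc (length (S s)))"
    by simp
  have "astep p xs (Run ks Home, h, tape S, 0) = (Run ks Seek, h, tape S, 1)"
    using assms(1) by (auto simp: astep_def fun_eq_iff)
  then show ?thesis using * by (intro areach_cons) (auto simp: ahead_def)
qed

text \<open>Walking out and back costs at most about twice the height of the stack.
  \<open>2 * W + 4\<close> is a common bound for every primitive command, so that the total time is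
  the cost of the program times one factor.\<close>

lemma areach_push:
  assumes "length (S s) < W"
  shows "areach p xs W (2 * W + 4) (Run (Basic (Push s x) # ks) Home, h, tape S, 0)
     (Run ks Home, h, tape (S(s := x # S s)), 0)"
proof -
  let ?ks = "Basic (Push s x) # ks"
  have 1: "areach p xs W (Suc (length (S s))) (Run ?ks Home, h, tape S, 0)
     (Run ?ks Seek, h, tape S, Suc (length (S s)))"
    by (rule areach_seek) (use assms in auto)
  have "astep p xs (Run ?ks Seek, h, tape S, Suc (length (S s))) =
      (Run ks Back, h, tape (S(s := x # S s)), length (S s))"
    using tape_push[of S s x] by (simp add: astep_def) (simp add: tape_Suc)
  then have 2: "areach p xs W (Suc (Suc (length (S s)))) (Run ?ks Seek, h, tape S, Suc (length (S s)))
     (Run ks Home, h, tape (S(s := x # S s)), 0)"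
    using areach_back[of "length (S s)" W p xs ks h "S(s := x # S s)"] assms
    by (intro areach_cons[of _ W p xs "Suc (length (S s))"]) (auto simp: ahead_def)
  show ?thesis using areach_trans[OF 1 2] by (rule areach_mono) (use assms in auto)
qed

lemma areach_top:
  assumes "length (S s) < W" "focus ks = Some s" "\<forall>x. hd ks \<noteq> Basic (Push s x)"
    "S' = (case ks of Basic b # _ \<Rightarrow> S(s := tl (S s)) | _ \<Rightarrow> S)"
  shows "areach p xs W (2 * W + 4) (Run ks Home, h, tape S, 0)
     (Run (after ks (peek (S s))) Home, h, tape S', 0)"
proof -
  have 1: "areach p xs W (Suc (length (S s))) (Run ks Home, h, tape S, 0)
     (Run ks Seek, h, tape S, Suc (length (S s)))"
    by (rule areach_seek) (use assms in auto)
  have "astep p xs (Run ks Seek, h, tape S, Suc (length (S s))) = (Run ks Edge, h, tape S, length (S s))"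
    using assms(2,3) by (auto simp: astep_def tape_Suc fun_eq_iff split: list.splits com.splits op1.splits)
  moreover have "astep p xs (Run ks Edge, h, tape S, length (S s)) =
      (Run (after ks (peek (S s))) Back, h, tape S', length (S s))"
  proof -
    have "(tape S)(length (S s) := (fst (tape S (length (S s))), erase ks (snd (tape S (length (S s)))))) = tape S'"
      using assms(2-4) tape_pop[of S s]
      by (cases "(ks, snd (tape S (length (S s))))" rule: erase.cases) auto
    then show ?thesis using assms(2) by (simp add: astep_def tape_length)
  qed
  ultimately have 2: "areach p xs W (Suc (Suc (Suc (length (S s))))) (Run ks Seek, h, tape S, Suc (length (S s)))
     (Run (after ks (peek (S s))) Home, h, tape S', 0)"
    using areach_back[of "length (S s)" W p xs "after ks (peek (S s))" h "S'"] assms(1)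
    by (intro areach_cons[of _ W p xs "Suc (length (S s))"] areach_cons[of _ W p xs "Suc (Suc (length (S s)))"])
      (auto simp: ahead_def)
  show ?thesis using areach_trans[OF 1 2] by (rule areach_mono) (use assms in auto)
qed

lemma areach_plain:
  assumes "focus ks = None" "plain ks (input_sym xs h) = (q, d)"
  shows "areach p xs W (2 * W + 4) (Run ks Home, h, tape S, 0) (q, move h d, tape S, 0)"
proof -
  have "astep p xs (Run ks Home, h, tape S, 0) = (q, move h d, tape S, 0)"
    using assms by (auto simp: astep_def fun_eq_iff)
  then have "areach p xs W 1 (Run ks Home, h, tape S, 0) (q, move h d, tape S, 0)"
    using areach_step[of "(Run ks Home, h, tape S, 0)" W p xs] by (simp add: ahead_def)
  then show ?thesis by (rule areach_mono) simp
qed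

lemma areach_Cond:
  assumes "\<And>s. length (S s) < W"
  shows "areach p xs W (2 * W + 4) (Run (Cond t c d # ks) Home, h, tape S, 0)
     (Run ((if holds1 xs t (S, h) then c else d) # ks) Home, h, tape S, 0)"
proof (cases t)
  case (Top s P)
  then show ?thesis using areach_top[of S s W "Cond t c d # ks" S p xs h] assms by (simp split: if_splits)
next
  case (Inp P)
  then show ?thesis using areach_plain[of "Cond t c d # ks" xs h _ 0 p W S] by (simp split: if_splits)
qed

lemma areach_Loop:
  assumes "\<And>s. length (S s) < W"
  shows "areach p xs W (2 * W + 4) (Run (Loop t c # ks) Home, h, tape S, 0)
     (Run (if holds1 xs t (S, h) then c # Loop t c # ks else ks) Home, h, tape S, 0)"
proof (cases t)
  case (Top s P)
  then show ?thesis using areach_top[of S s W "Loop t c # ks" S p xs h] assms by (simp split: if_splits)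
next
  case (Inp P)
  then show ?thesis using areach_plain[of "Loop t c # ks" xs h _ 0 p W S] by (simp split: if_splits)
qed

lemma exec_bounded:
  assumes "exec (stp1 B) (holds1 xs) c x n y" "\<And>s. length (fst x s) \<le> B"
  shows "length (fst y s) \<le> B"
  using assms by (induction arbitrary: s rule: exec.induct) (auto simp: stp1_def)

text \<open>Each unit of cost corresponds to one visit to cell 0. The statement has to hold for
  every continuation \<open>ks\<close>, because the parts of a sequence or a loop run in front of
  what remains. The space bound is \<open>Suc B\<close> because stack elements start in cell 1 and
  the search for the end of a full track looks one cell further.\<close>

lemma exec_areach:
  assumes "exec (stp1 B) (holds1 xs) c x n y" "\<And>s. length (fst x s) \<le> B"
  shows "areach p xs (Suc B) (n * (2 * Suc B + 4)) (Run (c # ks) Home, snd x, tape (fst x), 0)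
     (Run ks Home, snd y, tape (fst y), 0)"
  using assms
proof (induction arbitrary: ks rule: exec.induct)
  case (exec_Skip x)
  then show ?case using areach_plain[of "Skip # ks" xs "snd x" _ 0 p "Suc B" "fst x"] by simp
next
  case (exec_Basic b x y)
  obtain S h where x: "x = (S, h)" by force
  have *: "length (S s) < Suc B" for s using exec_Basic x by (simp add: le_imp_less_Suc)
  show ?case
  proof (cases b)
    case (Push s z)
    then show ?thesis using areach_push[of S s "Suc B" p xs z ks h, OF *] exec_Basic x by (auto simp: stp1_def simp del: fun_upd_apply)
  next
    case (Pop s)
    then show ?thesis using areach_top[of S s "Suc B" "Basic (Pop s) # ks" _ p xs h, OF *] exec_Basic x
      by (auto simp: stp1_def simp del: fun_upd_apply)
  next
    case InL
    then show ?thesis using areach_plain[of "Basic b # ks" xs h _ "-1" p "Suc B" S] exec_Basic x by (simp add: stp1_def)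
  next
    case InR
    then show ?thesis using areach_plain[of "Basic b # ks" xs h _ 1 p "Suc B" S] exec_Basic x by (simp add: stp1_def)
  next
    case (Halt r)
    then have False using exec_Basic(1) unfolding stp1_def by blast
    then show ?thesis ..
  qed
next
  case (exec_Seq c x m y d n z)
  have 0: "areach p xs (Suc B) (2 * Suc B + 4) (Run ((c ;; d) # ks) Home, snd x, tape (fst x), 0)
     (Run (c # d # ks) Home, snd x, tape (fst x), 0)"
    using areach_plain[of "(c ;; d) # ks" xs "snd x" _ 0 p "Suc B" "fst x"] by simp
  have 1: "length (fst y s) \<le> B" for s by (rule exec_bounded[OF exec_Seq.hyps(1) exec_Seq.prems])
  show ?case
    using areach_trans[OF areach_trans[OF 0 exec_Seq.IH(1)[OF exec_Seq.prems, of "d # ks"]] exec_Seq.IH(2)[OF 1, of ks]]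
    by (simp add: algebra_simps)
next
  case (exec_CondT t x c n y d)
  have "areach p xs (Suc B) (2 * Suc B + 4) (Run (Cond t c d # ks) Home, snd x, tape (fst x), 0)
     (Run (c # ks) Home, snd x, tape (fst x), 0)"
    using areach_Cond[of "fst x" "Suc B" p xs t c d ks "snd x"] exec_CondT by (simp add: le_imp_less_Suc)
  from areach_trans[OF this exec_CondT.IH[OF exec_CondT.prems]] show ?case by (simp add: algebra_simps)
next
  case (exec_CondF t x d n y c)
  have "areach p xs (Suc B) (2 * Suc B + 4) (Run (Cond t c d # ks) Home, snd x, tape (fst x), 0)
     (Run (d # ks) Home, snd x, tape (fst x), 0)"
    using areach_Cond[of "fst x" "Suc B" p xs t c d ks "snd x"] exec_CondF by (simp add: le_imp_less_Suc)
  from areach_trans[OF this exec_CondF.IH[OF exec_CondF.prems]] show ?case by (simp add: algebra_simps)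
next
  case (exec_LoopF t x c)
  then show ?case
    using areach_Loop[of "fst x" "Suc B" p xs t c ks "snd x"] by (simp add: le_imp_less_Suc)
next
  case (exec_LoopT t x c m y n z)
  have 0: "areach p xs (Suc B) (2 * Suc B + 4) (Run (Loop t c # ks) Home, snd x, tape (fst x), 0)
     (Run (c # Loop t c # ks) Home, snd x, tape (fst x), 0)"
    using areach_Loop[of "fst x" "Suc B" p xs t c ks "snd x"] exec_LoopT by (simp add: le_imp_less_Suc)
  have 1: "length (fst y s) \<le> B" for s by (rule exec_bounded[OF exec_LoopT.hyps(2) exec_LoopT.prems])
  show ?case
    using areach_trans[OF areach_trans[OF 0 exec_LoopT.IH(1)[OF exec_LoopT.prems, of "Loop t c # ks"]]
      exec_LoopT.IH(2)[OF 1, of ks]]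
    by (simp add: algebra_simps)
qed

section \<open>Finiteness of the control\<close>

text \<open>Unrolling a loop leads back to \<open>Loop t c # ks\<close> after the body, so
  structural recursion already collects every continuation that can arise.\<close>

fun conts :: "('b, 't) com \<Rightarrow> ('b, 't) com list \<Rightarrow> ('b, 't) com list set" where
  "conts Skip ks = {Skip # ks, ks}"
| "conts (Basic b) ks = {Basic b # ks, ks}"
| "conts (c ;; d) ks = insert ((c ;; d) # ks) (conts c (d # ks) \<union> conts d ks)"
| "conts (Cond t c d) ks = insert (Cond t c d # ks) (conts c ks \<union> conts d ks)"
| "conts (Loop t c) ks = {Loop t c # ks, ks} \<union> conts c (Loop t c # ks)"

text \<open>The empty continuation is its own successor. This removes the exception
  \<open>js = ks\<close> of \<open>conts_succs\<close> in the case \<open>ks = []\<close>, which is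
  the one used for the machine.\<close>

fun succs :: "('b, 't) com list \<Rightarrow> ('b, 't) com list set" where
  "succs [] = {[]}"
| "succs (Skip # ks) = {ks}"
| "succs (Basic b # ks) = {ks}"
| "succs ((c ;; d) # ks) = {c # d # ks}"
| "succs (Cond t c d # ks) = {c # ks, d # ks}"
| "succs (Loop t c # ks) = {c # Loop t c # ks, ks}"

lemma finite_conts [simp]: "finite (conts c ks)"
  by (induction c arbitrary: ks) auto

lemma conts_self: "c # ks \<in> conts c ks" and conts_rest: "ks \<in> conts c ks"
  by (induction c arbitrary: ks) auto

lemma conts_succs: "js \<in> conts c ks \<Longrightarrow> js = ks \<or> succs js \<subseteq> conts c ks"
proof (induction c arbitrary: ks)
  case (Seq c d)
  have d: "succs js \<subseteq> conts d ks" if "js = d # ks" using Seq.IH(2)[of ks] that conts_self[of d ks] by auto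
  from Seq.prems consider "js = (c ;; d) # ks" | "js \<in> conts c (d # ks)" | "js \<in> conts d ks" by auto
  then show ?case
  proof cases
    case 1 then show ?thesis using conts_self[of c "d # ks"] by auto
  next
    case 2 then show ?thesis using Seq.IH(1)[of "d # ks"] d by auto
  next
    case 3 then show ?thesis using Seq.IH(2)[of ks] by auto
  qed
next
  case (Cond t c d)
  then show ?case using conts_self[of c ks] conts_self[of d ks] by fastforce
next
  case (Loop t c)
  from Loop.prems consider "js = Loop t c # ks" | "js = ks" | "js \<in> conts c (Loop t c # ks)" by auto
  then show ?case
  proof cases
    case 1 then show ?thesis using conts_self[of c "Loop t c # ks"] by auto
  next
    case 3 then show ?thesis using Loop.IH[of "Loop t c # ks"] conts_self[of c "Loop t c # ks"] by auto
  qed simp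
qed auto

definition ctrls :: "'s com1 \<Rightarrow> 's ctrl set" where
  "ctrls p = {Start, Acc, Rej} \<union> case_prod Run ` (conts p [] \<times> {Home, Seek, Edge, Back})"

lemma phase_UNIV: "ph \<in> {Home, Seek, Edge, Back}" by (cases ph) auto

lemma Run_in_ctrls [simp]: "Run ks ph \<in> ctrls p \<longleftrightarrow> ks \<in> conts p []"
  using phase_UNIV[of ph] by (force simp: ctrls_def)

lemma finite_ctrls: "finite (ctrls p)"
  by (auto simp: ctrls_def)

lemma ctrls_basic [simp]: "Start \<in> ctrls p" "Acc \<in> ctrls p" "Rej \<in> ctrls p"
  by (auto simp: ctrls_def)

lemma conts_closed: "ks \<in> conts p [] \<Longrightarrow> succs ks \<subseteq> conts p []"
  using conts_succs[of ks p "[]"] conts_rest[of "[]" p] by auto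

lemma after_succs: "after ks y \<in> insert ks (succs ks)"
  by (cases "(ks, y)" rule: after.cases) auto

lemma plain_succs: "focus ks = None \<Longrightarrow> ks \<in> conts p [] \<Longrightarrow> fst (plain ks a) \<in> ctrls p"
  using conts_closed[of ks p]
  by (cases "(ks, a)" rule: plain.cases) auto

lemma plain_move: "snd (plain ks a) \<in> {-1, 0, 1}"
  by (cases "(ks, a)" rule: plain.cases) auto

lemma delta_closed:
  assumes "q \<in> ctrls p" "delta p q a g = (q', d1, b, d2)"
  shows "q' \<in> ctrls p"
proof (cases q)
  case (Run ks ph)
  have ks: "ks \<in> conts p []" using assms Run by simp
  show ?thesis
  proof (cases ph)
    case Home
    then show ?thesis using assms Run plain_succs[of ks p a] ks by (auto split: option.splits prod.splits)
  next
    case Seek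
    have "tl ks \<in> conts p []" if "ks = Basic b # tl ks" for b
      using conts_closed[OF ks] that by (metis insert_subset succs.simps(3))
    then show ?thesis using assms Run Seek ks
      by (fastforce split: if_splits list.splits com.splits op1.splits)
  next
    case Edge
    then show ?thesis using assms Run ks after_succs[of ks "snd g (the (focus ks))"] conts_closed[OF ks] by auto
  next
    case Back
    then show ?thesis using assms Run ks by (auto split: if_splits)
  qed
qed (use assms conts_self[of p "[]"] in auto)


lemma delta_moves:
  assumes "delta p q a g = (q', d1, b, d2)"
  shows "d1 \<in> {-1, 0, 1} \<and> d2 \<in> {-1, 0, 1}"
proof (cases q)
  case (Run ks ph)
  show ?thesis
  proof (cases ph)
    case Home
    then show ?thesis using assms Run plain_move[of ks a]
      by (cases "focus ks"; cases "plain ks a") auto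
  next
    case Seek
    then show ?thesis using assms Run
      by (cases "snd g (the (focus ks)) = None")
        (auto split: list.splits com.splits op1.splits)
  next
    case Back
    then show ?thesis using assms Run by (cases "fst g") auto
  qed (use assms Run in auto)
qed (use assms in auto)

text \<open>The machine model prescribes the numbers of the start, accepting and rejecting states
  and of the blank symbol; the listed elements receive these numbers.\<close>

lemma ex_numbering:
  assumes "finite Q" "distinct as" "set as \<subseteq> Q"
  obtains f where "bij_betw f Q {0..<card Q}" "\<And>i. i < length as \<Longrightarrow> f (as ! i) = i"
proof -
  have "finite (Q - set as)" using assms by auto
  then obtain bs where bs: "set bs = Q - set as" "distinct bs" using finite_distinct_list by blast
  let ?l = "as @ bs"
  have l: "set ?l = Q" "distinct ?l" using assms bs by auto
  then have len: "length ?l = card Q" by (metis distinct_card)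
  have bij: "bij_betw ((!) ?l) {0..<card Q} Q"
    by (rule bij_betw_nth) (simp_all only: l len atLeast0LessThan)
  let ?f = "the_inv_into {0..<card Q} ((!) ?l)"
  have "bij_betw ?f Q {0..<card Q}" using bij by (rule bij_betw_the_inv_into)
  moreover have "?f (as ! i) = i" if "i < length as" for i
  proof -
    have "?f (?l ! i) = i" using bij that len
      by (intro the_inv_into_f_f) (auto simp: bij_betw_def)
    then show ?thesis using that by (simp add: nth_append)
  qed
  ultimately show thesis using that by blast
qed

lemma tape_empty: "(\<lambda>_. (False, \<lambda>_. None))(0 := (True, \<lambda>_. None)) = tape (\<lambda>_. [])"
proof
  fix i show "((\<lambda>_. (False, \<lambda>_. None))(0 := (True, \<lambda>_. None))) i = tape (\<lambda>_. []) i"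
    by (cases i) (auto simp: tape_Suc)
qed

text \<open>The machine is the same for all inputs and all \<open>B\<close>; the bound only limits
  which executions are considered. The accept decision is an arbitrary predicate on the top of one
  stack, tested by a final conditional. The head reaches cell \<open>B + 1\<close> at most, hence
  \<open>B + 2\<close> cells.\<close>

theorem tm_of_com1:
  fixes c :: "('s :: finite) com1"
  shows "\<exists>M. wf_tm M \<and> (\<forall>xs B n y. exec (stp1 B) (holds1 xs) c (\<lambda>_. [], 0) n y \<longrightarrow>
     tm_decides_within M xs (P (peek (fst y s))) (real ((n + 4) * (2 * B + 6))) (real (B + 2)))"
proof -
  define p where "p = c ;; Cond (Top s P) (Basic (Halt True)) (Basic (Halt False))"
  define blank :: "'s cell" where "blank = (False, \<lambda>_. None)"
  obtain f where f: "bij_betw f (ctrls p) {0..<card (ctrls p)}"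
    and f012: "\<And>i. i < length [Start, Acc, Rej] \<Longrightarrow> f ([Start, Acc, Rej] ! i) = i"
    by (rule ex_numbering[of "ctrls p" "[Start, Acc, Rej]"]) (auto simp: finite_ctrls)
  have fs: "f Start = 0" "f Acc = 1" "f Rej = 2"
    using f012[of 0] f012[of 1] f012[of 2] by auto
  obtain g where g: "bij_betw g (UNIV :: 's cell set) {0..<card (UNIV :: 's cell set)}"
    and g0: "\<And>i. i < length [blank] \<Longrightarrow> g ([blank] ! i) = i"
    by (rule ex_numbering[of "UNIV :: 's cell set" "[blank]"]) auto
  have gb: "g blank = 0" using g0[of 0] by simp
  define f' where "f' = the_inv_into (ctrls p) f"
  define g' where "g' = the_inv_into UNIV g"
  have f'f: "f' (f q) = q" if "q \<in> ctrls p" for q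
    unfolding f'_def using f that by (intro the_inv_into_f_f) (auto simp: bij_betw_def)
  have g'g: "g' (g z) = z" for z
    unfolding g'_def using g by (intro the_inv_into_f_f) (auto simp: bij_betw_def)
  have f'in: "f' q \<in> ctrls p" if "q < card (ctrls p)" for q
    unfolding f'_def using f that by (intro the_inv_into_into) (auto simp: bij_betw_def)
  have flt: "f q < card (ctrls p)" if "q \<in> ctrls p" for q
    using f that by (auto simp: bij_betw_def)
  have glt: "g z < card (UNIV :: 's cell set)" for z
    using g by (auto simp: bij_betw_def)
  define M where "M = \<lparr>tm_states = card (ctrls p), tm_syms = card (UNIV :: 's cell set),
    tm_delta = \<lambda>q a w. case delta p (f' q) a (g' w) of (q', d1, b, d2) \<Rightarrow> (f q', d1, g b, d2)\<rparr>"
  have "wf_tm M"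
  proof -
    have "3 \<le> card (ctrls p)" using flt[of Rej] fs by simp
    moreover have "1 \<le> card (UNIV :: 's cell set)" using glt[of blank] by simp
    moreover have "case tm_delta M q a w of (q', d1, b, d2) \<Rightarrow>
           q' < tm_states M \<and> b < tm_syms M \<and> d1 \<in> {-1, 0, 1} \<and> d2 \<in> {-1, 0, 1}"
      if "q < card (ctrls p)" for q a w
    proof -
      obtain q' d1 b d2 where d: "delta p (f' q) a (g' w) = (q', d1, b, d2)" by (metis surj_pair)
      show ?thesis using delta_moves[OF d] flt[OF delta_closed[OF f'in[OF that] d]] glt[of b] d
        by (simp add: M_def)
    qed
    ultimately show ?thesis by (auto simp: wf_tm_def M_def)
  qed
  moreover have "tm_decides_within M xs (P (peek (fst y s))) (real ((n + 4) * (2 * B + 6))) (real (B + 2))"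
    if ex: "exec (stp1 B) (holds1 xs) c (\<lambda>_. [], 0) n y" for xs B n y
  proof -
    define \<phi> where "\<phi> = (\<lambda>(q, i, w, h). (f q, i, g \<circ> w, h) :: config)"
    define c0 where "c0 = (Start :: 's ctrl, 0 :: nat, (\<lambda>_ :: nat. blank), 0 :: nat)"
    \<comment> \<open>Numbering states and symbols commutes with every step. This includes the
      halting states: \<open>Acc\<close> and \<open>Rej\<close> are fixed points of
      \<open>astep\<close>, as the states 1 and 2 are of \<open>tm_step\<close>.\<close>
    have run: "fst ((astep p xs ^^ t) c0) \<in> ctrls p \<and> tm_run M xs t = \<phi> ((astep p xs ^^ t) c0)" for t
    proof (induction t)
      case 0
      then show ?case by (auto simp: c0_def tm_run_def \<phi>_def tm_init_def fs gb)
    next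
      case (Suc t)
      obtain q i w h where e: "(astep p xs ^^ t) c0 = (q, i, w, h)" by (metis surj_pair)
      obtain q' d1 b d2 where d: "delta p q (input_sym xs i) (w h) = (q', d1, b, d2)" by (metis surj_pair)
      have q: "q \<in> ctrls p" using Suc e by simp
      have q12: "f q = 1 \<longleftrightarrow> q = Acc" "f q = 2 \<longleftrightarrow> q = Rej"
        using fs f'f[OF q] f'f[of Acc] f'f[of Rej] by auto
      have upd: "(g \<circ> w)(h := g b) = g \<circ> w(h := b)" by (auto simp: fun_eq_iff)
      have "tm_run M xs (Suc t) = tm_step M xs (f q, i, g \<circ> w, h)"
        using Suc e by (simp add: tm_run_def \<phi>_def)
      also have "\<dots> = \<phi> (astep p xs (q, i, w, h))"
        using d q12 fs f'f[OF q] upd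
        by (cases "q = Acc \<or> q = Rej") (auto simp: tm_step_def astep_def M_def g'g \<phi>_def)
      finally show ?case using delta_closed[OF q d] e d by (simp add: astep_def)
    qed
    obtain S h where y: "y = (S, h)" by force
    have bd: "length (S s) < Suc B" for s using exec_bounded[OF ex] y by (simp add: le_imp_less_Suc)
    let ?W = "Suc B" let ?T = "2 * Suc B + 4"
    let ?b = "P (peek (S s))"
    let ?H = "Cond (Top s P) (Basic (Halt True)) (Basic (Halt False))"
    have "astep p xs c0 = (Run [p] Home, 0, tape (\<lambda>_. []), 0)"
      using tape_empty by (simp add: astep_def c0_def blank_def)
    then have 0: "areach p xs ?W 1 c0 (Run [p] Home, 0, tape (\<lambda>_. []), 0)"
      using areach_step[of c0 ?W p xs] by (simp add: ahead_def c0_def)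
    have 1: "areach p xs ?W ?T (Run [p] Home, 0, tape (\<lambda>_. []), 0) (Run [c, ?H] Home, 0, tape (\<lambda>_. []), 0)"
      using areach_plain[of "[p]" xs 0 _ 0 p ?W "\<lambda>_. []"] by (simp add: p_def)
    have 2: "areach p xs ?W (n * ?T) (Run [c, ?H] Home, 0, tape (\<lambda>_. []), 0) (Run [?H] Home, h, tape S, 0)"
      using exec_areach[OF ex, of p "[?H]"] y by simp
    have 3: "areach p xs ?W ?T (Run [?H] Home, h, tape S, 0) (Run [Basic (Halt ?b)] Home, h, tape S, 0)"
      using areach_Cond[of S ?W p xs "Top s P" "Basic (Halt True)" "Basic (Halt False)" "[]" h, OF bd]
      by (auto split: if_splits)
    have 4: "areach p xs ?W ?T (Run [Basic (Halt ?b)] Home, h, tape S, 0) (if ?b then Acc else Rej, h, tape S, 0)"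
      using areach_plain[of "[Basic (Halt ?b)]" xs h _ 0 p ?W S] by simp
    \<comment> \<open>One step leaves \<open>Start\<close>; opening the sequence, the final test and
      the halt cost three rounds more, so \<open>n + 4\<close> rounds of \<open>?T\<close> steps
      suffice.\<close>
    have "areach p xs ?W (1 + ?T + n * ?T + ?T + ?T) c0 (if ?b then Acc else Rej, h, tape S, 0)"
      by (rule areach_trans[OF areach_trans[OF areach_trans[OF areach_trans[OF 0 1] 2] 3] 4])
    then obtain t where t: "t \<le> 1 + ?T + n * ?T + ?T + ?T"
        "(if ?b then Acc else Rej, h, tape S, 0) = (astep p xs ^^ t) c0"
        "\<And>t'. t' \<le> t \<Longrightarrow> ahead ((astep p xs ^^ t') c0) \<le> ?W"
      by (auto simp: areach_def)
    have wh: "work_head (tm_run M xs t') = ahead ((astep p xs ^^ t') c0)" for t'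
      using run[of t'] by (auto simp: work_head_def \<phi>_def ahead_def split: prod.splits)
    have "state_of (tm_run M xs t) = (if ?b then 1 else 2)"
      using run[of t] fs unfolding t(2)[symmetric] by (simp add: state_of_def \<phi>_def)
    moreover have "real t \<le> real ((n + 4) * (2 * B + 6))"
      using t(1) by (intro of_nat_mono) (simp add: algebra_simps)
    moreover have "real (work_head (tm_run M xs t') + 1) \<le> real (B + 2)" if "t' \<le> t" for t'
      using t(3)[OF that] wh[of t'] by simp
    ultimately show ?thesis unfolding tm_decides_within_def y by auto
  qed
  ultimately show ?thesis by blast
qed

subsection \<open>Stacks of binary numbers\<close>

fun bin :: "nat \<Rightarrow> bool list" where
  "bin v = (if v = 0 then [] else odd v # bin (v div 2))"

declare bin.simps [simp del]

lemma bin_0 [simp]: "bin 0 = []"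
  by (simp add: bin.simps)

lemma bin_eq_Nil [simp]: "bin v = [] \<longleftrightarrow> v = 0"
  by (simp add: bin.simps[of v])

text \<open>Binary increment with the least significant bit first: a run of ones turns into zeros
  and the next zero into a one. If \<open>r\<close> is empty the carry creates a new leading bit.
  The shape is the one that the loops of \<open>impl (Inc s)\<close> produce.\<close>

lemma bin_Suc:
  "\<exists>a r. bin v = replicate a True @ r \<and> (r = [] \<or> \<not> hd r) \<and>
     bin (Suc v) = replicate a False @ True # tl r"
proof (induction v rule: bin.induct)
  case (1 v)
  consider "v = 0" | "v > 0" "even v" | "odd v" by auto
  then show ?case
  proof cases
    case 1
    then show ?thesis by (intro exI[of _ 0] exI[of _ "[]"]) (simp add: bin.simps)
  next
    case 2
    then show ?thesis
      by (intro exI[of _ 0] exI[of _ "bin v"]) (auto simp: bin.simps[of v] bin.simps[of "Suc v"])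
  next
    case 3
    then have "v \<noteq> 0" by (metis even_zero)
    then obtain a r where ar: "bin (v div 2) = replicate a True @ r" "r = [] \<or> \<not> hd r"
      "bin (Suc (v div 2)) = replicate a False @ True # tl r" using "1.IH" by blast
    have "Suc v div 2 = Suc (v div 2)" using 3 by presburger
    then show ?thesis using 3 ar \<open>v \<noteq> 0\<close>
      by (intro exI[of _ "Suc a"] exI[of _ r]) (auto simp: bin.simps[of v] bin.simps[of "Suc v"])
  qed
qed

text \<open>The borrow is the mirror image of the carry. If the one that absorbs it is the leading
  bit, it disappears instead of becoming a zero, which keeps the representation free of leading
  zeros.\<close>

lemma bin_pred:
  "\<exists>a r. bin (Suc v) = replicate a False @ True # r \<and>
     bin v = replicate a True @ (if r = [] then [] else False # r)"
proof (induction v rule: bin.induct)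
  case (1 v)
  consider "v = 0" | "v > 0" "even v" | "odd v" by auto
  then show ?case
  proof cases
    case 1
    then show ?thesis by (intro exI[of _ 0] exI[of _ "[]"]) (simp add: bin.simps)
  next
    case 2
    then have "v div 2 \<noteq> 0" by auto
    with 2 show ?thesis
      by (intro exI[of _ 0] exI[of _ "bin (v div 2)"]) (auto simp: bin.simps[of v] bin.simps[of "Suc v"])
  next
    case 3
    then have "v \<noteq> 0" by (metis even_zero)
    then obtain a r where ar: "bin (Suc (v div 2)) = replicate a False @ True # r"
      "bin (v div 2) = replicate a True @ (if r = [] then [] else False # r)" using "1.IH" by blast
    have "Suc v div 2 = Suc (v div 2)" using 3 by presburger
    then show ?thesis using 3 ar \<open>v \<noteq> 0\<close>
      by (intro exI[of _ "Suc a"] exI[of _ r]) (auto simp: bin.simps[of v] bin.simps[of "Suc v"])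
  qed
qed

lemma length_bin: "v < 2 ^ w \<Longrightarrow> length (bin v) \<le> w"
proof (induction w arbitrary: v)
  case (Suc w)
  then have "v div 2 < 2 ^ w" by auto
  then show ?case using Suc.IH by (auto simp: bin.simps[of v])
qed simp

section \<open>Programs on stacks of numbers and their compilation\<close>

datatype 's op2 = Zero 's | Inc 's | Dec 's | Drop 's | Copy 's 's | Lft | Rgt

datatype 's tst2 = NZ 's | InT

type_synonym 's com2 = "('s op2, 's tst2) com"

type_synonym 's state2 = "('s \<Rightarrow> nat list) \<times> nat"

fun eff2 :: "'s op2 \<Rightarrow> 's state2 \<Rightarrow> 's state2" where
  "eff2 (Zero s) (\<sigma>, h) = (\<sigma>(s := 0 # \<sigma> s), h)"
| "eff2 (Inc s) (\<sigma>, h) = (\<sigma>(s := Suc (hd (\<sigma> s)) # tl (\<sigma> s)), h)"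
| "eff2 (Dec s) (\<sigma>, h) = (\<sigma>(s := (hd (\<sigma> s) - 1) # tl (\<sigma> s)), h)"
| "eff2 (Drop s) (\<sigma>, h) = (\<sigma>(s := tl (\<sigma> s)), h)"
| "eff2 (Copy s s') (\<sigma>, h) = (\<sigma>(s' := hd (\<sigma> s) # \<sigma> s'), h)"
| "eff2 Lft (\<sigma>, h) = (\<sigma>, h - 1)"
| "eff2 Rgt (\<sigma>, h) = (\<sigma>, h + 1)"

fun pre2 :: "nat \<Rightarrow> 's op2 \<Rightarrow> ('s \<Rightarrow> nat list) \<Rightarrow> bool" where
  "pre2 K (Zero s) \<sigma> = (length (\<sigma> s) < K)"
| "pre2 K (Inc s) \<sigma> = (\<sigma> s \<noteq> [])"
| "pre2 K (Dec s) \<sigma> = (\<sigma> s \<noteq> [])"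
| "pre2 K (Drop s) \<sigma> = (\<sigma> s \<noteq> [])"
| "pre2 K (Copy s s') \<sigma> = (s \<noteq> s' \<and> \<sigma> s \<noteq> [] \<and> length (\<sigma> s') < K)"
| "pre2 K b \<sigma> = True"

text \<open>\<open>K\<close> limits the number of entries of a stack, not their size; the size is
  bounded later by the length of the run.\<close>

definition stp2 :: "nat \<Rightarrow> 's op2 \<Rightarrow> 's state2 \<Rightarrow> 's state2 \<Rightarrow> bool" where
  "stp2 K b x y \<longleftrightarrow> pre2 K b (fst x) \<and> y = eff2 b x"

text \<open>On an empty stack \<open>NZ\<close> is true. This matches the compiled test, which only
  asks whether the top symbol differs from \<open>Sep\<close>.\<close>

fun holds2 :: "bool list \<Rightarrow> 's tst2 \<Rightarrow> 's state2 \<Rightarrow> bool" where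
  "holds2 xs (NZ s) (\<sigma>, h) = (peek (\<sigma> s) \<noteq> Some 0)"
| "holds2 xs InT (\<sigma>, h) = (input_sym xs h = Some True)"

abbreviation "pushB s b \<equiv> Basic (Push s (Bit b))"
abbreviation "popB s \<equiv> Basic (Pop s)"
abbreviation "isB s b \<equiv> Top s (\<lambda>x. x = Some (Bit b))"
abbreviation "notSep s \<equiv> Top s (\<lambda>x. x \<noteq> Some Sep)"

text \<open>Bits in front of the place to be changed are parked on the scratch stack
  \<open>None\<close> and then restored in changed form. On zero the three phases of
  \<open>Dec\<close> all find nothing to do, which is truncated subtraction. \<open>Copy\<close>
  reverses the bits onto the scratch stack and then refills source and target together, so both get
  the original order back.\<close>

fun impl :: "'s op2 \<Rightarrow> 's option com1" where
  "impl (Zero s) = Basic (Push (Some s) Sep)"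
| "impl (Inc s) =
    Loop (isB (Some s) True) (popB (Some s) ;; pushB None True) ;;
    Cond (isB (Some s) False) (popB (Some s)) Skip ;;
    pushB (Some s) True ;;
    Loop (isB None True) (popB None ;; pushB (Some s) False)"
| "impl (Dec s) =
    Loop (isB (Some s) False) (popB (Some s) ;; pushB None False) ;;
    Cond (isB (Some s) True)
      (popB (Some s) ;; Cond (notSep (Some s)) (pushB (Some s) False) Skip) Skip ;;
    Loop (isB None False) (popB None ;; pushB (Some s) True)"
| "impl (Drop s) = Loop (notSep (Some s)) (popB (Some s)) ;; popB (Some s)"
| "impl (Copy s s') =
    Basic (Push (Some s') Sep) ;;
    Loop (notSep (Some s)) (Cond (isB (Some s) True)
      (popB (Some s) ;; pushB None True) (popB (Some s) ;; pushB None False)) ;;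
    Loop (Top None (\<lambda>x. x \<noteq> None)) (Cond (isB None True)
      (popB None ;; pushB (Some s) True ;; pushB (Some s') True)
      (popB None ;; pushB (Some s) False ;; pushB (Some s') False))"
| "impl Lft = Basic InL"
| "impl Rgt = Basic InR"

fun implt :: "'s tst2 \<Rightarrow> 's option tst1" where
  "implt (NZ s) = notSep (Some s)"
| "implt InT = Inp (\<lambda>x. x = Some True)"

fun compile :: "'s com2 \<Rightarrow> 's option com1" where
  "compile Skip = Skip"
| "compile (Basic b) = impl b"
| "compile (c ;; d) = compile c ;; compile d"
| "compile (Cond t c d) = Cond (implt t) (compile c) (compile d)"
| "compile (Loop t c) = Loop (implt t) (compile c)"

text \<open>Numbers are stored in binary, least significant bit on top and without leading zeros, so that
  a number is zero iff the separator \<open>Sep\<close> is on top. The extra stack \<open>None\<close> is scratch space.\<close>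

definition code :: "nat \<Rightarrow> sym list" where
  "code v = map Bit (bin v) @ [Sep]"

fun enc :: "('s \<Rightarrow> nat list) \<Rightarrow> 's option \<Rightarrow> sym list" where
  "enc \<sigma> None = []"
| "enc \<sigma> (Some s) = concat (map code (\<sigma> s))"

abbreviation run1 :: "bool list \<Rightarrow> nat \<Rightarrow> 's com1 \<Rightarrow> 's state1 \<Rightarrow> nat \<Rightarrow> 's state1 \<Rightarrow> bool" where
  "run1 xs B \<equiv> runs (stp1 B) (holds1 xs)"

lemma run1_push:
  "S' = S(s := x # S s) \<Longrightarrow> (\<And>s. length (S s) \<le> B) \<Longrightarrow> length (S s) < B \<Longrightarrow>
   run1 xs B (Basic (Push s x)) (S, h) 1 (S', h)"
  by (intro runs_Basic) (auto simp: stp1_def)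

lemma run1_pop:
  "S' = S(s := tl (S s)) \<Longrightarrow> (\<And>s. length (S s) \<le> B) \<Longrightarrow>
   run1 xs B (Basic (Pop s)) (S, h) 1 (S', h)"
  by (intro runs_Basic) (auto simp: stp1_def intro: le_trans[OF diff_le_self])

definition bd :: "nat \<Rightarrow> ('s \<Rightarrow> sym list) \<Rightarrow> bool" where
  "bd B S \<longleftrightarrow> (\<forall>s. length (S s) \<le> B)"

text \<open>Carry and borrow both consist of two such transfers: a block of equal bits goes to the
  scratch stack and returns as a block of the opposite bit.\<close>

lemma run1_transfer:
  assumes "s \<noteq> s'" "bd B S" "S s = replicate a (Bit b) @ u" "peek u \<noteq> Some (Bit b)"
    "length (S s') + a \<le> B"
  shows "run1 xs B (Loop (isB s b) (popB s ;; pushB s' b')) (S, h) (4 * a + 1)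
     (S(s := u, s' := replicate a (Bit b') @ S s'), h)"
  using assms
proof (induction a arbitrary: S)
  case 0
  have "S(s := u, s' := S s') = S" using 0 by (auto simp: fun_eq_iff)
  then show ?case using 0 runs_LoopF[of "holds1 xs" "isB s b" "(S, h)" "stp1 B"] by (simp del: fun_upd_apply)
next
  case (Suc a)
  let ?S1 = "S(s := replicate a (Bit b) @ u)"
  let ?S = "?S1(s' := Bit b' # S s')"
  have 1: "run1 xs B (popB s) (S, h) 1 (?S1, h)"
    by (rule run1_pop) (use Suc in \<open>auto simp: bd_def fun_eq_iff\<close>)
  have len: "length (replicate a (Bit b) @ u) \<le> B" using Suc.prems(2)[unfolded bd_def, rule_format, of s] Suc.prems(3) by simp
  have 2: "run1 xs B (pushB s' b') (?S1, h) 1 (?S, h)"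
    by (rule run1_push) (use Suc len in \<open>auto simp: bd_def fun_eq_iff\<close>)
  have 3: "run1 xs B (Loop (isB s b) (popB s ;; pushB s' b')) (?S, h) (4 * a + 1)
     (?S(s := u, s' := replicate a (Bit b') @ ?S s'), h)"
    by (rule Suc.IH) (use Suc len in \<open>auto simp: bd_def\<close>)
  have eq: "?S(s := u, s' := replicate a (Bit b') @ ?S s') = S(s := u, s' := replicate (Suc a) (Bit b') @ S s')"
    using Suc.prems(1) by (auto simp: fun_eq_iff replicate_app_Cons_same)
  show ?case using runs_LoopT[OF _ runs_Seq[OF 1 2] 3] Suc.prems(3) unfolding eq
    by (simp add: numeral_eq_Suc del: fun_upd_apply)
qed

lemma run1_discard:
  assumes "bd B S" "S s = map Bit bs @ Sep # u"
  shows "run1 xs B (Loop (notSep s) (popB s)) (S, h) (2 * length bs + 1) (S(s := Sep # u), h)"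
  using assms
proof (induction bs arbitrary: S)
  case Nil
  have "S(s := Sep # u) = S" using Nil by (auto simp: fun_eq_iff)
  then show ?case using Nil runs_LoopF[of "holds1 xs" "notSep s" "(S, h)" "stp1 B"] by (simp del: fun_upd_apply)
next
  case (Cons b bs)
  let ?S = "S(s := map Bit bs @ Sep # u)"
  have 1: "run1 xs B (popB s) (S, h) 1 (?S, h)"
    by (rule run1_pop) (use Cons in \<open>auto simp: bd_def fun_eq_iff\<close>)
  have len: "length (map Bit bs @ Sep # u) \<le> B" using Cons.prems(1)[unfolded bd_def, rule_format, of s] Cons.prems(2) by simp
  have 3: "run1 xs B (Loop (notSep s) (popB s)) (?S, h) (2 * length bs + 1) (?S(s := Sep # u), h)"
    by (rule Cons.IH) (use Cons len in \<open>auto simp: bd_def\<close>)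
  show ?case using runs_LoopT[OF _ 1 3] Cons.prems(2) by (simp del: fun_upd_apply)
qed

lemma run1_unload:
  assumes "s \<noteq> s'" "bd B S" "S s = map Bit bs @ Sep # u" "length (S s') + length bs \<le> B"
  shows "run1 xs B (Loop (notSep s) (Cond (isB s True) (popB s ;; pushB s' True) (popB s ;; pushB s' False)))
     (S, h) (5 * length bs + 1) (S(s := Sep # u, s' := map Bit (rev bs) @ S s'), h)"
  using assms
proof (induction bs arbitrary: S)
  case Nil
  have "S(s := Sep # u, s' := S s') = S" using Nil by (auto simp: fun_eq_iff)
  then show ?case using Nil runs_LoopF[of "holds1 xs" "notSep s" "(S, h)" "stp1 B"] by (simp del: fun_upd_apply)
next
  case (Cons b bs)
  let ?S1 = "S(s := map Bit bs @ Sep # u)"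
  let ?S = "?S1(s' := Bit b # S s')"
  have 1: "run1 xs B (popB s) (S, h) 1 (?S1, h)"
    by (rule run1_pop) (use Cons in \<open>auto simp: bd_def fun_eq_iff\<close>)
  have len: "length (map Bit bs @ Sep # u) \<le> B" using Cons.prems(2)[unfolded bd_def, rule_format, of s] Cons.prems(3) by simp
  have 2: "run1 xs B (pushB s' b) (?S1, h) 1 (?S, h)"
    by (rule run1_push) (use Cons len in \<open>auto simp: bd_def fun_eq_iff\<close>)
  have 4: "run1 xs B (Cond (isB s True) (popB s ;; pushB s' True) (popB s ;; pushB s' False)) (S, h) 4 (?S, h)"
    using runs_CondT[OF _ runs_Seq[OF 1 2], where t = "isB s True"] runs_CondF[OF _ runs_Seq[OF 1 2], where t = "isB s True"] Cons.prems
    by (cases b) (auto simp: eval_nat_numeral)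
  have 3: "run1 xs B (Loop (notSep s) (Cond (isB s True) (popB s ;; pushB s' True) (popB s ;; pushB s' False)))
     (?S, h) (5 * length bs + 1) (?S(s := Sep # u, s' := map Bit (rev bs) @ ?S s'), h)"
    by (rule Cons.IH) (use Cons len in \<open>auto simp: bd_def\<close>)
  have eq: "?S(s := Sep # u, s' := map Bit (rev bs) @ ?S s') = S(s := Sep # u, s' := map Bit (rev (b # bs)) @ S s')"
    using Cons.prems(1) by (auto simp: fun_eq_iff)
  show ?case using runs_LoopT[OF _ 4 3] Cons.prems(3) unfolding eq by (simp del: fun_upd_apply)
qed

lemma run1_reload:
  assumes "s \<noteq> s'" "t \<noteq> s" "t \<noteq> s'" "bd B S" "S t = map Bit bs"
    "length (S s) + length bs \<le> B" "length (S s') + length bs \<le> B"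
  shows "run1 xs B (Loop (Top t (\<lambda>x. x \<noteq> None)) (Cond (isB t True)
      (popB t ;; pushB s True ;; pushB s' True) (popB t ;; pushB s False ;; pushB s' False)))
     (S, h) (7 * length bs + 1) (S(t := [], s := map Bit (rev bs) @ S s, s' := map Bit (rev bs) @ S s'), h)"
  using assms
proof (induction bs arbitrary: S)
  case Nil
  have "S(t := [], s := S s, s' := S s') = S" using Nil by (auto simp: fun_eq_iff)
  then show ?case using Nil runs_LoopF[of "holds1 xs" "Top t (\<lambda>x. x \<noteq> None)" "(S, h)" "stp1 B"] by (simp del: fun_upd_apply)
next
  case (Cons b bs)
  let ?S1 = "S(t := map Bit bs)"
  let ?S2 = "?S1(s := Bit b # S s)"
  let ?S = "?S2(s' := Bit b # S s')"
  have 1: "run1 xs B (popB t) (S, h) 1 (?S1, h)"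
    by (rule run1_pop) (use Cons in \<open>auto simp: bd_def fun_eq_iff\<close>)
  have len: "length bs \<le> B" using Cons.prems by auto
  have 2: "run1 xs B (pushB s b) (?S1, h) 1 (?S2, h)"
    by (rule run1_push) (use Cons len in \<open>auto simp: bd_def fun_eq_iff\<close>)
  have 3: "run1 xs B (pushB s' b) (?S2, h) 1 (?S, h)"
    by (rule run1_push) (use Cons len in \<open>auto simp: bd_def fun_eq_iff\<close>)
  have 4: "run1 xs B (Cond (isB t True) (popB t ;; pushB s True ;; pushB s' True)
      (popB t ;; pushB s False ;; pushB s' False)) (S, h) 6 (?S, h)"
    using runs_CondT[OF _ runs_Seq[OF 1 runs_Seq[OF 2 3]], where t = "isB t True"]
      runs_CondF[OF _ runs_Seq[OF 1 runs_Seq[OF 2 3]], where t = "isB t True"] Cons.prems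
    by (cases b) (auto simp: eval_nat_numeral)
  have 5: "run1 xs B (Loop (Top t (\<lambda>x. x \<noteq> None)) (Cond (isB t True)
      (popB t ;; pushB s True ;; pushB s' True) (popB t ;; pushB s False ;; pushB s' False)))
     (?S, h) (7 * length bs + 1) (?S(t := [], s := map Bit (rev bs) @ ?S s, s' := map Bit (rev bs) @ ?S s'), h)"
    by (rule Cons.IH) (use Cons len in \<open>auto simp: bd_def\<close>)
  have eq: "?S(t := [], s := map Bit (rev bs) @ ?S s, s' := map Bit (rev bs) @ ?S s') =
      S(t := [], s := map Bit (rev (b # bs)) @ S s, s' := map Bit (rev (b # bs)) @ S s')"
    using Cons.prems(1-3) by (auto simp: fun_eq_iff)
  show ?case using runs_LoopT[OF _ 4 5] Cons.prems(5) unfolding eq by (simp del: fun_upd_apply)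
qed


lemma enc_upd: "enc (\<sigma>(s := ys)) = (enc \<sigma>)(Some s := concat (map code ys))"
proof
  fix t show "enc (\<sigma>(s := ys)) t = ((enc \<sigma>)(Some s := concat (map code ys))) t"
    by (cases t) auto
qed

text \<open>The summand 1 is the separator of each number.\<close>

lemma length_codes:
  "\<forall>v\<in>set vs. v < 2 ^ w \<Longrightarrow> length (concat (map code vs)) \<le> length vs * (w + 1)"
  by (induction vs) (auto simp: code_def dest: length_bin)

lemma length_enc:
  assumes "length (\<sigma> s) \<le> K" "\<forall>v\<in>set (\<sigma> s). v < 2 ^ w"
  shows "length (enc \<sigma> (Some s)) \<le> K * (w + 1)"
  using le_trans[OF length_codes[OF assms(2)] mult_le_mono1[OF assms(1)]] by simp

lemma run1_Inc:
  assumes room: "\<And>t. length (enc \<sigma> t) + w < B" and v: "\<sigma> s = v # vs" "v < 2 ^ w"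
  shows "run1 xs B (impl (Inc s)) (enc \<sigma>, h) (8 * w + 8) (enc (\<sigma>(s := Suc v # vs)), h)"
proof -
  obtain a r where ar: "bin v = replicate a True @ r" "r = [] \<or> \<not> hd r"
    "bin (Suc v) = replicate a False @ True # tl r" using bin_Suc by blast
  let ?U = "Sep # concat (map code vs)"
  have w: "a + length r \<le> w" using length_bin[OF v(2)] ar(1) by simp
  have es: "enc \<sigma> (Some s) = replicate a (Bit True) @ map Bit r @ ?U"
    using v ar(1) by (simp add: code_def)
  have bd0: "length (enc \<sigma> t) \<le> B" for t using room[of t] by simp
  have U: "length ?U + a + length r + w < B" using room[of "Some s"] es by simp
  let ?S1 = "(enc \<sigma>)(Some s := map Bit r @ ?U, None := replicate a (Bit True))"
  have 1: "run1 xs B (Loop (isB (Some s) True) (popB (Some s) ;; pushB None True)) (enc \<sigma>, h) (4 * a + 1) (?S1, h)"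
    using run1_transfer[of "Some s" None B "enc \<sigma>" a True "map Bit r @ ?U" xs True h] es bd0 ar(2) w U
    by (cases r) (auto simp: bd_def)
  let ?S2 = "?S1(Some s := map Bit (tl r) @ ?U)"
  have bd1: "length (?S1 t) \<le> B" for t using bd0[of t] U by auto
  have 2: "run1 xs B (Cond (isB (Some s) False) (popB (Some s)) Skip) (?S1, h) 2 (?S2, h)"
  proof (cases r)
    case Nil
    then have "?S2 = ?S1" by (auto simp: fun_eq_iff)
    then show ?thesis using runs_CondF[OF _ runs_Skip, of "holds1 xs" "isB (Some s) False" "(?S1, h)" "stp1 B"] Nil
      by (simp del: fun_upd_apply add: fun_upd_same fun_upd_other numeral_2_eq_2)
  next
    case (Cons b r')
    have "run1 xs B (popB (Some s)) (?S1, h) 1 (?S2, h)"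
      by (rule run1_pop[OF _ bd1]) (auto simp: Cons)
    from runs_CondT[OF _ this, of "isB (Some s) False"] show ?thesis using Cons ar(2) by (simp add: numeral_2_eq_2 del: fun_upd_apply add: fun_upd_same fun_upd_other)
  qed
  let ?S3 = "?S2(Some s := Bit True # map Bit (tl r) @ ?U)"
  have bd2: "length (?S2 t) \<le> B" for t using bd1[of t] U by (auto split: if_splits)
  have 3: "run1 xs B (pushB (Some s) True) (?S2, h) 1 (?S3, h)"
    by (rule run1_push[OF _ bd2]) (use U w in auto)
  have bd3: "length (?S3 t) \<le> B" for t using bd2[of t] U w by (auto split: if_splits)
  have 4: "run1 xs B (Loop (isB None True) (popB None ;; pushB (Some s) False)) (?S3, h) (4 * a + 1)
     (?S3(None := [], Some s := replicate a (Bit False) @ ?S3 (Some s)), h)"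
    by (rule run1_transfer) (use bd3 U w in \<open>auto simp: bd_def\<close>)
  have "?S3(None := [], Some s := replicate a (Bit False) @ ?S3 (Some s)) = enc (\<sigma>(s := Suc v # vs))"
  proof
    fix t show "(?S3(None := [], Some s := replicate a (Bit False) @ ?S3 (Some s))) t = enc (\<sigma>(s := Suc v # vs)) t"
      using ar(3) by (cases t) (auto simp: code_def)
  qed
  with runs_Seq[OF 1 runs_Seq[OF 2 runs_Seq[OF 3 4]]]
  show ?thesis using w by (auto elim!: runs_mono)
qed

lemma run1_Dec:
  assumes room: "\<And>t. length (enc \<sigma> t) + w < B" and v: "\<sigma> s = v # vs" "v < 2 ^ w"
  shows "run1 xs B (impl (Dec s)) (enc \<sigma>, h) (8 * w + 12) (enc (\<sigma>(s := (v - 1) # vs)), h)"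
proof (cases v)
  case 0
  have bd0: "length (enc \<sigma> t) \<le> B" for t using room[of t] by simp
  have 1: "run1 xs B (Loop (isB (Some s) False) (popB (Some s) ;; pushB None False)) (enc \<sigma>, h) 1 (enc \<sigma>, h)"
    by (rule runs_LoopF) (use v 0 in \<open>auto simp: code_def\<close>)
  have 2: "run1 xs B (Cond (isB (Some s) True)
      (popB (Some s) ;; Cond (notSep (Some s)) (pushB (Some s) False) Skip) Skip) (enc \<sigma>, h) 2 (enc \<sigma>, h)"
    using runs_CondF[OF _ runs_Skip, of "holds1 xs" "isB (Some s) True" "(enc \<sigma>, h)" "stp1 B"] v 0 by (simp add: code_def numeral_2_eq_2)
  have 3: "run1 xs B (Loop (isB None False) (popB None ;; pushB (Some s) True)) (enc \<sigma>, h) 1 (enc \<sigma>, h)"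
    by (rule runs_LoopF) simp
  have "\<sigma>(s := (v - 1) # vs) = \<sigma>" using v 0 by auto
  then show ?thesis using runs_mono[OF runs_Seq[OF 1 runs_Seq[OF 2 3]], of "8 * w + 12"] by (simp del: fun_upd_apply)
next
  case (Suc v')
  obtain a r where ar: "bin v = replicate a False @ True # r"
    "bin v' = replicate a True @ (if r = [] then [] else False # r)" using bin_pred Suc by blast
  let ?U = "Sep # concat (map code vs)"
  let ?r = "if r = [] then [] else False # r"
  have w: "a + length r < w" using length_bin[OF v(2)] ar(1) by simp
  have es: "enc \<sigma> (Some s) = replicate a (Bit False) @ Bit True # map Bit r @ ?U"
    using v ar(1) by (simp add: code_def)
  have bd0: "length (enc \<sigma> t) \<le> B" for t using room[of t] by simp
  have U: "length ?U + a + length r + 1 + w < B" using room[of "Some s"] es by simp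
  let ?S1 = "(enc \<sigma>)(Some s := Bit True # map Bit r @ ?U, None := replicate a (Bit False))"
  have 1: "run1 xs B (Loop (isB (Some s) False) (popB (Some s) ;; pushB None False)) (enc \<sigma>, h) (4 * a + 1) (?S1, h)"
    using run1_transfer[of "Some s" None B "enc \<sigma>" a False "Bit True # map Bit r @ ?U" xs False h] es bd0 w U
    by (auto simp: bd_def)
  let ?S2 = "?S1(Some s := map Bit r @ ?U)"
  let ?S3 = "?S1(Some s := map Bit ?r @ ?U)"
  have bd1: "length (?S1 t) \<le> B" for t using bd0[of t] U by auto
  have bd2: "length (?S2 t) \<le> B" for t using bd1[of t] U by (auto split: if_splits)
  have 2: "run1 xs B (popB (Some s)) (?S1, h) 1 (?S2, h)"
    by (rule run1_pop[OF _ bd1]) auto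
  have 3: "run1 xs B (Cond (notSep (Some s)) (pushB (Some s) False) Skip) (?S2, h) 2 (?S3, h)"
  proof (cases r)
    case Nil
    then have "?S3 = ?S2" by (auto simp: fun_eq_iff)
    then show ?thesis using runs_CondF[OF _ runs_Skip, of "holds1 xs" "notSep (Some s)" "(?S2, h)" "stp1 B"] Nil
      by (simp del: fun_upd_apply add: fun_upd_same fun_upd_other numeral_2_eq_2)
  next
    case (Cons b r')
    have "run1 xs B (pushB (Some s) False) (?S2, h) 1 (?S3, h)"
      by (rule run1_push[OF _ bd2]) (use Cons U w in auto)
    from runs_CondT[OF _ this, of "notSep (Some s)"] show ?thesis using Cons
      by (simp add: numeral_2_eq_2 del: fun_upd_apply add: fun_upd_same fun_upd_other)
  qed
  have 4: "run1 xs B (Cond (isB (Some s) True)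
      (popB (Some s) ;; Cond (notSep (Some s)) (pushB (Some s) False) Skip) Skip) (?S1, h) 5 (?S3, h)"
    using runs_CondT[OF _ runs_Seq[OF 2 3], where t = "isB (Some s) True"] by (simp add: numeral_eq_Suc)
  have bd3: "length (?S3 t) \<le> B" for t using bd1[of t] U w by (auto split: if_splits)
  have 5: "run1 xs B (Loop (isB None False) (popB None ;; pushB (Some s) True)) (?S3, h) (4 * a + 1)
     (?S3(None := [], Some s := replicate a (Bit True) @ ?S3 (Some s)), h)"
    by (rule run1_transfer) (use bd3 U w in \<open>auto simp: bd_def\<close>)
  have "?S3(None := [], Some s := replicate a (Bit True) @ ?S3 (Some s)) = enc (\<sigma>(s := (v - 1) # vs))"
  proof
    fix t show "(?S3(None := [], Some s := replicate a (Bit True) @ ?S3 (Some s))) t = enc (\<sigma>(s := (v - 1) # vs)) t"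
      using ar(2) Suc by (cases t) (auto simp: code_def)
  qed
  with runs_Seq[OF 1 runs_Seq[OF 4 5]]
  show ?thesis using w by (auto elim!: runs_mono)
qed

lemma run1_Drop:
  assumes room: "\<And>t. length (enc \<sigma> t) + w < B" and v: "\<sigma> s = v # vs" "v < 2 ^ w"
  shows "run1 xs B (impl (Drop s)) (enc \<sigma>, h) (2 * w + 3) (enc (\<sigma>(s := vs)), h)"
proof -
  have bd0: "length (enc \<sigma> t) \<le> B" for t using room[of t] by simp
  let ?S = "(enc \<sigma>)(Some s := Sep # concat (map code vs))"
  have 1: "run1 xs B (Loop (notSep (Some s)) (popB (Some s))) (enc \<sigma>, h) (2 * length (bin v) + 1) (?S, h)"
    by (rule run1_discard) (use bd0 v in \<open>auto simp: bd_def code_def\<close>)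
  have "length (?S t) \<le> B" for t using bd0[of t] v by (auto simp: code_def)
  then have 2: "run1 xs B (popB (Some s)) (?S, h) 1 (enc (\<sigma>(s := vs)), h)"
    by (intro run1_pop) (auto simp: enc_upd)
  show ?thesis using runs_Seq[OF 1 2] length_bin[OF v(2)] by (auto elim!: runs_mono)
qed

lemma run1_Copy:
  assumes room: "\<And>t. length (enc \<sigma> t) + w + 1 < B" and v: "\<sigma> s = v # vs" "v < 2 ^ w" "s \<noteq> s'"
  shows "run1 xs B (impl (Copy s s')) (enc \<sigma>, h) (12 * w + 5) (enc (\<sigma>(s' := v # \<sigma> s')), h)"
proof -
  have bd0: "length (enc \<sigma> t) \<le> B" for t using room[of t] by simp
  let ?U = "Sep # concat (map code vs)"
  let ?V = "Sep # enc \<sigma> (Some s')"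
  have es: "enc \<sigma> (Some s) = map Bit (bin v) @ ?U"
    using v by (simp add: code_def)
  have w: "length (bin v) \<le> w" using length_bin[OF v(2)] .
  have U: "length ?U + w < B" using room[of "Some s"] es by simp
  have V: "length ?V + w < B" using room[of "Some s'"] by simp
  let ?S1 = "(enc \<sigma>)(Some s' := ?V)"
  have 1: "run1 xs B (Basic (Push (Some s') Sep)) (enc \<sigma>, h) 1 (?S1, h)"
    by (rule run1_push[OF _ bd0]) (use V in auto)
  have bd1: "length (?S1 t) \<le> B" for t using bd0[of t] V by auto
  have 2: "run1 xs B (Loop (notSep (Some s)) (Cond (isB (Some s) True)
      (popB (Some s) ;; pushB None True) (popB (Some s) ;; pushB None False))) (?S1, h) (5 * length (bin v) + 1)
      (?S1(Some s := ?U, None := map Bit (rev (bin v)) @ ?S1 None), h)" (is "run1 _ _ _ _ _ (?S2, h)")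
    by (rule run1_unload) (use bd1 es v(3) w U in \<open>auto simp: bd_def\<close>)
  have bd2: "length (?S2 t) \<le> B" for t using bd1[of t] U w by (auto split: if_splits)
  have 3: "run1 xs B (Loop (Top None (\<lambda>x. x \<noteq> None)) (Cond (isB None True)
      (popB None ;; pushB (Some s) True ;; pushB (Some s') True)
      (popB None ;; pushB (Some s) False ;; pushB (Some s') False))) (?S2, h) (7 * length (rev (bin v)) + 1)
      (?S2(None := [], Some s := map Bit (rev (rev (bin v))) @ ?S2 (Some s),
         Some s' := map Bit (rev (rev (bin v))) @ ?S2 (Some s')), h)"
    by (rule run1_reload) (use bd2 v(3) w U V in \<open>auto simp: bd_def\<close>)
  have "?S2(None := [], Some s := map Bit (rev (rev (bin v))) @ ?S2 (Some s),
         Some s' := map Bit (rev (rev (bin v))) @ ?S2 (Some s')) = enc (\<sigma>(s' := v # \<sigma> s'))"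
    (is "?l = ?r")
  proof
    fix t show "?l t = ?r t"
      using v by (cases t) (auto simp: code_def)
  qed
  with runs_Seq[OF 1 runs_Seq[OF 2 3]]
  show ?thesis using w by (auto elim!: runs_mono)
qed

definition small :: "nat \<Rightarrow> nat \<Rightarrow> ('s \<Rightarrow> nat list) \<Rightarrow> bool" where
  "small K V \<sigma> \<longleftrightarrow> (\<forall>s. length (\<sigma> s) \<le> K \<and> (\<forall>v\<in>set (\<sigma> s). v \<le> V))"

text \<open>\<open>K\<close> numbers of \<open>w\<close> bits and a separator fill a stack; the room
  of two further numbers covers the intermediate states of the operations. The time is the maximum
  over all operations, the leading term coming from \<open>Copy\<close> and the constant from
  \<open>Dec\<close>.\<close>

lemma run1_impl:
  assumes "stp2 K b x y" "small K V (fst x)" "V < 2 ^ w"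
  shows "run1 xs ((K + 2) * (w + 1)) (impl b) (enc (fst x), snd x) (12 * w + 12) (enc (fst y), snd y)"
proof -
  obtain \<sigma> h where x: "x = (\<sigma>, h)" by force
  let ?B = "(K + 2) * (w + 1)"
  have room: "length (enc \<sigma> t) + w + 1 < ?B" for t
  proof (cases t)
    case (Some s)
    have "length (enc \<sigma> t) \<le> K * (w + 1)"
      unfolding Some using assms(2,3) x by (intro length_enc ballI le_less_trans[OF _ assms(3)]) (auto simp: small_def)
    then show ?thesis by (simp add: algebra_simps)
  qed simp
  have room': "length (enc \<sigma> t) + w < ?B" for t using room[of t] by simp
  have room'': "length (enc \<sigma> t) < ?B" for t using room[of t] by simp
  have lt: "hd (\<sigma> s) < 2 ^ w" if "\<sigma> s \<noteq> []" for s
    using assms(2,3) x hd_in_set[OF that] unfolding small_def by (auto intro: le_less_trans)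
  have y: "y = eff2 b (\<sigma>, h)" and pre: "pre2 K b \<sigma>" using assms(1) x by (auto simp: stp2_def)
  show ?thesis
  proof (cases b)
    case (Zero s)
    have "run1 xs ?B (impl b) (enc \<sigma>, h) 1 (enc (\<sigma>(s := 0 # \<sigma> s)), h)"
      unfolding Zero impl.simps
      by (rule run1_push) (use room'' room''[of "Some s"] in \<open>auto simp: enc_upd code_def less_imp_le\<close>)
    then show ?thesis using x y Zero by (auto elim!: runs_mono)
  next
    case (Inc s)
    then obtain v vs where v: "\<sigma> s = v # vs" using pre by (cases "\<sigma> s") auto
    then have "v < 2 ^ w" using lt[of s] by simp
    from run1_Inc[OF room' v this, of xs h] show ?thesis using x y Inc v
      by (auto elim!: runs_mono simp del: impl.simps)
  next
    case (Dec s)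
    then obtain v vs where v: "\<sigma> s = v # vs" using pre by (cases "\<sigma> s") auto
    then have "v < 2 ^ w" using lt[of s] by simp
    from run1_Dec[OF room' v this, of xs h] show ?thesis using x y Dec v
      by (auto elim!: runs_mono simp del: impl.simps)
  next
    case (Drop s)
    then obtain v vs where v: "\<sigma> s = v # vs" using pre by (cases "\<sigma> s") auto
    then have "v < 2 ^ w" using lt[of s] by simp
    from run1_Drop[OF room' v this, of xs h] show ?thesis using x y Drop v
      by (auto elim!: runs_mono simp del: impl.simps)
  next
    case (Copy s s')
    then obtain v vs where v: "\<sigma> s = v # vs" using pre by (cases "\<sigma> s") auto
    then have "v < 2 ^ w" using lt[of s] by simp
    from run1_Copy[OF room v this, of s' xs h] show ?thesis using x y Copy v pre
      by (auto elim!: runs_mono simp del: impl.simps)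
  next
    case Lft
    have "run1 xs ?B (impl b) (enc \<sigma>, h) 1 (enc \<sigma>, h - 1)"
      unfolding Lft impl.simps by (intro runs_Basic) (use room'' in \<open>auto simp: stp1_def less_imp_le\<close>)
    then show ?thesis using x y Lft by (auto elim!: runs_mono)
  next
    case Rgt
    have "run1 xs ?B (impl b) (enc \<sigma>, h) 1 (enc \<sigma>, h + 1)"
      unfolding Rgt impl.simps by (intro runs_Basic) (use room'' in \<open>auto simp: stp1_def less_imp_le\<close>)
    then show ?thesis using x y Rgt by (auto elim!: runs_mono)
  qed
qed

lemma holds_implt: "holds1 xs (implt t) (enc (fst x), snd x) = holds2 xs t x"
proof -
  obtain \<sigma> h where x: "x = (\<sigma>, h)" by force
  show ?thesis
  proof (cases t)
    case (NZ s)
    show ?thesis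
    proof (cases "\<sigma> s")
      case Nil
      then show ?thesis using NZ x by simp
    next
      case (Cons v vs)
      have "peek (map Bit (bin v) @ Sep # u) \<noteq> Some Sep \<longleftrightarrow> v \<noteq> 0" for u
        by (cases "bin v") (auto simp: bin_eq_Nil[symmetric] simp del: bin_eq_Nil)
      then show ?thesis using NZ x Cons by (simp add: code_def)
    qed
  next
    case InT
    then show ?thesis using x by simp
  qed
qed

lemma stp2_small:
  assumes "stp2 K b x y" "small K V (fst x)"
  shows "small K (Suc V) (fst y)"
proof -
  obtain \<sigma> h where x: "x = (\<sigma>, h)" by force
  have y: "y = eff2 b (\<sigma>, h)" and pre: "pre2 K b \<sigma>" using assms(1) x by (auto simp: stp2_def)
  have s: "length (\<sigma> s) \<le> K" "\<forall>v\<in>set (\<sigma> s). v \<le> V" for s using assms(2) x by (auto simp: small_def)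
  have s': "v \<in> set (\<sigma> s) \<Longrightarrow> v \<le> Suc V" for v s using s(2)[of s] by auto
  have hd: "\<sigma> s \<noteq> [] \<Longrightarrow> hd (\<sigma> s) \<le> V" for s using s(2)[of s] by (cases "\<sigma> s") auto
  have hd': "\<sigma> s \<noteq> [] \<Longrightarrow> hd (\<sigma> s) \<le> Suc V" "\<sigma> s \<noteq> [] \<Longrightarrow> hd (\<sigma> s) - Suc 0 \<le> Suc V" for s
    using hd[of s] by auto
  have tl: "v \<in> set (tl (\<sigma> s)) \<Longrightarrow> v \<le> Suc V" for v s using s'[of v s] by (cases "\<sigma> s") auto
  have len: "\<sigma> s \<noteq> [] \<Longrightarrow> Suc (length (\<sigma> s) - Suc 0) \<le> K" "length (\<sigma> s) - Suc 0 \<le> K" for s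
    using s(1)[of s] by (cases "\<sigma> s"; simp)+
  show ?thesis
    by (cases b) (use y pre s(1) s' hd hd' tl len in \<open>auto simp: small_def Suc_le_eq intro: le_imp_less_Suc\<close>)
qed

text \<open>The cost \<open>n\<close> has a second use as a bound on the growth of entries: a step
  raises the largest entry by at most one. One word length \<open>w\<close> therefore serves the
  whole run.\<close>

lemma exec_comp:
  assumes "exec (stp2 K) (holds2 xs) c x n y" "small K V (fst x)" "V + n < 2 ^ w"
  shows "run1 xs ((K + 2) * (w + 1)) (compile c) (enc (fst x), snd x) (n * (12 * w + 12)) (enc (fst y), snd y)
    \<and> small K (V + n) (fst y)"
  using assms
proof (induction arbitrary: V rule: exec.induct)
  case (exec_Skip x)
  then show ?case
    by (auto intro!: runs_mono[OF runs_Skip] simp: small_def intro: le_SucI)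
next
  case (exec_Basic b x y)
  then show ?case using run1_impl[of K b x y V w xs] stp2_small[of K b x y V] by simp
next
  case (exec_Seq c x m y d n z)
  have 1: "run1 xs ((K + 2) * (w + 1)) (compile c) (enc (fst x), snd x) (m * (12 * w + 12)) (enc (fst y), snd y)"
    "small K (V + m) (fst y)"
    using exec_Seq.IH(1)[OF exec_Seq.prems(1)] exec_Seq.prems by auto
  have 2: "run1 xs ((K + 2) * (w + 1)) (compile d) (enc (fst y), snd y) (n * (12 * w + 12)) (enc (fst z), snd z)"
    "small K (V + m + n) (fst z)"
    using exec_Seq.IH(2)[OF 1(2)] exec_Seq.prems by auto
  show ?case using runs_Seq[OF 1(1) 2(1)] 2(2)
    by (auto elim!: runs_mono simp: algebra_simps small_def intro: le_SucI)
next
  case (exec_CondT t x c n y d)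
  then have 1: "run1 xs ((K + 2) * (w + 1)) (compile c) (enc (fst x), snd x) (n * (12 * w + 12)) (enc (fst y), snd y)"
    "small K (V + n) (fst y)" using exec_CondT.IH[OF exec_CondT.prems(1)] by auto
  have "holds1 xs (implt t) (enc (fst x), snd x)" using exec_CondT.hyps(1) by (simp add: holds_implt)
  from runs_CondT[OF this 1(1), of "compile d"] show ?case using 1(2)
    by (auto elim!: runs_mono simp: algebra_simps small_def intro: le_SucI)
next
  case (exec_CondF t x d n y c)
  then have 1: "run1 xs ((K + 2) * (w + 1)) (compile d) (enc (fst x), snd x) (n * (12 * w + 12)) (enc (fst y), snd y)"
    "small K (V + n) (fst y)" using exec_CondF.IH[OF exec_CondF.prems(1)] by auto
  have "\<not> holds1 xs (implt t) (enc (fst x), snd x)" using exec_CondF.hyps(1) by (simp add: holds_implt)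
  from runs_CondF[OF this 1(1), of "compile c"] show ?case using 1(2)
    by (auto elim!: runs_mono simp: algebra_simps small_def intro: le_SucI)
next
  case (exec_LoopF t x c)
  then have "\<not> holds1 xs (implt t) (enc (fst x), snd x)" by (simp add: holds_implt)
  from runs_LoopF[of "holds1 xs" "implt t" "(enc (fst x), snd x)" "stp1 ((K + 2) * (w + 1))" "compile c", OF this] show ?case using exec_LoopF.prems
    by (auto elim!: runs_mono simp: small_def le_SucI)
next
  case (exec_LoopT t x c m y n z)
  have 1: "run1 xs ((K + 2) * (w + 1)) (compile c) (enc (fst x), snd x) (m * (12 * w + 12)) (enc (fst y), snd y)"
    "small K (V + m) (fst y)"
    using exec_LoopT.IH(1)[OF exec_LoopT.prems(1)] exec_LoopT.prems by auto
  have 2: "run1 xs ((K + 2) * (w + 1)) (compile (Loop t c)) (enc (fst y), snd y) (n * (12 * w + 12)) (enc (fst z), snd z)"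
    "small K (V + m + n) (fst z)"
    using exec_LoopT.IH(2)[OF 1(2)] exec_LoopT.prems by auto
  have "holds1 xs (implt t) (enc (fst x), snd x)" using exec_LoopT.hyps(1) by (simp add: holds_implt)
  from runs_LoopT[OF this 1(1) 2(1)[unfolded compile.simps]] show ?case using 2(2)
    by (auto elim!: runs_mono simp: algebra_simps small_def intro: le_SucI)
qed

text \<open>Stack entries only grow by increments, so a run of length \<open>n\<close> from empty stacks needs
  words of length \<open>w\<close> with \<open>n < 2 ^ w\<close> only.\<close>

theorem tm_of_com2:
  fixes c :: "('s :: finite) com2"
  shows "\<exists>M. wf_tm M \<and> (\<forall>xs K n \<sigma> h w. exec (stp2 K) (holds2 xs) c (\<lambda>_. [], 0) n (\<sigma>, h) \<longrightarrow>
     n < 2 ^ w \<longrightarrow> tm_decides_within M xs (peek (\<sigma> s) \<noteq> Some 0)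
       (real ((n * (12 * w + 12) + 4) * (2 * ((K + 2) * (w + 1)) + 6))) (real ((K + 2) * (w + 1) + 2)))"
proof -
  let ?P = "\<lambda>x. x \<noteq> Some Sep"
  obtain M where M: "wf_tm M" and dec: "\<And>xs B n y. exec (stp1 B) (holds1 xs) (compile c) (\<lambda>_. [], 0) n y \<Longrightarrow>
     tm_decides_within M xs (?P (peek (fst y (Some s)))) (real ((n + 4) * (2 * B + 6))) (real (B + 2))"
    using tm_of_com1[of "compile c" ?P "Some s"] by blast
  have "tm_decides_within M xs (peek (\<sigma> s) \<noteq> Some 0)
       (real ((n * (12 * w + 12) + 4) * (2 * ((K + 2) * (w + 1)) + 6))) (real ((K + 2) * (w + 1) + 2))"
    if ex: "exec (stp2 K) (holds2 xs) c (\<lambda>_. [], 0) n (\<sigma>, h)" and w: "n < 2 ^ w" for xs K n \<sigma> h w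
  proof -
    let ?B = "(K + 2) * (w + 1)"
    have "enc (\<lambda>_. [] :: nat list) t = []" for t :: "'s option" by (cases t) auto
    then have "enc (\<lambda>_ :: 's. []) = (\<lambda>_. [])" by (rule ext)
    then have "run1 xs ?B (compile c) (\<lambda>_. [], 0) (n * (12 * w + 12)) (enc \<sigma>, h)"
      using exec_comp[OF ex, of 0 w] w by (simp add: small_def)
    then obtain m where m: "m \<le> n * (12 * w + 12)" "exec (stp1 ?B) (holds1 xs) (compile c) (\<lambda>_. [], 0) m (enc \<sigma>, h)"
      by (auto simp: runs_def)
    have eq: "?P (peek (enc \<sigma> (Some s))) \<longleftrightarrow> peek (\<sigma> s) \<noteq> Some 0"
      using holds_implt[of xs "NZ s" "(\<sigma>, h)"] by simp
    have "(m + 4) * (2 * ?B + 6) \<le> (n * (12 * w + 12) + 4) * (2 * ?B + 6)"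
      using m(1) by (intro mult_right_mono) auto
    then have "real ((m + 4) * (2 * ?B + 6)) \<le> real ((n * (12 * w + 12) + 4) * (2 * ?B + 6))"
      by (rule of_nat_mono)
    with dec[OF m(2)] show ?thesis unfolding fst_conv eq tm_decides_within_def
      by (meson order_trans)
  qed
  with M show ?thesis by blast
qed

subsection \<open>Depth-first search with one mark per line\<close>

text \<open>\<open>seg r l c j q\<close>: row \<open>q\<close> of line \<open>l + c\<close> is reachable from row \<open>j\<close> of line \<open>l\<close> when
  \<open>r i\<close> relates the rows of line \<open>i\<close> to those of line \<open>i + 1\<close>.\<close>

fun seg :: "(nat \<Rightarrow> nat \<Rightarrow> nat \<Rightarrow> bool) \<Rightarrow> nat \<Rightarrow> nat \<Rightarrow> nat \<Rightarrow> nat \<Rightarrow> bool" where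
  "seg r l 0 j q = (j = q)"
| "seg r l (Suc c) j q = (\<exists>p. r l j p \<and> seg r (Suc l) c p q)"

lemma seg_add: "seg r l (c + d) j q \<longleftrightarrow> (\<exists>p. seg r l c j p \<and> seg r (l + c) d p q)"
  by (induction c arbitrary: l j) auto

text \<open>The first path starts no higher than the second and ends no lower, so the two meet, and
  from the meeting point the second can continue along the first. This is the only form in which
  planarity enters the search.\<close>

definition noncross :: "(nat \<Rightarrow> nat \<Rightarrow> bool) \<Rightarrow> bool" where
  "noncross r \<longleftrightarrow> (\<forall>p x q y. p \<le> x \<longrightarrow> r p q \<longrightarrow> r x y \<longrightarrow> y \<le> q \<longrightarrow> r x q)"

lemma noncrossD: "noncross r \<Longrightarrow> r p q \<Longrightarrow> r x y \<Longrightarrow> p \<le> x \<Longrightarrow> y \<le> q \<Longrightarrow> r x q"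
  unfolding noncross_def by blast

text \<open>Look at the rows \<open>p'\<close> and \<open>x'\<close> after the first layer. Either
  they are still in order, and the crossing lies further on, or the paths change sides within the
  first layer, and \<open>x\<close> reaches \<open>p'\<close> at once.\<close>

lemma noncross_seg:
  assumes "\<And>l. noncross (r l)"
  shows "noncross (seg r l c)"
proof -
  have "seg r l c x q" if "p \<le> x" "seg r l c p q" "seg r l c x y" "y \<le> q" for p x q y
    using that
  proof (induction c arbitrary: l p x)
    case (Suc c)
    from Suc.prems obtain p' x' where *: "r l p p'" "seg r (Suc l) c p' q" "r l x x'" "seg r (Suc l) c x' y" by auto
    show ?case
    proof (cases "p' \<le> x'")
      case True
      then show ?thesis using Suc.IH[OF True *(2,4)] * Suc.prems by auto
    next
      case False
      then have "r l x p'" using noncrossD[OF assms *(1,3)] Suc.prems by auto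
      then show ?thesis using * by auto
    qed
  qed simp
  then show ?thesis unfolding noncross_def by blast
qed

text \<open>The highest admissible row below \<open>M\<close>; it is the single answer that a
  sub-search returns.\<close>

definition best :: "(nat \<Rightarrow> bool) \<Rightarrow> nat \<Rightarrow> nat \<Rightarrow> bool" where
  "best P M q \<longleftrightarrow> P q \<and> q < M \<and> (\<forall>y<M. P y \<longrightarrow> y \<le> q)"

text \<open>A row from which the goal, some row below \<open>M\<close> of line \<open>k\<close>, is
  out of reach.\<close>

definition dead :: "(nat \<Rightarrow> nat \<Rightarrow> nat \<Rightarrow> bool) \<Rightarrow> nat \<Rightarrow> nat \<Rightarrow> nat \<Rightarrow> nat \<Rightarrow> bool" where
  "dead r k M l x \<longleftrightarrow> (\<forall>y<M. \<not> seg r l (k - l) x y)"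

text \<open>The invariant of the depth-first search from row \<open>m 0\<close> of line \<open>0\<close> for a row below \<open>M\<close> of
  line \<open>k\<close>. Line \<open>l\<close> carries the mark \<open>m l\<close>, the lowest row visited so far; for \<open>l \<le> i\<close> the marks
  are at the same time the current path. Rows are at most \<open>n\<close>, and the mark \<open>n + 1\<close> stands for
  an unvisited line.\<close>

definition dfs :: "(nat \<Rightarrow> nat \<Rightarrow> nat \<Rightarrow> bool) \<Rightarrow> nat \<Rightarrow> nat \<Rightarrow> nat \<Rightarrow> nat \<Rightarrow> (nat \<Rightarrow> nat) \<Rightarrow> nat \<Rightarrow> bool" where
  "dfs r n k M j m i \<longleftrightarrow> i < k \<and> m 0 = j \<and> m k = M \<and> j \<le> n
    \<and> (\<forall>l<i. r l (m l) (m (Suc l)))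
    \<and> (\<forall>l. i < l \<longrightarrow> l < k \<longrightarrow> dead r k M l (m l))
    \<and> (\<forall>l. Suc l < k \<longrightarrow> m (Suc l) \<le> n \<longrightarrow>
          (\<exists>x\<ge>m l. r l x (m (Suc l)) \<and> (x = m l \<or> dead r k M l x)))
    \<and> (\<forall>l\<le>i. \<forall>y<M. seg r l (k - l) (m l) y \<longrightarrow>
          (\<exists>l'. l \<le> l' \<and> l' \<le> i \<and> (\<exists>q<m (Suc l'). r l' (m l') q \<and> seg r (Suc l') (k - Suc l') q y)))"

section \<open>Preservation of the search invariant\<close>

lemma seg_Suc_diff: "l < k \<Longrightarrow> seg r l (k - l) x y \<longleftrightarrow> (\<exists>p. r l x p \<and> seg r (Suc l) (k - Suc l) p y)"
  by (metis Suc_diff_Suc seg.simps(2))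

context
  fixes r :: "nat \<Rightarrow> nat \<Rightarrow> nat \<Rightarrow> bool" and n k :: nat
  assumes nc: "\<And>l. noncross (r l)"
    and range: "\<And>l x y. r l x y \<Longrightarrow> x \<le> n \<and> y \<le> n"
begin

text \<open>Line \<open>k\<close> carries \<open>M\<close> from the start, so the bound on the
  target row acts like an ordinary mark. Unvisited lines are marked by a row outside the range of
  \<open>r\<close>, which is dead for lack of successors.\<close>

lemma dfs_init:
  assumes "0 < k" "j \<le> n" "M \<le> Suc n"
  shows "dfs r n k M j (\<lambda>l. if l = 0 then j else if l = k then M else Suc n) 0"
proof -
  let ?m = "\<lambda>l. if l = 0 then j else if l = k then M else Suc n"
  have "dead r k M l (?m l)" if "0 < l" "l < k" for l
    using that range by (fastforce simp: dead_def seg_Suc_diff)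
  moreover have "\<exists>q<?m (Suc 0). r 0 (?m 0) q \<and> seg r (Suc 0) (k - Suc 0) q y"
    if "y < M" and s: "seg r 0 (k - 0) (?m 0) y" for y
  proof -
    obtain q where q: "r 0 (?m 0) q" "seg r (Suc 0) (k - Suc 0) q y"
      using s seg_Suc_diff[of 0 k r] assms(1) by auto
    have "q < ?m (Suc 0)" using q \<open>y < M\<close> range[OF q(1)] by auto
    then show ?thesis using q by blast
  qed
  ultimately show ?thesis using assms unfolding dfs_def by auto
qed

text \<open>By the last clause of the invariant, any goal reachable from the top of the path is
  reached through a row below the next mark. If there is none, the top is dead, and for the lower
  path positions the exit named by that clause lies elsewhere.\<close>

lemma dfs_pop:
  assumes d: "dfs r n k M j m i" and no: "\<And>q. q < m (Suc i) \<Longrightarrow> \<not> r i (m i) q"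
  shows "dead r k M i (m i)" and "0 < i \<Longrightarrow> dfs r n k M j m (i - 1)"
proof -
  have D4: "\<exists>l'. l \<le> l' \<and> l' \<le> i \<and> (\<exists>q<m (Suc l'). r l' (m l') q \<and> seg r (Suc l') (k - Suc l') q y)"
    if "l \<le> i" "y < M" "seg r l (k - l) (m l) y" for l y using d that unfolding dfs_def by blast
  show dd: "dead r k M i (m i)"
    unfolding dead_def using D4[of i] no by (metis le_antisym order_refl)
  assume "0 < i"
  have "\<exists>l'. l \<le> l' \<and> l' \<le> i - 1 \<and> (\<exists>q<m (Suc l'). r l' (m l') q \<and> seg r (Suc l') (k - Suc l') q y)"
    if l: "l \<le> i - 1" "y < M" "seg r l (k - l) (m l) y" for l y
  proof -
    obtain l' q where "l \<le> l'" "l' \<le> i" "q < m (Suc l')" "r l' (m l') q" "seg r (Suc l') (k - Suc l') q y"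
      using D4[of l y] l \<open>0 < i\<close> by (metis diff_le_self le_trans)
    moreover from this have "l' \<noteq> i" using no by blast
    ultimately show ?thesis by (intro exI[of _ l']) auto
  qed
  moreover have "dead r k M l (m l)" if "i - 1 < l" "l < k" for l
    using that dd d unfolding dfs_def by (cases "l = i") auto
  ultimately show "dfs r n k M j m (i - 1)" using d \<open>0 < i\<close> unfolding dfs_def by auto
qed

text \<open>The last clause of the invariant must be shown for the new row \<open>p\<close>: nothing
  is lost by ignoring successors at or above the next mark. That mark was reached from a row
  \<open>x\<close> above \<open>p\<close> which is dead by now, and an ignored successor
  \<open>q\<close> of \<open>p\<close> is, by crossing, a successor of \<open>x\<close>. So
  \<open>q\<close> cannot lead to the goal either.\<close>

lemma dfs_push:
  assumes d: "dfs r n k M j m i" and b: "best (r i (m i)) (m (Suc i)) p" and i: "Suc i < k"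
  shows "dfs r n k M j (m(Suc i := p)) (Suc i)"
proof -
  let ?m = "m(Suc i := p)"
  have p: "r i (m i) p" "p < m (Suc i)" "\<And>y. y < m (Suc i) \<Longrightarrow> r i (m i) y \<Longrightarrow> y \<le> p"
    using b by (auto simp: best_def)
  have D1: "l < i \<Longrightarrow> r l (m l) (m (Suc l))" for l using d unfolding dfs_def by blast
  have D2: "i < l \<Longrightarrow> l < k \<Longrightarrow> dead r k M l (m l)" for l using d unfolding dfs_def by blast
  have D3: "Suc l < k \<Longrightarrow> m (Suc l) \<le> n \<Longrightarrow> \<exists>x\<ge>m l. r l x (m (Suc l)) \<and> (x = m l \<or> dead r k M l x)" for l
    using d unfolding dfs_def by blast
  have D4: "\<exists>l'. l \<le> l' \<and> l' \<le> i \<and> (\<exists>q<m (Suc l'). r l' (m l') q \<and> seg r (Suc l') (k - Suc l') q y)"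
    if "l \<le> i" "y < M" "seg r l (k - l) (m l) y" for l y using d that unfolding dfs_def by blast
  have Mk: "m k = M" using d unfolding dfs_def by blast
  have new: "\<exists>q<m (Suc (Suc i)). r (Suc i) p q \<and> seg r (Suc (Suc i)) (k - Suc (Suc i)) q y"
    if y: "y < M" "seg r (Suc i) (k - Suc i) p y" for y
  proof -
    obtain q where q: "r (Suc i) p q" "seg r (Suc (Suc i)) (k - Suc (Suc i)) q y"
      using y i by (auto simp: seg_Suc_diff)
    have "q < m (Suc (Suc i))"
    proof (rule ccontr)
      assume "\<not> q < m (Suc (Suc i))"
      then have le: "m (Suc (Suc i)) \<le> q" by simp
      show False
      proof (cases "Suc (Suc i) = k")
        case True
        then show False using q(2) le Mk y(1) by simp
      next
        case False
        then have k2: "Suc (Suc i) < k" using i by simp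
        have "m (Suc (Suc i)) \<le> n" using le range[OF q(1)] by simp
        then obtain x where x: "m (Suc i) \<le> x" "r (Suc i) x (m (Suc (Suc i)))"
          "x = m (Suc i) \<or> dead r k M (Suc i) x" using D3[OF k2] by blast
        \<comment> \<open>Line \<open>Suc i\<close> lies beyond the current path, so its old mark is
          dead; this settles the case in which \<open>x\<close> is that mark itself.\<close>
        have dx: "dead r k M (Suc i) x" using x(3) D2[of "Suc i"] i by auto
        have "r (Suc i) x q" using noncrossD[OF nc q(1) x(2)] x(1) p(2) le by simp
        then have "seg r (Suc i) (k - Suc i) x y" using q(2) i by (auto simp: seg_Suc_diff)
        then show False using dx y(1) by (simp add: dead_def)
      qed
    qed
    then show ?thesis using q by blast
  qed
  have 4: "\<exists>l'. l \<le> l' \<and> l' \<le> Suc i \<and> (\<exists>q<?m (Suc l'). r l' (?m l') q \<and> seg r (Suc l') (k - Suc l') q y)"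
    if l: "l \<le> Suc i" "y < M" "seg r l (k - l) (?m l) y" for l y
  proof (cases "l = Suc i")
    case True
    then show ?thesis using new[of y] l by (intro exI[of _ "Suc i"]) auto
  next
    case False
    then obtain l' q where l': "l \<le> l'" "l' \<le> i" "q < m (Suc l')" "r l' (m l') q" "seg r (Suc l') (k - Suc l') q y"
      using D4[of l y] l by auto
    \<comment> \<open>Since \<open>p\<close> is the highest row below the old mark, exits of line
      \<open>i\<close> above \<open>p\<close> do not occur. Exits below \<open>p\<close> stay
      available under the lowered mark, and an exit at \<open>p\<close> continues along the new path
      element.\<close>
    consider "l' < i" | "l' = i" "q < p" | "l' = i" "q = p" using l' p(3) by fastforce
    then show ?thesis
    proof cases
      case 3
      then show ?thesis using new[of y] l l' by (intro exI[of _ "Suc i"]) auto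
    qed (use l' in \<open>intro exI[of _ l'], auto\<close>)+
  qed
  have 3: "\<exists>x\<ge>?m l. r l x (?m (Suc l)) \<and> (x = ?m l \<or> dead r k M l x)" if l: "Suc l < k" "?m (Suc l) \<le> n" for l
  proof (cases "l = i")
    case True
    then show ?thesis using p(1) by auto
  next
    case False
    then obtain x where x: "m l \<le> x" "r l x (m (Suc l))" "x = m l \<or> dead r k M l x" using D3[of l] l by auto
    \<comment> \<open>Only the line whose mark is lowered needs care: the origin \<open>x\<close> of
      the next mark still lies above the new mark, and it has become dead.\<close>
    show ?thesis
    proof (cases "l = Suc i")
      case True
      then have "dead r k M l x" using x(3) D2[of l] i by auto
      then show ?thesis using x True p(2) by (intro exI[of _ x]) auto
    qed (use x False in auto)
  qed
  have 1: "r l (?m l) (?m (Suc l))" if "l < Suc i" for l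
    using that D1[of l] p(1) by (cases "l = i") auto
  have 2: "dead r k M l (?m l)" if "Suc i < l" "l < k" for l using D2[of l] that by auto
  have "?m 0 = j \<and> ?m k = M \<and> j \<le> n" using d i unfolding dfs_def by auto
  then show ?thesis unfolding dfs_def using 1 2 3 4 i by blast
qed

text \<open>The path of marks followed by \<open>p\<close> is a witness. For maximality, suppose a
  row \<open>y\<close> above \<open>p\<close> is reachable by leaving the path below some mark. That
  route crosses the path, which ends lower, so the mark itself reaches \<open>y\<close>. This
  repeats on later lines up to line \<open>i\<close>, where \<open>p\<close> is the highest
  choice.\<close>

lemma dfs_success:
  assumes d: "dfs r n k M j m i" and b: "best (r i (m i)) (m (Suc i)) p" and i: "Suc i = k"
  shows "best (seg r 0 k j) M p"
proof -
  have p: "r i (m i) p" "p < M" "\<And>y. y < M \<Longrightarrow> r i (m i) y \<Longrightarrow> y \<le> p"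
    using b i d by (auto simp: best_def dfs_def)
  have D1: "l < i \<Longrightarrow> r l (m l) (m (Suc l))" for l using d unfolding dfs_def by blast
  have m0: "m 0 = j" using d unfolding dfs_def by blast
  have D4: "\<exists>l'. l \<le> l' \<and> l' \<le> i \<and> (\<exists>q<m (Suc l'). r l' (m l') q \<and> seg r (Suc l') (k - Suc l') q y)"
    if "l \<le> i" "y < M" "seg r l (k - l) (m l) y" for l y using d that unfolding dfs_def by blast
  have path: "seg r (i - l) (k - (i - l)) (m (i - l)) p" if "l \<le> i" for l
    using that
  proof (induction l)
    case 0
    then show ?case using p i by (auto simp: seg_Suc_diff)
  next
    case (Suc l)
    then have "Suc (i - Suc l) = i - l" by simp
    then show ?case using Suc D1[of "i - Suc l"] i seg_Suc_diff[of "i - Suc l" k r] by auto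
  qed
  \<comment> \<open>Here \<open>l\<close> is the distance from the end of the path, so the induction
    moves towards line \<open>i\<close>.\<close>
  have max: "y \<le> p" if "y < M" "seg r (i - l) (k - (i - l)) (m (i - l)) y" "l \<le> i" for y l
    using that
  proof (induction l rule: less_induct)
    case (less l)
    obtain l' q where l': "i - l \<le> l'" "l' \<le> i" "q < m (Suc l')" "r l' (m l') q" "seg r (Suc l') (k - Suc l') q y"
      using D4[of "i - l" y] less.prems by auto
    show ?case
    proof (cases "l' = i")
      case True
      then show ?thesis using l' p(3) less.prems i by auto
    next
      case False
      show ?thesis
      proof (rule ccontr)
        assume "\<not> y \<le> p"
        define e where "e = i - Suc l'"
        have e: "i - e = Suc l'" "e < l" "e \<le> i" using False l' by (auto simp: e_def)
        have "seg r (Suc l') (k - Suc l') (m (Suc l')) p" using path[OF e(3)] e(1) by simp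
        then have "seg r (Suc l') (k - Suc l') (m (Suc l')) y"
          using noncrossD[OF noncross_seg[OF nc] l'(5)] l'(3) \<open>\<not> y \<le> p\<close> by simp
        then show False using less.IH[OF e(2) less.prems(1)] e \<open>\<not> y \<le> p\<close> by simp
      qed
    qed
  qed
  show ?thesis unfolding best_def using path[of i] max[of _ i] p(2) m0 by auto
qed

end


section \<open>Slabs, and grid paths as sequences of column steps\<close>

text \<open>Crossing \<open>m\<close> slabs of width \<open>c\<close> is crossing
  \<open>m * c\<close> columns: the link between two levels of the recursion.\<close>

lemma seg_mult: "seg (\<lambda>i. seg r (a + i * c) c) l m j q \<longleftrightarrow> seg r (a + l * c) (m * c) j q"
proof (induction m arbitrary: l j)
  case (Suc m)
  show ?case using Suc seg_add[of r "a + l * c" c "m * c" j q]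
    by (simp add: add.assoc add.commute[of c "l * c"])
qed simp

lemma seg_range:
  assumes "\<And>l x y. r l x y \<Longrightarrow> x \<le> n \<and> y \<le> n" "0 < c" "seg r l c x y"
  shows "x \<le> n \<and> y \<le> n"
proof -
  have "y \<le> n" if "x \<le> n" "seg r l c x y" for x l
    using that
  proof (induction c arbitrary: l x)
    case (Suc c)
    then show ?case using assms(1) by fastforce
  qed simp
  moreover have "x \<le> n" using assms by (cases c) auto
  ultimately show ?thesis using assms by blast
qed

type_synonym graph = "((nat \<times> nat) \<times> nat \<times> nat) set"

text \<open>The columns after the target column \<open>it\<close> are treated as copies of it, linked by all horizontal
  edges, so that the number of columns can be rounded up to a power of \<open>k\<close>.\<close>

definition col_step :: "graph \<Rightarrow> nat \<Rightarrow> nat \<Rightarrow> nat \<Rightarrow> nat \<Rightarrow> nat \<Rightarrow> bool" where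
  "col_step E n it a j q \<longleftrightarrow> j \<le> q \<and> q \<le> n
     \<and> (\<forall>y. j \<le> y \<longrightarrow> y < q \<longrightarrow> ((min a it, y), (min a it, y + 1)) \<in> E)
     \<and> (a < it \<longrightarrow> ((a, q), (a + 1, q)) \<in> E)"

lemma col_step_range: "col_step E n it a x y \<Longrightarrow> x \<le> n \<and> y \<le> n"
  by (auto simp: col_step_def)

text \<open>From \<open>x <= y <= q\<close>, the vertical run from \<open>p\<close> to
  \<open>q\<close> contains the run from \<open>x\<close> to \<open>q\<close>, and both use the same
  horizontal edge at \<open>q\<close>.\<close>

lemma noncross_col_step: "noncross (col_step E n it a)"
  unfolding noncross_def col_step_def by auto

lemma grid_path_mono:
  assumes "((i, j), (i', j')) \<in> E\<^sup>*" "E \<subseteq> grid_edges n"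
  shows "i \<le> i'"
proof -
  have "fst x \<le> fst y" if "(x, y) \<in> E\<^sup>*" for x y
    using that
  proof (induction rule: rtrancl_induct)
    case (step y z)
    then show ?case using assms(2) by (force simp: grid_edges_def)
  qed simp
  from this[OF assms(1)] show ?thesis by simp
qed

lemma north_path:
  fixes E :: graph
  assumes "\<And>y. j \<le> y \<Longrightarrow> y < q \<Longrightarrow> ((x, y), (x, y + 1)) \<in> E" "j \<le> q"
  shows "((x, j), (x, q)) \<in> E\<^sup>*"
  using assms
proof (induction q)
  case (Suc q)
  show ?case
  proof (cases "j = Suc q")
    case False
    then have "((x, j), (x, q)) \<in> E\<^sup>*" "((x, q), (x, q + 1)) \<in> E" using Suc by auto
    then show ?thesis by (metis Suc_eq_plus1 rtrancl.rtrancl_into_rtrancl)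
  qed simp
qed simp

lemma seg_col_step_path:
  "seg (col_step E n it) a c j q \<Longrightarrow> ((min a it, j), (min (a + c) it, q)) \<in> E\<^sup>*"
proof (induction c arbitrary: a j)
  case (Suc c)
  then obtain p where p: "col_step E n it a j p" "seg (col_step E n it) (Suc a) c p q" by auto
  have 1: "((min a it, j), (min a it, p)) \<in> E\<^sup>*"
    using p(1) by (intro north_path) (auto simp: col_step_def)
  have 2: "((min a it, p), (min (Suc a) it, p)) \<in> E\<^sup>*"
  proof (cases "a < it")
    case True
    then have "min a it = a" "min (Suc a) it = a + 1" by auto
    then show ?thesis using p(1) True by (auto simp: col_step_def)
  next
    case False
    then have "min a it = min (Suc a) it" by auto
    then show ?thesis by simp
  qed
  have 3: "((min (Suc a) it, p), (min (a + Suc c) it, q)) \<in> E\<^sup>*" using Suc.IH[OF p(2)] by simp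
  from 1 2 3 show ?case by (meson rtrancl_trans)
qed simp

text \<open>An east edge opens a new layer, a north edge lengthens the vertical run of the first
  layer. The strict inequality \<open>it < i + c\<close> provides one layer starting in the target
  column, where the final north edges are taken; any remaining layers stay at row
  \<open>jt\<close>.\<close>

lemma path_seg_col_step:
  assumes "((i, j), (it, jt)) \<in> E\<^sup>*" "E \<subseteq> grid_edges n" "jt \<le> n" "it < i + c"
  shows "seg (col_step E n it) i c j jt"
proof -
  have "\<forall>c. it < fst x + c \<longrightarrow> seg (col_step E n it) (fst x) c (snd x) jt" if "(x, (it, jt)) \<in> E\<^sup>*" for x
    using that
  proof (induction rule: converse_rtrancl_induct)
    case base
    have "seg (col_step E n it) a c jt jt" if "it \<le> a" for a c
      using that
    proof (induction c arbitrary: a)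
      case (Suc c)
      have "col_step E n it a jt jt" using Suc.prems assms(3) by (auto simp: col_step_def)
      then show ?case using Suc by auto
    qed simp
    then show ?case by simp
  next
    case (step x y)
    obtain a b where x: "x = (a, b)" by force
    have le: "fst x \<le> it" using grid_path_mono[of a b it jt E n] step(1,2) x assms(2)
      by (metis converse_rtrancl_into_rtrancl fst_conv)
    have ley: "fst y \<le> it" using grid_path_mono[of "fst y" "snd y" it jt E n] step(2) assms(2) by simp
    consider (east) "y = (a + 1, b)" "b \<le> n" | (north) "y = (a, b + 1)"
      using step(1) assms(2) x by (auto simp: grid_edges_def)
    then show ?case
    proof cases
      case east
      then have cs: "col_step E n it a b b" using step(1) x ley by (auto simp: col_step_def)
      show ?thesis
      proof (intro allI impI)
        fix c assume c: "it < fst x + c"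
        then obtain c' where c': "c = Suc c'" using le by (cases c) auto
        have "seg (col_step E n it) (a + 1) c' b jt" using step.IH east c c' x by auto
        then show "seg (col_step E n it) (fst x) c (snd x) jt" using cs x c' by auto
      qed
    next
      case north
      show ?thesis
      proof (intro allI impI)
        fix c assume c: "it < fst x + c"
        then obtain c' where c': "c = Suc c'" using le by (cases c) auto
        obtain p where p: "col_step E n it a (b + 1) p" "seg (col_step E n it) (Suc a) c' p jt"
          using step.IH[rule_format, of c] north c c' x by auto
        have m: "min a it = a" using le x by simp
        have "((a, b), (a, b + 1)) \<in> E" using step(1) x north by simp
        then have "((a, y), (a, y + 1)) \<in> E" if "b \<le> y" "y < p" for y
          using p(1) that m unfolding col_step_def by (cases "y = b") auto
        then have "col_step E n it a b p" using p(1) m unfolding col_step_def by auto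
        then show "seg (col_step E n it) (fst x) c (snd x) jt" using p(2) x c' by auto
      qed
    qed
  qed
  from this[OF assms(1)] show ?thesis using assms(4) by simp
qed

text \<open>The comparison of columns must be explicit, since a start to the right of the target
  would be treated as one of the copies of the target column.\<close>

lemma grid_reach_iff:
  assumes "E \<subseteq> grid_edges n" "it \<le> n" "jt \<le> n" "n < c"
  shows "grid_reach E (i, j) (it, jt) \<longleftrightarrow> i \<le> it \<and> seg (col_step E n it) i c j jt"
proof
  assume "grid_reach E (i, j) (it, jt)"
  then have p: "((i, j), (it, jt)) \<in> E\<^sup>*" by (simp add: grid_reach_def)
  then show "i \<le> it \<and> seg (col_step E n it) i c j jt"
    using grid_path_mono[OF p assms(1)] path_seg_col_step[OF p assms(1,3)] assms(2,4) by auto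
next
  assume a: "i \<le> it \<and> seg (col_step E n it) i c j jt"
  then have "min i it = i" "min (i + c) it = it" using assms by auto
  with seg_col_step_path[of E n it i c j jt] a show "grid_reach E (i, j) (it, jt)"
    by (simp add: grid_reach_def)
qed

subsection \<open>Program fragments\<close>

text \<open>The roles of the stacks: \<open>SN\<close> is \<open>n + 1\<close>, \<open>SK\<close> and \<open>SJ\<close> are the branching factor \<open>k\<close> and \<open>k - 1\<close>,
  \<open>SA\<close> is the current column, \<open>SI\<close> and \<open>SW\<close> are the column and the row of the target, \<open>SP\<close> is the position
  of the input head, and \<open>ST\<close> holds the counters of the active \<open>For\<close> loops. The marks of the search
  form a zipper: \<open>SL\<close> holds the current path, topmost the last line reached, and \<open>SR\<close> the marks of
  the lines to the right of it. \<open>SC\<close> counts the lines passed on each level, \<open>SF\<close> returns the outcome of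
  a search, \<open>SZ\<close> keeps its loop running; the others are temporary.\<close>

datatype stk = SN | SK | SJ | SA | SI | SW | SL | SR | SC | ST | SP | SU | SV | SX | SY | SG | SQ | SF | SZ

instance stk :: finite
proof
  have "x \<in> {SN, SK, SJ, SA, SI, SW, SL, SR, SC, ST, SP, SU, SV, SX, SY, SG, SQ, SF, SZ}" for x
    by (cases x) auto
  then have "(UNIV :: stk set) \<subseteq> {SN, SK, SJ, SA, SI, SW, SL, SR, SC, ST, SP, SU, SV, SX, SY, SG, SQ, SF, SZ}"
    by blast
  then show "finite (UNIV :: stk set)" by (rule finite_subset) simp
qed

abbreviation "zero s \<equiv> Basic (Zero s)"
abbreviation "inc s \<equiv> Basic (Inc s)"
abbreviation "dec s \<equiv> Basic (Dec s)"
abbreviation "drp s \<equiv> Basic (Drop s)"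
abbreviation "copy s s' \<equiv> Basic (Copy s s')"

text \<open>The counter lives on the common stack \<open>ST\<close>, so loops nest freely, and the
  register \<open>s\<close> itself is not consumed.\<close>

definition For :: "stk \<Rightarrow> stk com2 \<Rightarrow> stk com2" where
  "For s c = copy s ST ;; Loop (NZ ST) (dec ST ;; c) ;; drp ST"

definition diff :: "stk \<Rightarrow> stk \<Rightarrow> stk \<Rightarrow> stk com2" where
  "diff t s s' = copy s t ;; For s' (dec t)"

definition one :: "stk \<Rightarrow> stk com2" where
  "one s = zero s ;; inc s"

text \<open>The machine cannot see where its input head stands, so \<open>SP\<close> counts along
  and tells \<open>rewind\<close> how far to go back.\<close>

definition moveR :: "stk com2" where
  "moveR = Basic Rgt ;; inc SP"

definition rewind :: "stk com2" where
  "rewind = Loop (NZ SP) (dec SP ;; Basic Lft)"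

definition seek :: "stk com2" where
  "seek = For SN moveR ;; For SX (For SN (moveR ;; moveR)) ;; For SY (moveR ;; moveR)"

definition setQ :: "stk com2" where
  "setQ = drp SQ ;; copy SY SQ ;; inc SQ"

text \<open>\<open>SU\<close> is nonzero left of the target column, where leaving at this row needs
  the east edge; in the copies of the target column leaving is always possible. \<open>SQ\<close>
  holds the row plus one, so that zero can mean that no row was found. \<open>SG\<close> tells
  whether the vertical run still continues.\<close>

definition scan :: "stk com2" where
  "scan = Cond (NZ SU) (Cond InT setQ Skip) setQ ;; moveR ;; Cond InT Skip (dec SG) ;; moveR ;; inc SY"

text \<open>Repeats \<open>c\<close> a number of times equal to the \<open>d\<close>-th power of the
  entry of \<open>SK\<close> without storing that power; the program text depends on
  \<open>d\<close> only.\<close>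

fun nest :: "stk com2 \<Rightarrow> nat \<Rightarrow> stk com2" where
  "nest c 0 = c"
| "nest c (Suc d) = For SK (nest c d)"

definition prog0 :: "stk com2" where
  "prog0 = diff SU SI SA ;; Cond (NZ SU) (copy SA SX) (copy SI SX) ;; copy SL SY ;; diff SV SR SL ;;
     seek ;; one SG ;; zero SQ ;; For SV (Cond (NZ SG) scan Skip) ;; rewind ;;
     drp SG ;; drp SV ;; drp SY ;; drp SX ;; drp SU ;;
     Cond (NZ SQ) (dec SQ ;; copy SQ SL ;; drp SR ;; inc SA ;; one SF) (zero SF) ;; drp SQ"

definition push_branch :: "stk com2" where
  "push_branch = drp SF ;; inc SC ;; diff SU SK SC ;; Cond (NZ SU) Skip (dec SZ) ;; drp SU"

definition pop_branch :: "nat \<Rightarrow> stk com2" where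
  "pop_branch d = drp SF ;; Cond (NZ SC) (dec SC ;; copy SL SR ;; drp SL ;; nest (dec SA) d) (dec SZ)"

text \<open>All levels share the stacks: each search finds its start row on top of \<open>SL\<close>
  and its bound on top of \<open>SR\<close>, and the path and marks of the current level are placed
  in just this way for the level below. After the loop \<open>SC\<close> is \<open>k\<close> on
  success and 0 on failure, which is why it serves as the test.\<close>

fun prog :: "nat \<Rightarrow> stk com2" where
  "prog 0 = prog0"
| "prog (Suc d) = For SJ (copy SN SR) ;; zero SC ;; one SZ ;;
     Loop (NZ SZ) (prog d ;; Cond (NZ SF) push_branch (pop_branch d)) ;;
     drp SZ ;;
     Cond (NZ SC)
       (copy SL SQ ;; drp SL ;; For SJ (drp SL) ;; copy SQ SL ;; drp SQ ;; drp SC ;; one SF)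
       (For SJ (drp SR) ;; drp SC ;; zero SF)"

lemma runs_cong:
  "runs stp tst c x T' y' \<Longrightarrow> y' = y \<Longrightarrow> T' \<le> T \<Longrightarrow> runs stp tst c x T y"
  using runs_mono by metis

section \<open>Cost estimates and rules for loops\<close>

text \<open>One more nested loop costs one more factor \<open>b\<close>: the excess of
  \<open>b\<close> over \<open>W\<close> absorbs the overhead of loop control.\<close>

lemma loop_bound:
  fixes k W b d :: nat
  assumes "k \<le> W" "W + 10 \<le> b"
  shows "k * (b ^ Suc d + 3) + 5 \<le> b ^ Suc (Suc d)"
proof -
  have "1 \<le> b ^ d" using assms(2) by simp
  then have 1: "b \<le> b ^ Suc d" by simp
  have "k * (b ^ Suc d + 3) + 5 \<le> W * (b ^ Suc d) + (3 * W + 5)"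
    using mult_le_mono1[OF assms(1), of "b ^ Suc d + 3"] by (simp add: algebra_simps)
  also have "3 * W + 5 \<le> 10 * b ^ Suc d" using 1 assms(2) by linarith
  also have "W * b ^ Suc d + 10 * b ^ Suc d = (W + 10) * b ^ Suc d" by (simp add: algebra_simps)
  also have "\<dots> \<le> b * b ^ Suc d" using assms(2) by (rule mult_le_mono1)
  finally show ?thesis by simp
qed

lemma cube_bound: "W + 200 \<le> b \<Longrightarrow> 200 * (W + 1) ^ 2 \<le> b ^ 3" for W b :: nat
proof -
  assume "W + 200 \<le> b"
  then have "200 * (W + 1) ^ 2 \<le> b * b ^ 2" by (intro mult_le_mono power_mono) auto
  then show ?thesis by (simp add: numeral_eq_Suc)
qed

lemma runs_While:
  assumes "\<And>x. I x \<Longrightarrow> tst t x \<Longrightarrow> \<exists>y. runs stp tst c x T y \<and> I y \<and> \<mu> y < \<mu> x"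
    and "I x"
  shows "\<exists>y. runs stp tst (Loop t c) x (\<mu> x * (T + 1) + 1) y \<and> I y \<and> \<not> tst t y"
  using assms(2)
proof (induction "\<mu> x" arbitrary: x rule: less_induct)
  case less
  show ?case
  proof (cases "tst t x")
    case False
    then show ?thesis using less.prems runs_mono[OF runs_LoopF[of tst t x stp c]] by (intro exI[of _ x]) auto
  next
    case True
    then obtain y where y: "runs stp tst c x T y" "I y" "\<mu> y < \<mu> x" using assms(1) less.prems by blast
    obtain z where z: "runs stp tst (Loop t c) y (\<mu> y * (T + 1) + 1) z" "I z" "\<not> tst t z"
      using less.hyps[OF y(3,2)] by blast
    have "T + (\<mu> y * (T + 1) + 1) + 1 \<le> \<mu> x * (T + 1) + 1"
      using mult_le_mono1[of "Suc (\<mu> y)" "\<mu> x" "T + 1"] y(3) by simp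
    then show ?thesis using runs_mono[OF runs_LoopT[OF True y(1) z(1)]] z by blast
  qed
qed

context
  fixes xs :: "bool list" and K :: nat
begin

abbreviation run2 :: "stk com2 \<Rightarrow> stk state2 \<Rightarrow> nat \<Rightarrow> stk state2 \<Rightarrow> bool" where
  "run2 \<equiv> runs (stp2 K) (holds2 xs)"

lemma run_Zero: "length (\<sigma> s) < K \<Longrightarrow> run2 (zero s) (\<sigma>, h) 1 (\<sigma>(s := 0 # \<sigma> s), h)"
  and run_Inc: "\<sigma> s \<noteq> [] \<Longrightarrow> run2 (inc s) (\<sigma>, h) 1 (\<sigma>(s := Suc (hd (\<sigma> s)) # tl (\<sigma> s)), h)"
  and run_Dec: "\<sigma> s \<noteq> [] \<Longrightarrow> run2 (dec s) (\<sigma>, h) 1 (\<sigma>(s := (hd (\<sigma> s) - 1) # tl (\<sigma> s)), h)"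
  and run_Drop: "\<sigma> s \<noteq> [] \<Longrightarrow> run2 (drp s) (\<sigma>, h) 1 (\<sigma>(s := tl (\<sigma> s)), h)"
  and run_Copy: "s \<noteq> s' \<Longrightarrow> \<sigma> s \<noteq> [] \<Longrightarrow> length (\<sigma> s') < K \<Longrightarrow>
    run2 (copy s s') (\<sigma>, h) 1 (\<sigma>(s' := hd (\<sigma> s) # \<sigma> s'), h)"
  and run_Lft: "run2 (Basic Lft) (\<sigma>, h) 1 (\<sigma>, h - 1)"
  and run_Rgt: "run2 (Basic Rgt) (\<sigma>, h) 1 (\<sigma>, h + 1)"
  by (rule runs_Basic, simp add: stp2_def)+

lemmas basics = runs_Seq runs_Skip run_Zero run_Inc run_Dec run_Drop run_Copy run_Lft run_Rgt

lemma run_one: "length (\<sigma> s) < K \<Longrightarrow> run2 (one s) (\<sigma>, h) 3 (\<sigma>(s := 1 # \<sigma> s), h)"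
  unfolding one_def by (rule runs_cong, (rule basics | (simp; fail))+)

text \<open>The invariant speaks of states without the loop counter and is thus independent of the
  nesting depth. The three extra units per round are the decrement, the sequencing and the loop
  test.\<close>

lemma run_For:
  assumes s: "s \<noteq> ST" "\<sigma> s \<noteq> []" "length (\<sigma> ST) < K"
    and I0: "I 0 (\<sigma>, h)"
    and step: "\<And>i \<tau> g. i < hd (\<sigma> s) \<Longrightarrow> I i (\<tau>, g) \<Longrightarrow>
      \<exists>\<tau>' g'. run2 c (\<tau>(ST := (hd (\<sigma> s) - Suc i) # \<tau> ST), g) T (\<tau>'(ST := (hd (\<sigma> s) - Suc i) # \<tau>' ST), g')
        \<and> I (Suc i) (\<tau>', g')"
  shows "\<exists>\<tau> g. run2 (For s c) (\<sigma>, h) (hd (\<sigma> s) * (T + 3) + 5) (\<tau>, g) \<and> I (hd (\<sigma> s)) (\<tau>, g)"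
proof -
  let ?v = "hd (\<sigma> s)"
  define J where "J = (\<lambda>x. \<exists>i \<tau> g. i \<le> ?v \<and> x = (\<tau>(ST := (?v - i) # \<tau> ST), g) \<and> I i (\<tau>, g))"
  let ?\<mu> = "\<lambda>x :: stk state2. hd (fst x ST)"
  have body: "\<exists>y. run2 (dec ST ;; c) x (T + 2) y \<and> J y \<and> ?\<mu> y < ?\<mu> x" if J: "J x" and t: "holds2 xs (NZ ST) x" for x
  proof -
    from J obtain i \<tau> g where i: "i \<le> ?v" "x = (\<tau>(ST := (?v - i) # \<tau> ST), g)" "I i (\<tau>, g)"
      unfolding J_def by blast
    have lt: "i < ?v" using t i by simp
    obtain \<tau>' g' where n: "run2 c (\<tau>(ST := (?v - Suc i) # \<tau> ST), g) T (\<tau>'(ST := (?v - Suc i) # \<tau>' ST), g')"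
      "I (Suc i) (\<tau>', g')" using step[OF lt i(3)] by blast
    have d: "run2 (dec ST) x 1 (\<tau>(ST := (?v - Suc i) # \<tau> ST), g)"
      unfolding i(2) by (rule runs_cong, rule run_Dec) auto
    have "J (\<tau>'(ST := (?v - Suc i) # \<tau>' ST), g')"
      unfolding J_def using n(2) lt by (intro exI[of _ "Suc i"] exI[of _ \<tau>'] exI[of _ g']) simp
    then show ?thesis using runs_Seq[OF d n(1)] i lt
      by (intro exI[of _ "(\<tau>'(ST := (?v - Suc i) # \<tau>' ST), g')"]) (auto simp: add.commute)
  qed
  let ?x = "(\<sigma>(ST := ?v # \<sigma> ST), h)"
  have "J ?x" unfolding J_def using I0 by (intro exI[of _ 0] exI[of _ \<sigma>] exI[of _ h]) simp
  from runs_While[of J "holds2 xs" "NZ ST" "stp2 K" "dec ST ;; c" "T + 2" ?\<mu>, OF body this]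
  obtain y where y: "run2 (Loop (NZ ST) (dec ST ;; c)) ?x (?v * (T + 3) + 1) y" "J y" "\<not> holds2 xs (NZ ST) y"
    by (auto simp: numeral_eq_Suc)
  obtain i \<tau> g where i: "i \<le> ?v" "y = (\<tau>(ST := (?v - i) # \<tau> ST), g)" "I i (\<tau>, g)"
    using y(2) unfolding J_def by blast
  then have iv: "i = ?v" using y(3) by simp
  have cp: "run2 (copy s ST) (\<sigma>, h) 1 ?x" using s by (intro run_Copy)
  have dr: "run2 (drp ST) y 1 (\<tau>, g)" unfolding i(2) by (rule runs_cong, rule run_Drop) auto
  have "run2 (For s c) (\<sigma>, h) (?v * (T + 3) + 5) (\<tau>, g)"
    unfolding For_def by (rule runs_cong[OF runs_Seq[OF cp runs_Seq[OF y(1) dr]]]) auto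
  then show ?thesis using i iv by blast
qed

lemma run_For_fun:
  assumes s: "s \<noteq> ST" "\<sigma> s \<noteq> []" "length (\<sigma> ST) < K"
    and f0: "f 0 = \<sigma>" "g 0 = h"
    and step: "\<And>i. i < hd (\<sigma> s) \<Longrightarrow>
      run2 c ((f i)(ST := (hd (\<sigma> s) - Suc i) # f i ST), g i) T
        ((f (Suc i))(ST := (hd (\<sigma> s) - Suc i) # f (Suc i) ST), g (Suc i))"
  shows "run2 (For s c) (\<sigma>, h) (hd (\<sigma> s) * (T + 3) + 5) (f (hd (\<sigma> s)), g (hd (\<sigma> s)))"
proof -
  have "\<exists>\<tau> g'. run2 (For s c) (\<sigma>, h) (hd (\<sigma> s) * (T + 3) + 5) (\<tau>, g') \<and> (f (hd (\<sigma> s)), g (hd (\<sigma> s))) = (\<tau>, g')"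
  proof (rule run_For[where I = "\<lambda>i x. (f i, g i) = x", OF s])
    fix i \<tau> g'' assume i: "i < hd (\<sigma> s)" "(f i, g i) = (\<tau>, g'')"
    show "\<exists>\<tau>' g'. run2 c (\<tau>(ST := (hd (\<sigma> s) - Suc i) # \<tau> ST), g'') T (\<tau>'(ST := (hd (\<sigma> s) - Suc i) # \<tau>' ST), g')
        \<and> (f (Suc i), g (Suc i)) = (\<tau>', g')"
      using step[OF i(1)] i(2) by auto
  qed (use f0 in simp)
  then show ?thesis by auto
qed

lemma run_diff:
  assumes "t \<noteq> s" "t \<noteq> s'" "t \<noteq> ST" "s' \<noteq> ST" "\<sigma> s \<noteq> []" "\<sigma> s' \<noteq> []"
    "length (\<sigma> ST) < K" "length (\<sigma> t) < K"
  shows "run2 (diff t s s') (\<sigma>, h) (hd (\<sigma> s') * 4 + 7) (\<sigma>(t := (hd (\<sigma> s) - hd (\<sigma> s')) # \<sigma> t), h)"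
proof -
  let ?f = "\<lambda>i. \<sigma>(t := (hd (\<sigma> s) - i) # \<sigma> t)"
  have c: "run2 (copy s t) (\<sigma>, h) 1 (?f 0, h)"
    by (rule runs_cong, rule run_Copy) (use assms in auto)
  have "run2 (For s' (dec t)) (?f 0, h) (hd (?f 0 s') * (1 + 3) + 5) (?f (hd (?f 0 s')), h)"
  proof (rule run_For_fun[where f = ?f and g = "\<lambda>_. h"])
    fix i
    show "run2 (dec t) ((?f i)(ST := (hd (?f 0 s') - Suc i) # ?f i ST), h) 1
       ((?f (Suc i))(ST := (hd (?f 0 s') - Suc i) # ?f (Suc i) ST), h)"
      by (rule runs_cong, rule run_Dec) (use assms in \<open>auto simp: fun_eq_iff\<close>)
  qed (use assms in auto)
  then show ?thesis unfolding diff_def using assms by (intro runs_cong[OF runs_Seq[OF c]]) auto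
qed

definition mv :: "(stk \<Rightarrow> nat list) \<Rightarrow> nat \<Rightarrow> stk \<Rightarrow> nat list" where
  "mv \<sigma> d = \<sigma>(SP := (hd (\<sigma> SP) + d) # tl (\<sigma> SP))"

text \<open>\<open>mover \<tau> c m d T\<close>: with the registers of \<open>\<tau>\<close>, the command \<open>c\<close> moves the input head \<open>d\<close> cells to the
  right in time \<open>T\<close>, nesting loops to depth \<open>m\<close>.\<close>

definition mover :: "(stk \<Rightarrow> nat list) \<Rightarrow> stk com2 \<Rightarrow> nat \<Rightarrow> nat \<Rightarrow> nat \<Rightarrow> bool" where
  "mover \<tau> c m d T \<longleftrightarrow> (\<forall>\<sigma> h. \<sigma> SP \<noteq> [] \<longrightarrow> length (\<sigma> ST) + m \<le> K \<longrightarrow>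
     (\<forall>s. s \<noteq> SP \<longrightarrow> s \<noteq> ST \<longrightarrow> \<sigma> s = \<tau> s) \<longrightarrow> run2 c (\<sigma>, h) T (mv \<sigma> d, h + d))"

lemma mover_moveR: "mover \<tau> moveR 0 1 3"
  unfolding mover_def moveR_def
  by (intro allI impI, rule runs_cong, (rule basics | (simp; fail))+) (auto simp: mv_def)

lemma mover_Seq: "mover \<tau> c m d T \<Longrightarrow> mover \<tau> c' m d' T' \<Longrightarrow> mover \<tau> (c ;; c') m (d + d') (T + T' + 1)"
  unfolding mover_def
proof (intro allI impI)
  fix \<sigma> h
  assume c: "\<forall>\<sigma> h. \<sigma> SP \<noteq> [] \<longrightarrow> length (\<sigma> ST) + m \<le> K \<longrightarrow>
     (\<forall>s. s \<noteq> SP \<longrightarrow> s \<noteq> ST \<longrightarrow> \<sigma> s = \<tau> s) \<longrightarrow> run2 c (\<sigma>, h) T (mv \<sigma> d, h + d)"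
   and c': "\<forall>\<sigma> h. \<sigma> SP \<noteq> [] \<longrightarrow> length (\<sigma> ST) + m \<le> K \<longrightarrow>
     (\<forall>s. s \<noteq> SP \<longrightarrow> s \<noteq> ST \<longrightarrow> \<sigma> s = \<tau> s) \<longrightarrow> run2 c' (\<sigma>, h) T' (mv \<sigma> d', h + d')"
   and a: "\<sigma> SP \<noteq> []" "length (\<sigma> ST) + m \<le> K" "\<forall>s. s \<noteq> SP \<longrightarrow> s \<noteq> ST \<longrightarrow> \<sigma> s = \<tau> s"
  have 1: "run2 c (\<sigma>, h) T (mv \<sigma> d, h + d)" using c a by blast
  have 2: "run2 c' (mv \<sigma> d, h + d) T' (mv (mv \<sigma> d) d', h + d + d')"
    using a by (intro c'[rule_format]) (auto simp: mv_def)
  show "run2 (c ;; c') (\<sigma>, h) (T + T' + 1) (mv \<sigma> (d + d'), h + (d + d'))"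
    by (rule runs_cong[OF runs_Seq[OF 1 2]]) (auto simp: mv_def add.assoc)
qed

lemma mover_For:
  assumes c: "mover \<tau> c m d T" and s: "s \<noteq> SP" "s \<noteq> ST" "\<tau> s \<noteq> []"
  shows "mover \<tau> (For s c) (Suc m) (hd (\<tau> s) * d) (hd (\<tau> s) * (T + 3) + 5)"
  unfolding mover_def
proof (intro allI impI)
  fix \<sigma> h
  assume a: "\<sigma> SP \<noteq> []" "length (\<sigma> ST) + Suc m \<le> K" "\<forall>s. s \<noteq> SP \<longrightarrow> s \<noteq> ST \<longrightarrow> \<sigma> s = \<tau> s"
  let ?f = "\<lambda>i. mv \<sigma> (i * d)" and ?g = "\<lambda>i. h + i * d"
  have "run2 (For s c) (\<sigma>, h) (hd (\<sigma> s) * (T + 3) + 5) (?f (hd (\<sigma> s)), ?g (hd (\<sigma> s)))"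
  proof (rule run_For_fun[where f = ?f and g = ?g])
    fix i
    let ?\<sigma> = "(?f i)(ST := (hd (\<sigma> s) - Suc i) # ?f i ST)"
    have "run2 c (?\<sigma>, ?g i) T (mv ?\<sigma> d, ?g i + d)"
      using a by (intro c[unfolded mover_def, rule_format]) (auto simp: mv_def)
    then show "run2 c (?\<sigma>, ?g i) T ((?f (Suc i))(ST := (hd (\<sigma> s) - Suc i) # ?f (Suc i) ST), ?g (Suc i))"
      by (rule runs_cong) (auto simp: mv_def fun_eq_iff)
  qed (use a s in \<open>auto simp: mv_def\<close>)
  then show "run2 (For s c) (\<sigma>, h) (hd (\<tau> s) * (T + 3) + 5) (mv \<sigma> (hd (\<tau> s) * d), h + hd (\<tau> s) * d)"
    using a s by simp
qed

lemma mover_mono: "mover \<tau> c m d T \<Longrightarrow> m \<le> m' \<Longrightarrow> mover \<tau> c m' d T"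
  unfolding mover_def by (meson add_left_mono le_trans)

lemma run_seek:
  assumes "\<sigma> SN \<noteq> []" "\<sigma> SX \<noteq> []" "\<sigma> SY \<noteq> []" "\<sigma> SP = [0]" "length (\<sigma> ST) + 2 \<le> K"
    "p = hd (\<sigma> SN) + (hd (\<sigma> SX) * (hd (\<sigma> SN) * 2) + hd (\<sigma> SY) * 2)"
  shows "run2 seek (\<sigma>, 0) (hd (\<sigma> SN) * 6 + hd (\<sigma> SX) * (hd (\<sigma> SN) * 10 + 8) + hd (\<sigma> SY) * 10 + 17)
    (\<sigma>(SP := [p]), p)"
proof -
  have m2: "mover \<sigma> (moveR ;; moveR) 0 2 7"
    using mover_Seq[OF mover_moveR mover_moveR] by (simp add: numeral_eq_Suc)
  have 1: "mover \<sigma> (For SN moveR) 2 (hd (\<sigma> SN) * 1) (hd (\<sigma> SN) * (3 + 3) + 5)"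
    by (rule mover_mono[OF mover_For[OF mover_moveR]]) (use assms in auto)
  have "mover \<sigma> (For SX (For SN (moveR ;; moveR))) (Suc (Suc 0)) (hd (\<sigma> SX) * (hd (\<sigma> SN) * 2))
     (hd (\<sigma> SX) * (hd (\<sigma> SN) * (7 + 3) + 5 + 3) + 5)"
    by (intro mover_For m2) (use assms in auto)
  then have 2: "mover \<sigma> (For SX (For SN (moveR ;; moveR))) 2 (hd (\<sigma> SX) * (hd (\<sigma> SN) * 2))
     (hd (\<sigma> SX) * (hd (\<sigma> SN) * (7 + 3) + 5 + 3) + 5)" by (simp add: numeral_2_eq_2)
  have 3: "mover \<sigma> (For SY (moveR ;; moveR)) 2 (hd (\<sigma> SY) * 2) (hd (\<sigma> SY) * (7 + 3) + 5)"
    by (rule mover_mono[OF mover_For[OF m2]]) (use assms in auto)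
  have "mover \<sigma> seek 2 p (hd (\<sigma> SN) * 6 + hd (\<sigma> SX) * (hd (\<sigma> SN) * 10 + 8) + hd (\<sigma> SY) * 10 + 17)"
    unfolding seek_def assms(6) using mover_Seq[OF 1 mover_Seq[OF 2 3]] by (simp add: algebra_simps)
  from this[unfolded mover_def, rule_format, of \<sigma> 0] show ?thesis using assms by (simp add: mv_def)
qed

lemma run_rewind: "\<sigma> SP = v # vs \<Longrightarrow> run2 rewind (\<sigma>, v) (4 * v + 1) (\<sigma>(SP := 0 # vs), 0)"
proof (induction v arbitrary: \<sigma>)
  case 0
  then have "\<sigma>(SP := 0 # vs) = \<sigma>" by auto
  then show ?case using runs_LoopF[of "holds2 xs" "NZ SP" "(\<sigma>, 0)" "stp2 K" "dec SP ;; Basic Lft"] 0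
    by (simp add: rewind_def)
next
  case (Suc v)
  have b: "run2 (dec SP ;; Basic Lft) (\<sigma>, Suc v) 3 (\<sigma>(SP := v # vs), v)"
    by (rule runs_cong, (rule basics | (simp add: Suc; fail))+)
  have "run2 rewind (\<sigma>(SP := v # vs), v) (4 * v + 1) (\<sigma>(SP := 0 # vs), 0)"
    using Suc.IH[of "\<sigma>(SP := v # vs)"] by (simp only: fun_upd_same fun_upd_upd simp_thms)
  from runs_LoopT[OF _ b this[unfolded rewind_def]] show ?case unfolding rewind_def
    using Suc.prems by (simp del: fun_upd_apply)
qed

lemma run_scan:
  assumes "\<tau> SG = [1]" "\<tau> SY = [y]" "\<tau> SQ = [q]" "\<tau> SP = [p]" "\<tau> SU = [e]" "1 < K"
  shows "run2 scan (\<tau>, p) 30 (\<tau>(SQ := [if e \<noteq> 0 \<longrightarrow> input_sym xs p = Some True then Suc y else q], SP := [p + 2],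
     SG := [if input_sym xs (Suc p) = Some True then 1 else 0], SY := [Suc y]), p + 2)"
  unfolding scan_def moveR_def setQ_def
  apply (cases "e = 0"; cases "input_sym xs p = Some True"; cases "input_sym xs (Suc p) = Some True")
  by (rule runs_cong, ((rule runs_CondT, (simp add: assms; fail)) | (rule runs_CondF, (simp add: assms; fail))
      | rule basics | (use assms in \<open>simp; fail\<close>))+, use assms in \<open>auto simp: fun_eq_iff\<close>)+

text \<open>\<open>f i\<close> is the state after \<open>i\<close> executions of \<open>c\<close>.
  The stack \<open>ST\<close> is exempt, because the surrounding loops keep changing counters
  there.\<close>

lemma run_nest:
  assumes step: "\<And>i \<tau>. (\<And>s. s \<noteq> ST \<Longrightarrow> \<tau> s = f i s) \<Longrightarrow> run2 c (\<tau>, h) 1 ((f (Suc i))(ST := \<tau> ST), h)"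
    and k: "\<And>i. f i SK = [k]" "k \<le> W" "W + 10 \<le> b"
    and \<sigma>: "\<And>s. s \<noteq> ST \<Longrightarrow> \<sigma> s = f i s" "length (\<sigma> ST) + d \<le> K"
  shows "run2 (nest c d) (\<sigma>, h) (b ^ Suc d) ((f (i + k ^ d))(ST := \<sigma> ST), h)"
  using \<sigma>
proof (induction d arbitrary: \<sigma> i)
  case 0
  show ?case unfolding nest.simps by (rule runs_cong, rule step[of \<sigma> i]) (use 0 k in auto)
next
  case (Suc d)
  let ?f = "\<lambda>l. (f (i + l * k ^ d))(ST := \<sigma> ST)"
  have SK: "\<sigma> SK = [k]" using Suc.prems(1)[of SK] k(1) by simp
  have R: "run2 (For SK (nest c d)) (\<sigma>, h) (hd (\<sigma> SK) * (b ^ Suc d + 3) + 5) (?f (hd (\<sigma> SK)), h)"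
  proof (rule run_For_fun[where f = ?f and g = "\<lambda>_. h"])
    fix l
    let ?\<sigma> = "(?f l)(ST := (hd (\<sigma> SK) - Suc l) # ?f l ST)"
    have "run2 (nest c d) (?\<sigma>, h) (b ^ Suc d) ((f (i + l * k ^ d + k ^ d))(ST := ?\<sigma> ST), h)"
      by (rule Suc.IH) (use Suc.prems(2) in auto)
    then show "run2 (nest c d) (?\<sigma>, h) (b ^ Suc d) ((?f (Suc l))(ST := (hd (\<sigma> SK) - Suc l) # ?f (Suc l) ST), h)"
      by (rule runs_cong) (auto simp: ac_simps)
  qed (use Suc.prems SK in \<open>auto simp: fun_eq_iff\<close>)
  show ?case unfolding nest.simps
    by (rule runs_cong[OF R]) (use SK loop_bound[OF k(2,3)] in \<open>simp_all only: list.sel power_Suc mult.assoc\<close>)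
qed

end

subsection \<open>Searching a single column\<close>

text \<open>The unary code of \<open>n\<close> takes \<open>n + 1\<close> cells; then follow two
  bits per vertex, column by column.\<close>

definition cell_pos :: "nat \<Rightarrow> nat \<Rightarrow> nat \<Rightarrow> nat" where
  "cell_pos n x y = (n + 1) + (x * ((n + 1) * 2) + y * 2)"

locale instance_input =
  fixes E :: graph and n it :: nat and xs :: "bool list" and K :: nat
  assumes edges: "E \<subseteq> grid_edges n" and it: "it \<le> n"
    and east_in: "x \<le> n \<Longrightarrow> y \<le> n \<Longrightarrow> input_sym xs (cell_pos n x y) = Some (((x, y), (x + 1, y)) \<in> E)"
    and north_in: "x \<le> n \<Longrightarrow> y \<le> n \<Longrightarrow> input_sym xs (Suc (cell_pos n x y)) = Some (((x, y), (x, y + 1)) \<in> E)"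
begin

abbreviation "step \<equiv> col_step E n it"
abbreviation "run \<equiv> run2 xs K"

text \<open>Rows are visited upwards, so overwriting the last hit leaves the highest one, and the
  loop length \<open>M - j\<close> keeps the search below the mark.\<close>

lemma scan_column:
  assumes j: "j \<le> n" and K: "1 < K" "length (\<sigma> ST) + 1 < K" and x: "x = min a it"
    and \<sigma>: "\<sigma> SU = [it - a]" "\<sigma> SV = [M - j]" "\<sigma> SY = [j]" "\<sigma> SP = [cell_pos n x j]" "\<sigma> SG = [1]" "\<sigma> SQ = [0]"
  shows "\<exists>g y c q. run (For SV (Cond (NZ SG) scan Skip)) (\<sigma>, cell_pos n x j) ((M - j) * 34 + 5)
       (\<sigma>(SP := [g], SY := [y], SG := [c], SQ := [q]), g) \<and> g \<le> cell_pos n x j + 2 * (M - j) \<and>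
       (if q = 0 then \<forall>z<M. \<not> step a j z else best (step a j) M (q - 1))"
proof -
  \<comment> \<open>Once \<open>c\<close> is 0 a north edge is missing and neither the row nor the
    head position is tracked any further, except for the upper bound on \<open>g\<close> that the
    cost of rewinding requires.\<close>
  define P where "P = (\<lambda>i g y c q. g \<le> cell_pos n x j + 2 * i \<and>
     (if c = 0 then \<not> (\<forall>z. j \<le> z \<longrightarrow> z < j + i \<longrightarrow> ((x, z), (x, z + 1)) \<in> E)
      else c = Suc 0 \<and> y = j + i \<and> y \<le> n \<and> g = cell_pos n x y \<and>
        (\<forall>z. j \<le> z \<longrightarrow> z < j + i \<longrightarrow> ((x, z), (x, z + 1)) \<in> E)) \<and>
     (if q = 0 then \<forall>z<j + i. \<not> step a j z else best (step a j) (j + i) (q - 1)))"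
  define I where "I = (\<lambda>i (\<tau>, g). \<exists>y c q. \<tau> = \<sigma>(SP := [g], SY := [y], SG := [c], SQ := [q]) \<and> P i g y c q)"
  have xn: "x \<le> n" using x it by simp
  have I0: "I 0 (\<sigma>, cell_pos n x j)"
  proof -
    have "\<not> step a j z" if "z < j" for z using that by (simp add: col_step_def)
    then have "P 0 (cell_pos n x j) j 1 0" using j by (simp add: P_def)
    moreover have "\<sigma> = \<sigma>(SP := [cell_pos n x j], SY := [j], SG := [1], SQ := [0])" using \<sigma> by auto
    ultimately show ?thesis unfolding I_def prod.case by blast
  qed
  have "\<exists>\<tau> g. run (For SV (Cond (NZ SG) scan Skip)) (\<sigma>, cell_pos n x j) (hd (\<sigma> SV) * (31 + 3) + 5) (\<tau>, g) \<and> I (hd (\<sigma> SV)) (\<tau>, g)"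
  proof (rule run_For[where I = I, OF _ _ _ I0])
    fix i \<tau> g assume i: "i < hd (\<sigma> SV)" and I: "I i (\<tau>, g)"
    let ?T = "(hd (\<sigma> SV) - Suc i)"
    from I[unfolded I_def prod.case] obtain y c q where yc: "\<tau> = \<sigma>(SP := [g], SY := [y], SG := [c], SQ := [q])"
      and P: "P i g y c q" by blast
    have g: "g \<le> cell_pos n x j + 2 * i" using P[unfolded P_def] by (rule conjunct1)
    have c: "if c = 0 then \<not> (\<forall>z. j \<le> z \<longrightarrow> z < j + i \<longrightarrow> ((x, z), (x, z + 1)) \<in> E)
          else c = Suc 0 \<and> y = j + i \<and> y \<le> n \<and> g = cell_pos n x y \<and>
          (\<forall>z. j \<le> z \<longrightarrow> z < j + i \<longrightarrow> ((x, z), (x, z + 1)) \<in> E)"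
      using conjunct2[OF P[unfolded P_def]] by (rule conjunct1)
    have q: "if q = 0 then \<forall>z<j + i. \<not> step a j z else best (step a j) (j + i) (q - 1)"
      using conjunct2[OF P[unfolded P_def]] by (rule conjunct2)
    show "\<exists>\<tau>' g'. run (Cond (NZ SG) scan Skip) (\<tau>(ST := ?T # \<tau> ST), g) 31 (\<tau>'(ST := ?T # \<tau>' ST), g') \<and> I (Suc i) (\<tau>', g')"
    proof (cases "c = 0")
      case True
      obtain w where w: "j \<le> w" "w < j + i" "((x, w), (x, w + 1)) \<notin> E" using c True by auto
      have dead: "\<not> step a j z" if "j + i \<le> z" for z
        using w[unfolded x] less_le_trans[OF w(2) that] unfolding col_step_def by blast
      have nox: "z < j + Suc i \<Longrightarrow> step a j z \<Longrightarrow> z < j + i" for z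
        using dead[of "j + i"] less_Suc_eq[of z "j + i"] by auto
      have "I (Suc i) (\<tau>, g)"
      proof -
        have "if q = 0 then \<forall>z<j + Suc i. \<not> step a j z else best (step a j) (j + Suc i) (q - 1)"
        proof (cases "q = 0")
          case True
          then have "\<forall>z<j + i. \<not> step a j z" using q by simp
          with True nox show ?thesis by (metis (full_types))
        next
          case False
          then have b: "step a j (q - 1)" "q - 1 < j + i" "\<And>z. z < j + i \<Longrightarrow> step a j z \<Longrightarrow> z \<le> q - 1"
            using q by (auto simp: best_def)
          have "best (step a j) (j + Suc i) (q - 1)"
            unfolding best_def by (intro conjI allI impI b(1)) (use b(2) in simp, rule b(3)[OF nox])
          with False show ?thesis by simp
        qed
        moreover have "\<not> (\<forall>z. j \<le> z \<longrightarrow> z < j + Suc i \<longrightarrow> ((x, z), (x, z + 1)) \<in> E)"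
          using c True by auto
        ultimately have "P (Suc i) g y 0 q" unfolding P_def using g by simp
        then show ?thesis unfolding I_def prod.case using yc True by blast
      qed
      moreover have "run (Cond (NZ SG) scan Skip) (\<tau>(ST := ?T # \<tau> ST), g) 31 (\<tau>(ST := ?T # \<tau> ST), g)"
        by (rule runs_cong, rule runs_CondF, use yc True in simp, rule runs_Skip) auto
      ultimately show ?thesis by blast
    next
      case False
      then have c1: "c = Suc 0" "y = j + i" "y \<le> n" "g = cell_pos n x y"
        and al: "\<And>z. j \<le> z \<Longrightarrow> z < j + i \<Longrightarrow> ((x, z), (x, z + 1)) \<in> E" using c by auto
      let ?east = "((x, y), (x + 1, y)) \<in> E" and ?north = "((x, y), (x, y + 1)) \<in> E"
      define q' where "q' = (if it - a \<noteq> 0 \<longrightarrow> ?east then Suc y else q)"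
      define c' :: nat where "c' = (if ?north then 1 else 0)"
      let ?\<tau> = "\<sigma>(SP := [g + 2], SY := [Suc y], SG := [c'], SQ := [q'])"
      have east: "input_sym xs g = Some True \<longleftrightarrow> ?east" using east_in[OF xn c1(3)] c1(4) by simp
      have north: "input_sym xs (Suc g) = Some True \<longleftrightarrow> ?north" using north_in[OF xn c1(3)] c1(4) by simp
      have sc: "run scan (\<tau>(ST := ?T # \<tau> ST), g) 30 (?\<tau>(ST := ?T # ?\<tau> ST), g + 2)"
        by (rule runs_cong, rule run_scan[where y = y and q = q and e = "it - a"])
          (use yc c1(1) \<sigma> K in \<open>auto simp: fun_eq_iff east north q'_def c'_def\<close>)
      have run: "run (Cond (NZ SG) scan Skip) (\<tau>(ST := ?T # \<tau> ST), g) 31 (?\<tau>(ST := ?T # ?\<tau> ST), g + 2)"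
        by (rule runs_cong, rule runs_CondT[OF _ sc]) (use yc c1 in auto)
      have stepy: "step a j y \<longleftrightarrow> (it - a \<noteq> 0 \<longrightarrow> ?east)"
        using c1(2,3) al x unfolding col_step_def by auto
      have "(if q' = 0 then \<forall>z<j + Suc i. \<not> step a j z else best (step a j) (j + Suc i) (q' - 1))"
        using q stepy c1(2) unfolding q'_def best_def by (auto simp: less_Suc_eq split: if_splits)
      moreover have "if c' = 0 then \<not> (\<forall>z. j \<le> z \<longrightarrow> z < j + Suc i \<longrightarrow> ((x, z), (x, z + 1)) \<in> E)
          else c' = Suc 0 \<and> Suc y = j + Suc i \<and> Suc y \<le> n \<and> g + 2 = cell_pos n x (Suc y) \<and>
          (\<forall>z. j \<le> z \<longrightarrow> z < j + Suc i \<longrightarrow> ((x, z), (x, z + 1)) \<in> E)"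
      proof (cases ?north)
        \<comment> \<open>An existing north edge ends inside the grid, so the bits of the next row
          are present on the input.\<close>
        case True
        then have "Suc y \<le> n" using edges by (auto simp: grid_edges_def)
        then show ?thesis using True c1 al by (auto simp: c'_def cell_pos_def less_Suc_eq)
      next
        case False
        then show ?thesis using c1 by (auto simp: c'_def intro!: exI[of _ y])
      qed
      ultimately have "P (Suc i) (g + 2) (Suc y) c' q'" unfolding P_def using g by simp
      then have "I (Suc i) (?\<tau>, g + 2)" unfolding I_def prod.case by blast
      with run show ?thesis by blast
    qed
  qed (use \<sigma> K in auto)
  then obtain \<tau> g where r: "run (For SV (Cond (NZ SG) scan Skip)) (\<sigma>, cell_pos n x j) ((M - j) * 34 + 5) (\<tau>, g)"
    "I (M - j) (\<tau>, g)" using \<sigma> by auto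
  from r(2)[unfolded I_def prod.case] obtain y c q
    where yc: "\<tau> = \<sigma>(SP := [g], SY := [y], SG := [c], SQ := [q])" and P: "P (M - j) g y c q" by blast
  have g: "g \<le> cell_pos n x j + 2 * (M - j)" using P[unfolded P_def] by (rule conjunct1)
  have q: "if q = 0 then \<forall>z<j + (M - j). \<not> step a j z else best (step a j) (j + (M - j)) (q - 1)"
    using conjunct2[OF P[unfolded P_def]] by (rule conjunct2)
  have "if q = 0 then \<forall>z<M. \<not> step a j z else best (step a j) M (q - 1)"
  \<comment> \<open>If \<open>M < j\<close>, truncated subtraction gives an empty loop, which is
    right because a column step never goes down.\<close>
  proof (cases "j \<le> M")
    case False
    then show ?thesis using q by (auto simp: best_def col_step_def split: if_splits)
  qed (use q in auto)
  then show ?thesis using r(1) g unfolding yc by blast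
qed

definition env :: "nat \<Rightarrow> (stk \<Rightarrow> nat list) \<Rightarrow> bool" where
  "env k \<sigma> \<longleftrightarrow> \<sigma> SN = [n + 1] \<and> \<sigma> SK = [k] \<and> \<sigma> SJ = [k - 1] \<and> \<sigma> SI = [it] \<and> \<sigma> SP = [0] \<and>
     \<sigma> SU = [] \<and> \<sigma> SV = [] \<and> \<sigma> SX = [] \<and> \<sigma> SY = [] \<and> \<sigma> SG = [] \<and> \<sigma> SQ = []"

lemma run_prog0:
  assumes env: "env k \<sigma>" and \<sigma>: "\<sigma> SA = [a]" "\<sigma> SL = j # ls" "\<sigma> SR = M # rs" and jM: "j \<le> n" "M \<le> n + 1"
    and room: "\<forall>s. length (\<sigma> s) + 5 \<le> K" and W: "n + 1 \<le> W" "a \<le> W"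
  shows "best (step a j) M q \<Longrightarrow>
      run prog0 (\<sigma>, 0) (200 * (W + 1) ^ 2) (\<sigma>(SL := q # j # ls, SR := rs, SA := [Suc a], SF := 1 # \<sigma> SF), 0)"
    and "\<forall>z<M. \<not> step a j z \<Longrightarrow> run prog0 (\<sigma>, 0) (200 * (W + 1) ^ 2) (\<sigma>(SF := 0 # \<sigma> SF), 0)"
proof -
  define x where "x = min a it"
  let ?p = "cell_pos n x j"
  have e: "\<sigma> SN = [n + 1]" "\<sigma> SI = [it]" "\<sigma> SP = [0]" "\<sigma> SU = []" "\<sigma> SV = []" "\<sigma> SX = []" "\<sigma> SY = []" "\<sigma> SG = []" "\<sigma> SQ = []"
    using env by (auto simp: env_def)
  have K: "5 \<le> K" "length (\<sigma> ST) + 5 \<le> K" "length (\<sigma> SL) + 5 \<le> K" "length (\<sigma> SF) + 5 \<le> K" "length (\<sigma> SR) + 5 \<le> K"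
    using room[rule_format, of SU] room[rule_format, of ST] room[rule_format, of SL] room[rule_format, of SF]
      room[rule_format, of SR] e(4) by auto
  note s = e \<sigma>
  let ?S1 = "\<sigma>(SU := [it - a])"
  let ?S4 = "?S1(SX := [x], SY := [j], SV := [M - j])"
  let ?S6 = "?S4(SP := [?p], SG := [1], SQ := [0])"
  have 1: "run (diff SU SI SA) (\<sigma>, 0) (a * 4 + 7) (?S1, 0)"
    by (rule runs_cong, rule run_diff) (use s K in auto)
  have 2: "run (Cond (NZ SU) (copy SA SX) (copy SI SX)) (?S1, 0) 2 (?S1(SX := [x]), 0)"
  proof (cases "it - a = 0")
    case True
    show ?thesis by (rule runs_cong, rule runs_CondF, use True in simp, rule run_Copy) (use s K True in \<open>auto simp: x_def min_def\<close>)
  next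
    case False
    show ?thesis by (rule runs_cong, rule runs_CondT, use False in simp, rule run_Copy) (use s K False in \<open>auto simp: x_def min_def\<close>)
  qed
  have 3: "run (copy SL SY) (?S1(SX := [x]), 0) 1 (?S1(SX := [x], SY := [j]), 0)"
    by (rule runs_cong, rule run_Copy) (use s K in auto)
  have 4: "run (diff SV SR SL) (?S1(SX := [x], SY := [j]), 0) (j * 4 + 7) (?S4, 0)"
    by (rule runs_cong, rule run_diff) (use s K in auto)
  have 5: "run seek (?S4, 0) ((n + 1) * 6 + x * ((n + 1) * 10 + 8) + j * 10 + 17) (?S4(SP := [?p]), ?p)"
    by (rule runs_cong, rule run_seek[where p = ?p]) (use s K in \<open>auto simp: cell_pos_def\<close>)
  have 6: "run (one SG) (?S4(SP := [?p]), ?p) 3 (?S4(SP := [?p], SG := [1]), ?p)"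
    by (rule runs_cong, rule run_one) (use s K in auto)
  have 7: "run (zero SQ) (?S4(SP := [?p], SG := [1]), ?p) 1 (?S6, ?p)"
    by (rule runs_cong, rule run_Zero) (use s K in auto)
  obtain g y c r where 8: "run (For SV (Cond (NZ SG) scan Skip)) (?S6, ?p) ((M - j) * 34 + 5)
       (?S6(SP := [g], SY := [y], SG := [c], SQ := [r]), g)"
     and g: "g \<le> ?p + 2 * (M - j)" and r: "if r = 0 then \<forall>z<M. \<not> step a j z else best (step a j) M (r - 1)"
    using scan_column[OF jM(1), of ?S6 x a M] K x_def by auto
  let ?S8 = "?S6(SP := [g], SY := [y], SG := [c], SQ := [r])"
  have 9: "run rewind (?S8, g) (4 * g + 1) (?S8(SP := [0]), 0)"
    by (rule runs_cong, rule run_rewind) auto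
  let ?S10 = "\<sigma>(SQ := [r])"
  let ?tail = "Cond (NZ SQ) (dec SQ ;; copy SQ SL ;; drp SR ;; inc SA ;; one SF) (zero SF) ;; drp SQ"
  \<comment> \<open>Everything before the verdict is common to both outcomes, so its cost is
    estimated once for an arbitrary final state.\<close>
  have 10: "run prog0 (\<sigma>, 0) (200 * (W + 1) ^ 2) (\<tau>, 0)" if t: "run ?tail (?S10, 0) 20 (\<tau>, 0)" for \<tau>
  proof -
    have "run (drp SG ;; drp SV ;; drp SY ;; drp SX ;; drp SU ;; ?tail) (?S8(SP := [0]), 0)
        (1 + (1 + (1 + (1 + (1 + 20 + 1) + 1) + 1) + 1) + 1) (\<tau>, 0)"
    proof -
      have a: "run (drp SG) (?S8(SP := [0]), 0) 1 (?S8(SP := [0], SG := []), 0)"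
        by (rule runs_cong, rule run_Drop) auto
      have b: "run (drp SV) (?S8(SP := [0], SG := []), 0) 1 (?S8(SP := [0], SG := [], SV := []), 0)"
        by (rule runs_cong, rule run_Drop) auto
      have c: "run (drp SY) (?S8(SP := [0], SG := [], SV := []), 0) 1 (?S8(SP := [0], SG := [], SV := [], SY := []), 0)"
        by (rule runs_cong, rule run_Drop) auto
      have d: "run (drp SX) (?S8(SP := [0], SG := [], SV := [], SY := []), 0) 1 (?S8(SP := [0], SG := [], SV := [], SY := [], SX := []), 0)"
        by (rule runs_cong, rule run_Drop) auto
      have e: "run (drp SU) (?S8(SP := [0], SG := [], SV := [], SY := [], SX := []), 0) 1 (?S10, 0)"
        by (rule runs_cong, rule run_Drop) (use s in \<open>auto simp: fun_eq_iff\<close>)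
      show ?thesis by (rule runs_Seq[OF a runs_Seq[OF b runs_Seq[OF c runs_Seq[OF d runs_Seq[OF e t]]]]])
    qed
    note R = runs_Seq[OF 1 runs_Seq[OF 2 runs_Seq[OF 3 runs_Seq[OF 4 runs_Seq[OF 5 runs_Seq[OF 6
        runs_Seq[OF 7 runs_Seq[OF 8 runs_Seq[OF 9 this]]]]]]]]]
    have xW: "x \<le> W" using W(2) by (simp add: x_def)
    have xN: "x * (n + 1) \<le> W * W" using xW W(1) by (rule mult_le_mono)
    have p: "?p = (n + 1) + 2 * (x * (n + 1)) + 2 * j" by (simp add: cell_pos_def algebra_simps)
    have q: "x * ((n + 1) * 10 + 8) = 10 * (x * (n + 1)) + 8 * x" by (simp add: algebra_simps)
    have sq: "(W + 1) ^ 2 = W * W + 2 * W + 1" by (simp add: power2_eq_square algebra_simps)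
    have Mj: "M - j \<le> W" "j \<le> W" using jM W by auto
    \<comment> \<open>The products receive names, so that the remaining inequality is
      linear.\<close>
    obtain X v Q where Xv: "X = x * (n + 1)" "v = M - j" "Q = W * W" by simp
    show ?thesis unfolding prog0_def
      by (rule runs_mono[OF R], unfold q sq, fold Xv)
        (use g[unfolded p, folded Xv] W Mj[folded Xv] xW xN[folded Xv] in simp)
  qed
  have tail0: "run ?tail (?S10, 0) 20 (\<sigma>(SF := 0 # \<sigma> SF), 0)" if "r = 0"
    by (rule runs_cong, rule runs_Seq, rule runs_CondF, use that in simp, (rule basics run_one | (use s K in \<open>simp; fail\<close>))+)
      (use s K in \<open>auto simp: fun_eq_iff\<close>)
  have tail1: "run ?tail (?S10, 0) 20 (\<sigma>(SL := (r - 1) # j # ls, SR := rs, SA := [Suc a], SF := 1 # \<sigma> SF), 0)" if "r \<noteq> 0"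
    by (rule runs_cong, rule runs_Seq, rule runs_CondT, use that in simp, (rule basics run_one | (use s K in \<open>simp; fail\<close>))+)
      (use s K in \<open>auto simp: fun_eq_iff\<close>)
  show "run prog0 (\<sigma>, 0) (200 * (W + 1) ^ 2) (\<sigma>(SL := q # j # ls, SR := rs, SA := [Suc a], SF := 1 # \<sigma> SF), 0)"
    if b: "best (step a j) M q"
  proof -
    have "r \<noteq> 0" using b r by (auto simp: best_def split: if_splits)
    then have "best (step a j) M (r - 1)" using r by simp
    then have "r - 1 = q" using b unfolding best_def by (metis le_antisym)
    then show ?thesis using 10[OF tail1] \<open>r \<noteq> 0\<close> by simp
  qed
  show "run prog0 (\<sigma>, 0) (200 * (W + 1) ^ 2) (\<sigma>(SF := 0 # \<sigma> SF), 0)" if b: "\<forall>z<M. \<not> step a j z"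
  proof -
    have "r = 0" using b r by (auto simp: best_def split: if_splits)
    then show ?thesis using 10[OF tail0] by simp
  qed
qed

section \<open>Stack bookkeeping around a sub-search\<close>

lemma run_drops:
  assumes "s \<noteq> ST" "s \<noteq> SJ" "\<tau> SJ = [v]" "v \<le> length (\<tau> s)" "length (\<tau> ST) < K"
  shows "run (For SJ (drp s)) (\<tau>, h) (v * 4 + 5) (\<tau>(s := drop v (\<tau> s)), h)"
proof -
  let ?f = "\<lambda>i. \<tau>(s := drop i (\<tau> s))"
  have R: "run (For SJ (drp s)) (\<tau>, h) (hd (\<tau> SJ) * (1 + 3) + 5) (?f (hd (\<tau> SJ)), h)"
  proof (rule run_For_fun[where f = ?f and g = "\<lambda>_. h"])
    fix i assume i: "i < hd (\<tau> SJ)"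
    show "run (drp s) ((?f i)(ST := (hd (\<tau> SJ) - Suc i) # ?f i ST), h) 1
       ((?f (Suc i))(ST := (hd (\<tau> SJ) - Suc i) # ?f (Suc i) ST), h)"
      by (rule runs_cong, rule run_Drop) (use assms i in \<open>auto simp: fun_eq_iff drop_Suc tl_drop\<close>)
  qed (use assms in auto)
  show ?thesis by (rule runs_cong[OF R]) (use assms in auto)
qed

lemma run_fill:
  assumes "\<tau> SJ = [v]" "\<tau> SN = [w]" "length (\<tau> SR) + v \<le> K" "length (\<tau> ST) < K"
  shows "run (For SJ (copy SN SR)) (\<tau>, h) (v * 4 + 5) (\<tau>(SR := replicate v w @ \<tau> SR), h)"
proof -
  let ?f = "\<lambda>i. \<tau>(SR := replicate i w @ \<tau> SR)"
  have R: "run (For SJ (copy SN SR)) (\<tau>, h) (hd (\<tau> SJ) * (1 + 3) + 5) (?f (hd (\<tau> SJ)), h)"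
  proof (rule run_For_fun[where f = ?f and g = "\<lambda>_. h"])
    fix i assume i: "i < hd (\<tau> SJ)"
    show "run (copy SN SR) ((?f i)(ST := (hd (\<tau> SJ) - Suc i) # ?f i ST), h) 1
       ((?f (Suc i))(ST := (hd (\<tau> SJ) - Suc i) # ?f (Suc i) ST), h)"
      by (rule runs_cong, rule run_Copy) (use assms i in \<open>auto simp: fun_eq_iff\<close>)
  qed (use assms in auto)
  show ?thesis by (rule runs_cong[OF R]) (use assms in auto)
qed

lemma run_push_branch:
  assumes "\<tau> SF = f # fs" "\<tau> SC = i # cs" "\<tau> SK = [k]" "\<tau> SU = []" "\<tau> SZ = 1 # zs" "length (\<tau> ST) < K"
  shows "run push_branch (\<tau>, 0) (4 * i + 30) (\<tau>(SF := fs, SC := Suc i # cs, SZ := (if k \<le> Suc i then 0 else 1) # zs), 0)"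
proof -
  have a: "run (drp SF) (\<tau>, 0) 1 (\<tau>(SF := fs), 0)"
    by (rule runs_cong, rule run_Drop) (use assms in auto)
  have b: "run (inc SC) (\<tau>(SF := fs), 0) 1 (\<tau>(SF := fs, SC := Suc i # cs), 0)"
    by (rule runs_cong, rule run_Inc) (use assms in auto)
  let ?S = "\<tau>(SF := fs, SC := Suc i # cs, SU := [k - Suc i])"
  have c: "run (diff SU SK SC) (\<tau>(SF := fs, SC := Suc i # cs), 0) (Suc i * 4 + 7) (?S, 0)"
    by (rule runs_cong, rule run_diff) (use assms in auto)
  let ?S' = "?S(SZ := (if k \<le> Suc i then 0 else 1) # zs)"
  have d: "run (Cond (NZ SU) Skip (dec SZ)) (?S, 0) 2 (?S', 0)"
  proof (cases "k \<le> Suc i")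
    case True
    show ?thesis by (rule runs_cong, rule runs_CondF, use True in simp, rule run_Dec) (use assms True in auto)
  next
    case False
    show ?thesis by (rule runs_cong, rule runs_CondT, use False in simp, rule runs_Skip) (use assms False in \<open>auto simp: fun_eq_iff\<close>)
  qed
  have e: "run (drp SU) (?S', 0) 1 (\<tau>(SF := fs, SC := Suc i # cs, SZ := (if k \<le> Suc i then 0 else 1) # zs), 0)"
    by (rule runs_cong, rule run_Drop) (use assms in \<open>auto simp: fun_eq_iff\<close>)
  show ?thesis unfolding push_branch_def
    by (rule runs_mono[OF runs_Seq[OF a runs_Seq[OF b runs_Seq[OF c runs_Seq[OF d e]]]]]) simp
qed

lemma run_pop_branch:
  assumes "\<tau> SF = 0 # fs" "\<tau> SC = Suc i # cs" "\<tau> SK = [k]" "\<tau> SL = l # ls" "\<tau> SA = [a]" "length (\<tau> ST) + d \<le> K"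
    "length (\<tau> SR) < K" "k \<le> W" "W + 10 \<le> b"
  shows "run (pop_branch d) (\<tau>, 0) (b ^ Suc d + 20) (\<tau>(SF := fs, SC := i # cs, SR := l # \<tau> SR, SL := ls, SA := [a - k ^ d]), 0)"
proof -
  have a: "run (drp SF) (\<tau>, 0) 1 (\<tau>(SF := fs), 0)"
    by (rule runs_cong, rule run_Drop) (use assms in auto)
  have b: "run (dec SC) (\<tau>(SF := fs), 0) 1 (\<tau>(SF := fs, SC := i # cs), 0)"
    by (rule runs_cong, rule run_Dec) (use assms in auto)
  have c: "run (copy SL SR) (\<tau>(SF := fs, SC := i # cs), 0) 1 (\<tau>(SF := fs, SC := i # cs, SR := l # \<tau> SR), 0)"
    by (rule runs_cong, rule run_Copy) (use assms in auto)
  have d: "run (drp SL) (\<tau>(SF := fs, SC := i # cs, SR := l # \<tau> SR), 0) 1 (\<tau>(SF := fs, SC := i # cs, SR := l # \<tau> SR, SL := ls), 0)"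
    by (rule runs_cong, rule run_Drop) (use assms in auto)
  let ?S = "\<tau>(SF := fs, SC := i # cs, SR := l # \<tau> SR, SL := ls)"
  have e: "run (nest (dec SA) d) (?S, 0) (b ^ Suc d)
      (\<tau>(SF := fs, SC := i # cs, SR := l # \<tau> SR, SL := ls, SA := [a - k ^ d]), 0)"
  proof (rule runs_cong, rule run_nest[where f = "\<lambda>i. ?S(SA := [a - i])" and k = k and W = W and i = 0])
    show "run (dec SA) (\<rho>, 0) 1 ((?S(SA := [a - Suc i]))(ST := \<rho> ST), 0)"
      if "\<And>s. s \<noteq> ST \<Longrightarrow> \<rho> s = (?S(SA := [a - i])) s" for i \<rho>
      by (rule runs_cong, rule run_Dec) (use that in \<open>auto simp: fun_eq_iff\<close>)
  qed (use assms in \<open>auto simp: fun_eq_iff\<close>)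
  have n: "holds2 xs (NZ SC) (\<tau>(SF := fs), 0)" using assms by simp
  show ?thesis unfolding pop_branch_def
    by (rule runs_mono[OF runs_Seq[OF a runs_CondT[OF n runs_Seq[OF b runs_Seq[OF c runs_Seq[OF d e]]]]]]) simp
qed

lemma run_fail_branch:
  assumes "\<tau> SF = 0 # fs" "\<tau> SC = 0 # cs" "\<tau> SZ = 1 # zs"
  shows "run (pop_branch d) (\<tau>, 0) 10 (\<tau>(SF := fs, SZ := 0 # zs), 0)"
proof -
  have a: "run (drp SF) (\<tau>, 0) 1 (\<tau>(SF := fs), 0)"
    by (rule runs_cong, rule run_Drop) (use assms in auto)
  have b: "run (dec SZ) (\<tau>(SF := fs), 0) 1 (\<tau>(SF := fs, SZ := 0 # zs), 0)"
    by (rule runs_cong, rule run_Dec) (use assms in auto)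
  have n: "\<not> holds2 xs (NZ SC) (\<tau>(SF := fs), 0)" using assms by simp
  show ?thesis unfolding pop_branch_def
    by (rule runs_mono[OF runs_Seq[OF a runs_CondF[OF n b]]]) simp
qed

text \<open>On success the answer moves onto the path, the mark is consumed and the column advances;
  on failure all is as before except for the flag. This is what backtracking in the calling level
  requires. Each level adds at most \<open>k\<close> marks and a few counters to any stack, for
  which \<open>k + 8\<close> entries are reserved.\<close>

definition search_spec :: "nat \<Rightarrow> nat \<Rightarrow> nat \<Rightarrow> nat \<Rightarrow> bool" where
  "search_spec k W T d \<longleftrightarrow> (\<forall>\<sigma> a j M ls rs. env k \<sigma> \<longrightarrow> \<sigma> SA = [a] \<longrightarrow> \<sigma> SL = j # ls \<longrightarrow> \<sigma> SR = M # rs \<longrightarrow>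
     j \<le> n \<longrightarrow> M \<le> n + 1 \<longrightarrow> (\<forall>s. length (\<sigma> s) + (d + 1) * (k + 8) \<le> K) \<longrightarrow> a + k ^ d \<le> W \<longrightarrow>
     (\<forall>q. best (seg step a (k ^ d) j) M q \<longrightarrow>
        run (prog d) (\<sigma>, 0) T (\<sigma>(SL := q # j # ls, SR := rs, SA := [a + k ^ d], SF := 1 # \<sigma> SF), 0)) \<and>
     ((\<forall>z<M. \<not> seg step a (k ^ d) j z) \<longrightarrow> run (prog d) (\<sigma>, 0) T (\<sigma>(SF := 0 # \<sigma> SF), 0)))"

lemma best_ex:
  assumes "P z" "z < M"
  shows "\<exists>q. best P M q"
proof -
  let ?A = "{y. y < M \<and> P y}"
  have f: "finite ?A" by simp
  have "Max ?A \<in> ?A" using assms by (intro Max_in[OF f]) auto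
  moreover have "y \<le> Max ?A" if "y \<in> ?A" for y using that by (rule Max_ge[OF f])
  ultimately show ?thesis unfolding best_def by blast
qed

lemma search_spec_0:
  assumes "n + 1 \<le> W" "W + 200 \<le> b"
  shows "search_spec k W (b ^ 3) 0"
proof -
  note le = cube_bound[OF assms(2)]
  have seg1: "seg step a (Suc 0) j = step a j" for a j by (auto simp: fun_eq_iff)
  show ?thesis unfolding search_spec_def
  proof (intro allI impI)
    fix \<sigma> a j M ls rs
    assume a: "env k \<sigma>" "\<sigma> SA = [a]" "\<sigma> SL = j # ls" "\<sigma> SR = M # rs" "j \<le> n" "M \<le> n + 1"
      "\<forall>s. length (\<sigma> s) + (0 + 1) * (k + 8) \<le> K" "a + k ^ 0 \<le> W"
    have r: "\<forall>s. length (\<sigma> s) + 5 \<le> K"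
    proof
      fix s show "length (\<sigma> s) + 5 \<le> K" using a(7)[rule_format, of s] by simp
    qed
    have aW: "a \<le> W" using a(8) by simp
    note P = run_prog0[OF a(1-6) r assms(1) aW, THEN runs_mono, OF _ le]
    show "(\<forall>q. best (seg step a (k ^ 0) j) M q \<longrightarrow>
        run (prog 0) (\<sigma>, 0) (b ^ 3) (\<sigma>(SL := q # j # ls, SR := rs, SA := [a + k ^ 0], SF := 1 # \<sigma> SF), 0)) \<and>
     ((\<forall>z<M. \<not> seg step a (k ^ 0) j z) \<longrightarrow> run (prog 0) (\<sigma>, 0) (b ^ 3) (\<sigma>(SF := 0 # \<sigma> SF), 0))"
      using P by (simp add: seg1 del: fun_upd_apply seg.simps)
  qed
qed

end

subsection \<open>Searching a slab\<close>

context instance_input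
begin

text \<open>The loop is the abstract search with slabs of width \<open>k ^ d\<close> as its steps:
  an answer of the sub-search is a push, a refusal is a pop. The cost per level is a factor
  \<open>b ^ 4\<close>.\<close>

lemma search_spec_Suc:
  assumes k: "0 < k" "k \<le> W" and W: "n + 1 \<le> W" "W + 200 \<le> b"
    and IH: "search_spec k W (b ^ (4 * d + 3)) d"
  shows "search_spec k W (b ^ (4 * Suc d + 3)) (Suc d)"
  unfolding search_spec_def
proof (intro allI impI)
  fix \<sigma> a j M ls rs
  assume env: "env k \<sigma>" and \<sigma>: "\<sigma> SA = [a]" "\<sigma> SL = j # ls" "\<sigma> SR = M # rs" and jM: "j \<le> n" "M \<le> n + 1"
    and room: "\<forall>s. length (\<sigma> s) + (Suc d + 1) * (k + 8) \<le> K" and aW: "a + k ^ Suc d \<le> W"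
  define r where "r = (\<lambda>i. seg step (a + i * k ^ d) (k ^ d))"
  have nc: "noncross (r l)" for l unfolding r_def by (rule noncross_seg[OF noncross_col_step])
  have range: "x \<le> n \<and> y \<le> n" if "r l x y" for l x y
    using seg_range[of step n "k ^ d" "a + l * k ^ d" x y] that col_step_range k(1) by (auto simp: r_def)
  have rk: "seg r 0 k = seg step a (k ^ Suc d)"
    using seg_mult[of step a "k ^ d" 0 k] by (auto simp: r_def fun_eq_iff)
  let ?X = "b ^ (4 * d + 3)"
  define S where "S = (\<lambda>i (m :: nat \<Rightarrow> nat) z. \<sigma>(SL := map m (rev [0..<Suc i]) @ ls, SR := map m [Suc i..<Suc k] @ rs,
     SC := i # \<sigma> SC, SA := [a + i * k ^ d], SZ := z # \<sigma> SZ))"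
  \<comment> \<open>The three cases are a search in progress, a success with the whole path present,
    and a refuted start row.\<close>
  define J where "J = (\<lambda>x. (\<exists>m i. dfs r n k M j m i \<and> (\<forall>l. m l \<le> n + 1) \<and> x = (S i m 1, 0 :: nat)) \<or>
     (\<exists>m. best (seg r 0 k j) M (m k) \<and> m 0 = j \<and> x = (S k m 0, 0)) \<or>
     (\<exists>m. (\<forall>z<M. \<not> seg r 0 k j z) \<and> m 0 = j \<and> m k = M \<and> x = (S 0 m 0, 0)))"
  define tot where "tot = (\<lambda>m :: nat \<Rightarrow> nat. \<Sum>l<Suc k. m l)"
  \<comment> \<open>A push lowers some mark by at least one while the path grows by one; a pop
    shortens the path and keeps the marks. Hence twice the sum of the marks plus the path length
    decreases. Subtracting the sums of \<open>ls\<close> and \<open>rs\<close> leaves the marks of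
    this level only.\<close>
  define \<mu> where "\<mu> = (\<lambda>x :: stk state2. if hd (fst x SZ) = 0 then 0 else
     1 + 2 * (sum_list (fst x SL) + sum_list (fst x SR) - (sum_list ls + sum_list rs)) + hd (fst x SC))"
  let ?body = "prog d ;; Cond (NZ SF) push_branch (pop_branch d)"
  let ?T = "?X + b ^ Suc d + 4 * k + 40"
  have e: "\<sigma> SN = [n + 1]" "\<sigma> SK = [k]" "\<sigma> SJ = [k - 1]" "\<sigma> SU = []" "\<sigma> SQ = []" using env by (auto simp: env_def)
  have room1: "length (\<sigma> s) + (d + 1) * (k + 8) + k + 8 \<le> K" for s
    using room[rule_format, of s] by (simp add: algebra_simps)
  have kd: "d \<le> (d + 1) * (k + 8)" using mult_le_mono[of d "d + 1" 1 "k + 8"] by simp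
  have mu: "\<mu> (S i m 1, 0) = 1 + 2 * tot m + i" if "i < k" for i m
  proof -
    have "sum_list (map m (rev [0..<Suc i])) + sum_list (map m [Suc i..<Suc k]) = sum_list (map m ([0..<Suc i] @ [Suc i..<Suc k]))"
      by (simp only: rev_map[symmetric] sum_list_rev map_append sum_list_append)
    also have "[0..<Suc i] @ [Suc i..<Suc k] = [0..<Suc k]"
      using upt_add_eq_append[of 0 "Suc i" "k - i"] that by simp
    also have "sum_list (map m [0..<Suc k]) = tot m"
      unfolding tot_def by (subst interv_sum_list_conv_sum_set_nat) (simp add: atLeast0LessThan)
    finally show ?thesis by (simp add: \<mu>_def S_def)
  qed
  have step_J: "\<exists>y. run ?body x ?T y \<and> J y \<and> \<mu> y < \<mu> x" if J: "J x" and t: "holds2 xs (NZ SZ) x" for x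
  proof -
    obtain m i where d: "dfs r n k M j m i" and m: "\<And>l. m l \<le> n + 1" and x: "x = (S i m 1, 0)"
      using J t unfolding J_def by (auto simp: S_def)
    have ik: "i < k" and m0: "m 0 = j" and mk: "m k = M" using d by (auto simp: dfs_def)
    \<comment> \<open>The mark \<open>n + 1\<close> of an unvisited line never lies on the path, as
      the sub-search requires of its start row.\<close>
    have mi: "m i \<le> n"
    proof (cases i)
      case (Suc l)
      then have "r l (m l) (m i)" using d by (simp add: dfs_def)
      then show ?thesis using range by blast
    qed (use m0 jM in simp)
    have up: "[Suc i..<Suc k] = Suc i # [Suc (Suc i)..<Suc k]" using ik by (simp add: upt_conv_Cons)
    let ?L = "map m (rev [0..<i]) @ ls" and ?R = "map m [Suc (Suc i)..<Suc k] @ rs"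
    have SL: "S i m 1 SL = m i # ?L" by (simp add: S_def)
    have SR: "S i m 1 SR = m (Suc i) # ?R" unfolding S_def up by simp
    have Senv: "env k (S i m 1)" using env by (simp add: env_def S_def)
    have Sroom: "\<forall>s. length (S i m 1 s) + (d + 1) * (k + 8) \<le> K"
    proof
      fix s
      have "length (S i m 1 s) \<le> length (\<sigma> s) + k + 1"
        using ik \<sigma> by (auto simp: S_def)
      then show "length (S i m 1 s) + (d + 1) * (k + 8) \<le> K" using room1[of s] by linarith
    qed
    have Sa: "a + i * k ^ d + k ^ d \<le> W"
    proof -
      have "Suc i * k ^ d \<le> k * k ^ d" using ik by (intro mult_le_mono1) simp
      then show ?thesis using aW by simp
    qed
    have SA: "S i m 1 SA = [a + i * k ^ d]" by (simp add: S_def)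
    note P = IH[unfolded search_spec_def, rule_format, OF Senv SA SL SR mi m[of "Suc i"] Sroom[rule_format] Sa]
    show ?thesis
    proof (cases "\<exists>q<m (Suc i). r i (m i) q")
      case True
      then obtain p where p: "best (r i (m i)) (m (Suc i)) p" using best_ex by blast
      let ?\<tau> = "(S i m 1)(SL := p # m i # ?L, SR := ?R, SA := [a + i * k ^ d + k ^ d], SF := 1 # S i m 1 SF)"
      have R1: "run (prog d) (S i m 1, 0) ?X (?\<tau>, 0)"
        using P p by (simp add: r_def del: fun_upd_apply)
      have R2: "run push_branch (?\<tau>, 0) (4 * i + 30) (?\<tau>(SF := \<sigma> SF, SC := Suc i # \<sigma> SC,
          SZ := (if k \<le> Suc i then 0 else 1) # \<sigma> SZ), 0)"
        by (rule run_push_branch) (use e room1[of ST] in \<open>auto simp: S_def\<close>)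
      have nz: "holds2 xs (NZ SF) (?\<tau>, 0)" by simp
      let ?m = "m(Suc i := p)"
      let ?z = "if k \<le> Suc i then 0 else 1 :: nat"
      have eq: "?\<tau>(SF := \<sigma> SF, SC := Suc i # \<sigma> SC, SZ := (if k \<le> Suc i then 0 else 1) # \<sigma> SZ) = S (Suc i) ?m ?z"
        by (auto simp: S_def fun_eq_iff)
      have R: "run ?body x ?T (S (Suc i) ?m ?z, 0)"
        unfolding x eq[symmetric]
        by (rule runs_mono[OF runs_Seq[OF R1 runs_CondT[OF nz R2]]]) (use ik in simp)
      show ?thesis
      proof (cases "Suc i < k")
        case True
        then have "J (S (Suc i) ?m ?z, 0)" unfolding J_def
          using dfs_push[OF nc range d p True] m p
          by (intro disjI1 exI[of _ ?m] exI[of _ "Suc i"])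
            (auto simp: best_def intro: le_trans[OF less_imp_le])
        moreover have "tot ?m < tot m"
          unfolding tot_def using p ik
          by (intro sum_strict_mono_ex1) (auto simp: best_def intro!: bexI[of _ "Suc i"])
        then have "\<mu> (S (Suc i) ?m ?z, 0) < \<mu> x"
          unfolding x using mu[OF True, of ?m] mu[OF ik, of m] True by simp
        ultimately show ?thesis using R by blast
      next
        case False
        then have ki: "k = Suc i" using ik by simp
        have "J (S (Suc i) ?m ?z, 0)" unfolding J_def
          using dfs_success[OF nc range d p ki[symmetric]] ki m0
          by (intro disjI2 disjI1 exI[of _ ?m]) auto
        moreover have "\<mu> (S (Suc i) ?m ?z, 0) < \<mu> x"
          unfolding x mu[OF ik] using ki by (simp add: \<mu>_def S_def)
        ultimately show ?thesis using R by blast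
      qed
    next
      case False
      let ?\<tau> = "(S i m 1)(SF := 0 # S i m 1 SF)"
      have no: "\<And>q. q < m (Suc i) \<Longrightarrow> \<not> r i (m i) q" using False by blast
      have R1: "run (prog d) (S i m 1, 0) ?X (?\<tau>, 0)"
        using P no by (simp add: r_def del: fun_upd_apply)
      have nz: "\<not> holds2 xs (NZ SF) (?\<tau>, 0)" by simp
      show ?thesis
      proof (cases i)
        case 0
        have R2: "run (pop_branch d) (?\<tau>, 0) 10 (?\<tau>(SF := \<sigma> SF, SZ := 0 # \<sigma> SZ), 0)"
          by (rule run_fail_branch) (use 0 in \<open>auto simp: S_def\<close>)
        have eq: "?\<tau>(SF := \<sigma> SF, SZ := 0 # \<sigma> SZ) = S 0 m 0"
          using 0 by (auto simp: S_def fun_eq_iff)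
        have R: "run ?body x ?T (S 0 m 0, 0)"
          unfolding x eq[symmetric]
          by (rule runs_mono[OF runs_Seq[OF R1 runs_CondF[OF nz R2]]]) simp
        have "J (S 0 m 0, 0)" unfolding J_def
          using dfs_pop(1)[OF nc range d no] 0 m0 mk
          by (intro disjI2 exI[of _ m]) (auto simp: dead_def)
        moreover have "\<mu> (S 0 m 0, 0) < \<mu> x" unfolding x mu[OF ik] by (simp add: \<mu>_def S_def)
        ultimately show ?thesis using R by blast
      next
        case (Suc l)
        let ?\<tau>' = "?\<tau>(SF := \<sigma> SF, SC := l # \<sigma> SC, SR := m i # ?\<tau> SR, SL := ?L, SA := [a + i * k ^ d - k ^ d])"
        have lenR: "length (?\<tau> SR) < K" using room1[of SR] \<sigma>(3) ik
          by (simp add: S_def del: upt_Suc)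
        have R2: "run (pop_branch d) (?\<tau>, 0) (b ^ Suc d + 20) (?\<tau>', 0)"
          by (rule run_pop_branch[where W = W])
            (use SL Suc e k W room1[of ST] kd lenR in \<open>auto simp: S_def simp del: upt_Suc\<close>)
        have up': "[Suc l..<Suc k] = i # [Suc i..<Suc k]" using ik Suc by (simp add: upt_conv_Cons)
        have eq: "?\<tau>' = S l m 1"
          unfolding S_def up' using Suc by (auto simp: fun_eq_iff)
        have R: "run ?body x ?T (S l m 1, 0)"
          unfolding x eq[symmetric]
          by (rule runs_mono[OF runs_Seq[OF R1 runs_CondF[OF nz R2]]]) simp
        have "J (S l m 1, 0)" unfolding J_def
          using dfs_pop(2)[OF nc range d no] Suc m by (intro disjI1 exI[of _ m] exI[of _ l]) auto
        moreover have "\<mu> (S l m 1, 0) < \<mu> x" unfolding x mu[OF ik] using mu[of l m] ik Suc by simp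
        ultimately show ?thesis using R by blast
      qed
    qed
  qed
  define m0 where "m0 = (\<lambda>l. if l = 0 then j else if l = k then M else Suc n)"
  have J0: "J (S 0 m0 1, 0)" unfolding J_def
    using dfs_init[OF nc range k(1) jM(1), where M = M] jM
    by (intro disjI1 exI[of _ m0] exI[of _ 0]) (auto simp: m0_def)
  obtain y where y: "run (Loop (NZ SZ) ?body) (S 0 m0 1, 0) (\<mu> (S 0 m0 1, 0) * (?T + 1) + 1) y" "J y" "\<not> holds2 xs (NZ SZ) y"
    using runs_While[of J "holds2 xs" "NZ SZ" "stp2 K" ?body ?T \<mu>, OF step_J J0] by blast
  \<comment> \<open>There are \<open>k + 1\<close> marks of at most \<open>n + 1\<close> each, which
    bounds the number of rounds.\<close>
  have mu0: "\<mu> (S 0 m0 1, 0) \<le> 2 * b ^ 2"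
  proof -
    have "tot m0 \<le> (\<Sum>l<Suc k. n + 1)" unfolding tot_def using jM by (intro sum_mono) (auto simp: m0_def)
    also have "\<dots> = Suc k * (n + 1)" by simp
    also have "\<dots> \<le> (W + 1) * W" using k W by (intro mult_le_mono) auto
    finally have "\<mu> (S 0 m0 1, 0) \<le> 1 + 2 * ((W + 1) * W)" using mu[OF k(1), of m0] by simp
    also have "\<dots> \<le> 2 * ((W + 200) * (W + 200))" by (simp add: algebra_simps)
    also have "\<dots> \<le> 2 * (b * b)" using W(2) by (intro mult_le_mono) auto
    finally show ?thesis by (simp add: power2_eq_square)
  qed
  let ?init = "\<sigma>(SR := replicate (k - 1) (n + 1) @ M # rs)"
  have i1: "run (For SJ (copy SN SR)) (\<sigma>, 0) ((k - 1) * 4 + 5) (?init, 0)"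
    by (rule runs_cong, rule run_fill[where v = "k - 1" and w = "n + 1"]) (use e \<sigma> room1[of ST] room1[of SR] in auto)
  have i2: "run (zero SC) (?init, 0) 1 (?init(SC := 0 # \<sigma> SC), 0)"
    by (rule runs_cong, rule run_Zero) (use room1[of SC] in auto)
  have i3: "run (one SZ) (?init(SC := 0 # \<sigma> SC), 0) 3 (S 0 m0 1, 0)"
  proof (rule runs_cong, rule run_one)
    have "map m0 [Suc 0..<Suc k] = replicate (k - 1) (n + 1) @ [M]"
    proof -
      have "[Suc 0..<Suc k] = [Suc 0..<k] @ [k]" using k(1) by simp
      moreover have "map m0 [Suc 0..<k] = map (\<lambda>_. n + 1) [Suc 0..<k]" by (auto simp: m0_def)
      ultimately show ?thesis using k(1) by (simp add: m0_def map_replicate_const)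
    qed
    moreover have "map m0 (rev [0..<Suc 0]) = [j]" by (simp add: m0_def)
    ultimately show "((?init(SC := 0 # \<sigma> SC))(SZ := 1 # (?init(SC := 0 # \<sigma> SC)) SZ), 0) = (S 0 m0 1, 0)"
      using \<sigma> by (auto simp: S_def fun_eq_iff simp del: upt_Suc)
  qed (use room1[of SZ] in auto)
  let ?fin = "Cond (NZ SC)
       (copy SL SQ ;; drp SL ;; For SJ (drp SL) ;; copy SQ SL ;; drp SQ ;; drp SC ;; one SF)
       (For SJ (drp SR) ;; drp SC ;; zero SF)"
  \<comment> \<open>At most \<open>2 * b ^ 2\<close> rounds of at most
    \<open>3 * b ^ (4 * d + 3)\<close> steps, with bookkeeping seven times the product of the two
    powers; the remaining factor \<open>b ^ 2\<close> of the bound absorbs the seven.\<close>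
  have total: "run (prog (Suc d)) (\<sigma>, 0) (b ^ (4 * Suc d + 3)) (\<tau>, 0)"
    if f: "run (drp SZ ;; ?fin) y (4 * k + 50) (\<tau>, 0)" for \<tau>
  proof -
    note R = runs_Seq[OF i1 runs_Seq[OF i2 runs_Seq[OF i3 runs_Seq[OF y(1) f]]]]
    have bX: "b * b * b \<le> ?X" using W by (simp add: power_add numeral_3_eq_3)
    have "200 * b \<le> b * b" using W by (intro mult_le_mono1) simp
    moreover have "b * b \<le> b * b * b" using W by simp
    ultimately have b200: "200 * b \<le> ?X" using bX by linarith
    have "b ^ Suc d \<le> ?X" using W by (intro power_increasing) auto
    then have T: "?T + 1 \<le> 3 * ?X" using b200 k W by linarith
    have "\<mu> (S 0 m0 1, 0) * (?T + 1) \<le> 2 * b ^ 2 * (3 * ?X)" by (rule mult_le_mono[OF mu0 T])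
    then have "\<mu> (S 0 m0 1, 0) * (?T + 1) \<le> 6 * (b ^ 2 * ?X)" by simp
    moreover have "?X \<le> b ^ 2 * ?X" using W by simp
    moreover have "(k - 1) * 4 + 4 * k + 100 \<le> ?X" using b200 k W by linarith
    ultimately have "(k - 1) * 4 + 5 + (1 + (3 + (\<mu> (S 0 m0 1, 0) * (?T + 1) + 1 + (4 * k + 50) + 1) + 1) + 1) + 1 \<le> 7 * (b ^ 2 * ?X)"
      by linarith
    also have "7 * (b ^ 2 * ?X) \<le> b ^ 2 * (b ^ 2 * ?X)"
    proof (rule mult_le_mono1)
      have "7 \<le> b * 1" using W by simp
      also have "\<dots> \<le> b * b" using W by (intro mult_le_mono) auto
      finally show "7 \<le> b ^ 2" by (simp add: power2_eq_square)
    qed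
    also have "\<dots> = b ^ (4 * Suc d + 3)" by (simp flip: power_add)
    finally show ?thesis unfolding prog.simps by (intro runs_mono[OF R]) simp
  qed
  from y(2,3) consider
      (succ) m where "best (seg r 0 k j) M (m k)" "m 0 = j" "y = (S k m 0, 0)"
    | (fail) m where "\<forall>z<M. \<not> seg r 0 k j z" "m 0 = j" "m k = M" "y = (S 0 m 0, 0)"
    unfolding J_def by (auto simp: S_def)
  then show "(\<forall>q. best (seg step a (k ^ Suc d) j) M q \<longrightarrow>
        run (prog (Suc d)) (\<sigma>, 0) (b ^ (4 * Suc d + 3)) (\<sigma>(SL := q # j # ls, SR := rs, SA := [a + k ^ Suc d], SF := 1 # \<sigma> SF), 0)) \<and>
     ((\<forall>z<M. \<not> seg step a (k ^ Suc d) j z) \<longrightarrow>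
        run (prog (Suc d)) (\<sigma>, 0) (b ^ (4 * Suc d + 3)) (\<sigma>(SF := 0 # \<sigma> SF), 0))"
  proof cases
    case succ
    let ?p = "m k"
    let ?U = "(S k m 0)(SZ := \<sigma> SZ)"
    have SLk: "S k m 0 SL = ?p # map m (rev [0..<k]) @ ls" by (simp add: S_def)
    \<comment> \<open>The answer on top is set aside; below it lie the \<open>k - 1\<close> inner
      rows of the path, and removing these exposes the start row \<open>j\<close>.\<close>
    have dr: "drop (k - 1) (map m (rev [0..<k]) @ ls) = j # ls"
    proof -
      have "rev [0..<k] = rev [Suc 0..<k] @ [0]" using k(1) by (simp add: upt_conv_Cons)
      then show ?thesis using succ(2) by (simp add: drop_append)
    qed
    have f1: "run (drp SZ) (S k m 0, 0) 1 (?U, 0)"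
      by (rule runs_cong, rule run_Drop) (auto simp: S_def)
    have nz: "holds2 xs (NZ SC) (?U, 0)" using k(1) by (simp add: S_def)
    have f2: "run (copy SL SQ) (?U, 0) 1 (?U(SQ := [?p]), 0)"
      by (rule runs_cong, rule run_Copy) (use SLk e room1[of SQ] in \<open>auto simp: S_def\<close>)
    have f3: "run (drp SL) (?U(SQ := [?p]), 0) 1 (?U(SQ := [?p], SL := map m (rev [0..<k]) @ ls), 0)"
      by (rule runs_cong, rule run_Drop) (use SLk in auto)
    have f4: "run (For SJ (drp SL)) (?U(SQ := [?p], SL := map m (rev [0..<k]) @ ls), 0) ((k - 1) * 4 + 5) (?U(SQ := [?p], SL := j # ls), 0)"
      by (rule runs_cong, rule run_drops[where v = "k - 1"]) (use dr e room1[of ST] in \<open>auto simp: S_def\<close>)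
    have f5: "run (copy SQ SL) (?U(SQ := [?p], SL := j # ls), 0) 1 (?U(SQ := [?p], SL := ?p # j # ls), 0)"
      by (rule runs_cong, rule run_Copy) (use \<sigma> room1[of SL] in auto)
    have f6: "run (drp SQ) (?U(SQ := [?p], SL := ?p # j # ls), 0) 1 (?U(SQ := [], SL := ?p # j # ls), 0)"
      by (rule runs_cong, rule run_Drop) (auto simp: fun_eq_iff)
    have f7: "run (drp SC) (?U(SQ := [], SL := ?p # j # ls), 0) 1 (?U(SQ := [], SL := ?p # j # ls, SC := \<sigma> SC), 0)"
      by (rule runs_cong, rule run_Drop) (auto simp: S_def)
    have f8: "run (one SF) (?U(SQ := [], SL := ?p # j # ls, SC := \<sigma> SC), 0) 3
        (\<sigma>(SL := ?p # j # ls, SR := rs, SA := [a + k ^ Suc d], SF := 1 # \<sigma> SF), 0)"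
      by (rule runs_cong, rule run_one) (use e room1[of SF] in \<open>auto simp: S_def fun_eq_iff\<close>)
    have "run (drp SZ ;; ?fin) y (4 * k + 50) (\<sigma>(SL := ?p # j # ls, SR := rs, SA := [a + k ^ Suc d], SF := 1 # \<sigma> SF), 0)"
      unfolding succ(3)
      by (rule runs_mono[OF runs_Seq[OF f1 runs_CondT[OF nz runs_Seq[OF f2 runs_Seq[OF f3 runs_Seq[OF f4
          runs_Seq[OF f5 runs_Seq[OF f6 runs_Seq[OF f7 f8]]]]]]]]]) simp
    note F = total[OF this]
    have "q = ?p" if "best (seg r 0 k j) M q" for q
      using that succ(1) unfolding best_def by (metis le_antisym)
    moreover have "\<not> (\<forall>z<M. \<not> seg r 0 k j z)" using succ(1) unfolding best_def by blast
    ultimately show ?thesis using F unfolding rk by blast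
  next
    case fail
    let ?U = "(S 0 m 0)(SZ := \<sigma> SZ)"
    have dr: "drop (k - 1) (map m [Suc 0..<Suc k] @ rs) = M # rs"
    proof -
      have "[Suc 0..<Suc k] = [Suc 0..<k] @ [k]" using k(1) by simp
      then show ?thesis using fail(3) by (simp add: drop_append)
    qed
    have f1: "run (drp SZ) (S 0 m 0, 0) 1 (?U, 0)"
      by (rule runs_cong, rule run_Drop) (auto simp: S_def)
    have nz: "\<not> holds2 xs (NZ SC) (?U, 0)" by (simp add: S_def)
    have f2: "run (For SJ (drp SR)) (?U, 0) ((k - 1) * 4 + 5) (?U(SR := M # rs), 0)"
      by (rule runs_cong, rule run_drops[where v = "k - 1"])
        (use dr e room1[of ST] in \<open>auto simp: S_def simp del: upt_Suc\<close>)
    have f3: "run (drp SC) (?U(SR := M # rs), 0) 1 (?U(SR := M # rs, SC := \<sigma> SC), 0)"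
      by (rule runs_cong, rule run_Drop) (auto simp: S_def)
    have f4: "run (zero SF) (?U(SR := M # rs, SC := \<sigma> SC), 0) 1 (\<sigma>(SF := 0 # \<sigma> SF), 0)"
      by (rule runs_cong, rule run_Zero) (use fail \<sigma> room1[of SF] in \<open>auto simp: S_def fun_eq_iff\<close>)
    have "run (drp SZ ;; ?fin) y (4 * k + 50) (\<sigma>(SF := 0 # \<sigma> SF), 0)"
      unfolding fail(4)
      by (rule runs_mono[OF runs_Seq[OF f1 runs_CondF[OF nz runs_Seq[OF f2 runs_Seq[OF f3 f4]]]]]) simp
    note F = total[OF this]
    have "\<not> best (seg r 0 k j) M q" for q using fail(1) unfolding best_def by blast
    then show ?thesis using F fail(1) unfolding rk by blast
  qed
qed

lemma search_spec:
  assumes "0 < k" "k \<le> W" "n + 1 \<le> W" "W + 200 \<le> b"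
  shows "search_spec k W (b ^ (4 * d + 3)) d"
proof (induction d)
  case 0
  then show ?case using search_spec_0[OF assms(3,4)] by simp
next
  case (Suc d)
  then show ?case by (rule search_spec_Suc[OF assms])
qed

end

subsection \<open>The decision procedure\<close>

lemma length_concat_upt:
  assumes "\<And>i. i < m \<Longrightarrow> length (f i) = L"
  shows "length (concat (map f [0..<m])) = m * L"
  using assms by (induction m) auto

lemma nth_concat_upt:
  assumes "\<And>i. i < m \<Longrightarrow> length (f i) = L" "i < m" "r < L"
  shows "concat (map f [0..<m]) ! (i * L + r) = f i ! r"
  using assms
proof (induction m)
  case (Suc m)
  have len: "length (concat (map f [0..<m])) = m * L" using Suc.prems(1) by (intro length_concat_upt) auto
  show ?case
  proof (cases "i = m")
    case True
    then show ?thesis using len by (simp add: nth_append)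
  next
    case False
    then have "i < m" using Suc.prems by simp
    then have "i * L + r < m * L"
      using mult_le_mono1[of "Suc i" m L] Suc.prems(3) by simp
    then show ?thesis using Suc False len by (simp add: nth_append)
  qed
qed simp

definition edge_bits :: "nat \<Rightarrow> graph \<Rightarrow> bool list" where
  "edge_bits n E = concat (map (\<lambda>i. concat (map (\<lambda>j.
     [((i, j), (i + 1, j)) \<in> E, ((i, j), (i, j + 1)) \<in> E]) [0..<n + 1])) [0..<n + 1])"

lemma encode_instance_eq:
  "encode_instance n E (i, j) (it, jt) =
     unary n @ edge_bits n E @ unary i @ unary j @ unary it @ unary jt"
  by (simp add: encode_instance_def edge_bits_def)

lemma length_unary [simp]: "length (unary m) = m + 1"
  by (simp add: unary_def)

lemma length_edge_bits: "length (edge_bits n E) = (n + 1) * ((n + 1) * 2)"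
  unfolding edge_bits_def by (intro length_concat_upt) simp_all

lemma nth_edge_bits:
  assumes "x \<le> n" "y \<le> n" "e < 2"
  shows "edge_bits n E ! (x * ((n + 1) * 2) + (y * 2 + e)) =
    [((x, y), (x + 1, y)) \<in> E, ((x, y), (x, y + 1)) \<in> E] ! e"
proof -
  let ?f = "\<lambda>i j. [((i, j), (i + 1, j)) \<in> E, ((i, j), (i, j + 1)) \<in> E]"
  have "edge_bits n E ! (x * ((n + 1) * 2) + (y * 2 + e)) = concat (map (?f x) [0..<n + 1]) ! (y * 2 + e)"
    unfolding edge_bits_def
    by (rule nth_concat_upt) (use assms in \<open>auto intro!: length_concat_upt\<close>)
  also have "\<dots> = ?f x y ! e" by (rule nth_concat_upt) (use assms in auto)
  finally show ?thesis .
qed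

lemma input_sym_append: "input_sym (us @ vs) (length us + p) = input_sym vs p"
  by (simp add: input_sym_def nth_append)

lemma input_sym_unary: "p \<le> m \<Longrightarrow> input_sym (unary m @ vs) p = Some (p < m)"
  by (auto simp: input_sym_def unary_def nth_append)

lemma input_sym_at:
  "xs = us @ unary m @ vs \<Longrightarrow> length us = q \<Longrightarrow> p \<le> m \<Longrightarrow> input_sym xs (q + p) = Some (p < m)"
  by (auto simp: input_sym_append input_sym_unary)

lemma instance_input_encode:
  assumes "E \<subseteq> grid_edges n" "it \<le> n"
  shows "instance_input E n it (encode_instance n E (i, j) (it, jt))"
proof
  let ?xs = "encode_instance n E (i, j) (it, jt)"
  have *: "input_sym ?xs (cell_pos n x y + e) = Some ([((x, y), (x + 1, y)) \<in> E, ((x, y), (x, y + 1)) \<in> E] ! e)"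
    if "x \<le> n" "y \<le> n" "e < 2" for x y e
  proof -
    let ?p = "x * ((n + 1) * 2) + (y * 2 + e)"
    have "y * 2 + e < (n + 1) * 2" using that by simp
    then have "?p < Suc x * ((n + 1) * 2)" by simp
    also have "\<dots> \<le> (n + 1) * ((n + 1) * 2)" using that by (intro mult_le_mono1) simp
    finally have p: "?p < length (edge_bits n E)" by (simp add: length_edge_bits)
    have "input_sym ?xs (cell_pos n x y + e) = input_sym ?xs (length (unary n) + ?p)"
      by (simp add: cell_pos_def add.assoc)
    also have "\<dots> = Some (edge_bits n E ! ?p)"
      unfolding encode_instance_eq input_sym_append using p by (simp add: input_sym_def nth_append)
    finally show ?thesis using nth_edge_bits[OF that] by simp
  qed
  show "input_sym ?xs (cell_pos n x y) = Some (((x, y), (x + 1, y)) \<in> E)" if "x \<le> n" "y \<le> n" for x y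
    using *[OF that, of 0] by simp
  show "input_sym ?xs (Suc (cell_pos n x y)) = Some (((x, y), (x, y + 1)) \<in> E)" if "x \<le> n" "y \<le> n" for x y
    using *[OF that, of 1] by simp
qed (use assms in auto)

definition read :: "stk \<Rightarrow> stk com2" where
  "read s = zero s ;; Loop InT (inc s ;; moveR) ;; moveR"

text \<open>The edge bits are skipped with the counters at hand. \<open>SR\<close> receives
  \<open>jt + 1\<close> because marks are exclusive bounds: the best row below \<open>jt + 1\<close>
  may be \<open>jt\<close> itself, and \<open>SW\<close> keeps \<open>jt\<close> for the final
  comparison.\<close>

definition input_prog :: "stk com2" where
  "input_prog = zero SP ;; read SN ;; inc SN ;; For SN (For SN (moveR ;; moveR)) ;;
     read SA ;; read SL ;; read SI ;; read SR ;; copy SR SW ;; inc SR ;; rewind"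

text \<open>Linear search for the least \<open>k\<close> whose \<open>d\<close>-th power exceeds
  \<open>n\<close>; the power is obtained by counting, which costs polynomial time only.\<close>

definition root_prog :: "nat \<Rightarrow> stk com2" where
  "root_prog d = zero SK ;; one SV ;;
     Loop (NZ SV) (drp SV ;; inc SK ;; zero SU ;; nest (inc SU) d ;; diff SV SN SU ;; drp SU) ;;
     drp SV ;; copy SK SJ ;; dec SJ"

text \<open>The target is reachable iff it is the highest reachable row below \<open>jt + 1\<close>
  of its column, so one search answers the question. The difference in \<open>SC\<close> is nonzero
  iff the start lies to the right of the target, and then the answer is negative.\<close>

definition main_prog :: "nat \<Rightarrow> stk com2" where
  "main_prog d = input_prog ;; root_prog d ;; diff SC SA SI ;; prog d ;; zero SZ ;;
     Cond (NZ SF) (Cond (NZ SC) Skip (diff SU SW SL ;; Cond (NZ SU) Skip (inc SZ))) Skip"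

context
  fixes xs :: "bool list" and K :: nat
begin

lemma run_moveR: "\<sigma> SP = [p] \<Longrightarrow> run2 xs K moveR (\<sigma>, h) 3 (\<sigma>(SP := [Suc p]), Suc h)"
  unfolding moveR_def by (rule runs_cong, (rule basics | (simp; fail))+)

lemma run_read:
  assumes "s \<noteq> SP" "\<sigma> SP = [p]" "length (\<sigma> s) < K"
    and in_m: "\<And>i. i \<le> m \<Longrightarrow> input_sym xs (p + i) = Some (i < m)"
  shows "run2 xs K (read s) (\<sigma>, p) (6 * m + 7) (\<sigma>(s := m # \<sigma> s, SP := [Suc (p + m)]), Suc (p + m))"
proof -
  let ?S = "\<lambda>i. (\<sigma>(s := i # \<sigma> s, SP := [p + i]), p + i)"
  have loop: "run2 xs K (Loop InT (inc s ;; moveR)) (?S (m - i)) (6 * i + 1) (?S m)" if "i \<le> m" for i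
    using that
  proof (induction i)
    case 0
    then show ?case using in_m[of m] runs_LoopF[of "holds2 xs" InT "?S m" "stp2 K"] by (simp del: fun_upd_apply)
  next
    case (Suc i)
    then have e: "Suc (m - Suc i) = m - i" by simp
    have h: "holds2 xs InT (?S (m - Suc i))" using in_m[of "m - Suc i"] Suc.prems by simp
    have 1: "run2 xs K (inc s) (?S (m - Suc i)) 1 (\<sigma>(s := (m - i) # \<sigma> s, SP := [p + (m - Suc i)]), p + (m - Suc i))"
      by (rule runs_cong, rule run_Inc) (use assms(1) e in \<open>auto simp: fun_eq_iff\<close>)
    have 2: "run2 xs K moveR (\<sigma>(s := (m - i) # \<sigma> s, SP := [p + (m - Suc i)]), p + (m - Suc i)) 3 (?S (m - i))"
      by (rule runs_cong, rule run_moveR) (use e in \<open>auto simp: fun_eq_iff\<close>)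
    have 3: "run2 xs K (Loop InT (inc s ;; moveR)) (?S (m - i)) (6 * i + 1) (?S m)"
      by (rule Suc.IH) (use Suc.prems in simp)
    show ?case by (rule runs_mono[OF runs_LoopT[OF h runs_Seq[OF 1 2] 3]]) simp
  qed
  have a: "run2 xs K (zero s) (\<sigma>, p) 1 (?S 0)"
    by (rule runs_cong, rule run_Zero) (use assms in \<open>auto simp: fun_eq_iff\<close>)
  have b: "run2 xs K (Loop InT (inc s ;; moveR)) (?S 0) (6 * m + 1) (?S m)" using loop[of m] by simp
  have c: "run2 xs K moveR (?S m) 3 (\<sigma>(s := m # \<sigma> s, SP := [Suc (p + m)]), Suc (p + m))"
    by (rule runs_cong, rule run_moveR) (auto simp: fun_eq_iff)
  show ?thesis unfolding read_def by (rule runs_mono[OF runs_Seq[OF a runs_Seq[OF b c]]]) simp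
qed

lemma run_root_prog:
  assumes \<sigma>: "\<sigma> SK = []" "\<sigma> SV = []" "\<sigma> SU = []" "\<sigma> SJ = []" "\<sigma> SN = [n + 1]"
    and K: "length (\<sigma> ST) + d + 5 \<le> K" and d: "0 < d" and W: "n + 1 \<le> W" "(n + 1) ^ d \<le> W" "W + 200 \<le> b"
  shows "\<exists>k. 0 < k \<and> n + 1 \<le> k ^ d \<and> (k - 1) ^ d < n + 1 \<and> k \<le> n + 1 \<and>
    run2 xs K (root_prog d) (\<sigma>, 0) (b ^ (d + 3)) (\<sigma>(SK := [k], SJ := [k - 1]), 0)"
proof -
  define I where "I = (\<lambda>x. \<exists>k v. x = (\<sigma>(SK := [k], SV := [v]), 0 :: nat) \<and> (\<forall>l<k. l ^ d < n + 1) \<and>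
    (if v = 0 then n + 1 \<le> k ^ d else k ^ d < n + 1))"
  \<comment> \<open>While the loop runs, \<open>k <= k ^ d < n + 1\<close>, so the second branch
    strictly decreases.\<close>
  define \<mu> where "\<mu> = (\<lambda>x :: stk state2. if hd (fst x SV) = 0 then 0 else n + 2 - hd (fst x SK))"
  let ?body = "drp SV ;; inc SK ;; zero SU ;; nest (inc SU) d ;; diff SV SN SU ;; drp SU"
  let ?T = "b ^ Suc d + 4 * W + 20"
  have le_pow: "l \<le> l ^ d" for l :: nat using d by (cases l) (auto simp: self_le_power)
  have step: "\<exists>y. run2 xs K ?body x ?T y \<and> I y \<and> \<mu> y < \<mu> x" if I: "I x" and t: "holds2 xs (NZ SV) x" for x
  proof -
    obtain k v where x: "x = (\<sigma>(SK := [k], SV := [v]), 0)" and lt: "\<forall>l<k. l ^ d < n + 1"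
      and v: "if v = 0 then n + 1 \<le> k ^ d else k ^ d < n + 1" using I unfolding I_def by blast
    have v0: "v \<noteq> 0" using t x by simp
    then have kn: "k ^ d < n + 1" using v by simp
    then have k: "k < n + 1" using le_pow[of k] by linarith
    have kd: "Suc k ^ d \<le> W"
      using power_mono[of "Suc k" "n + 1" d] k W(2) by simp
    let ?v = "n + 1 - Suc k ^ d"
    have 1: "run2 xs K (drp SV) x 1 (\<sigma>(SK := [k], SV := []), 0)"
      unfolding x by (rule runs_cong, rule run_Drop) auto
    have 2: "run2 xs K (inc SK) (\<sigma>(SK := [k], SV := []), 0) 1 (\<sigma>(SK := [Suc k], SV := []), 0)"
      by (rule runs_cong, rule run_Inc) (auto simp: fun_eq_iff)
    have 3: "run2 xs K (zero SU) (\<sigma>(SK := [Suc k], SV := []), 0) 1 (\<sigma>(SK := [Suc k], SV := [], SU := [0]), 0)"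
      by (rule runs_cong, rule run_Zero) (use \<sigma> K in auto)
    have 4: "run2 xs K (nest (inc SU) d) (\<sigma>(SK := [Suc k], SV := [], SU := [0]), 0) (b ^ Suc d)
       (\<sigma>(SK := [Suc k], SV := [], SU := [Suc k ^ d]), 0)"
    proof (rule runs_cong, rule run_nest[where f = "\<lambda>i. \<sigma>(SK := [Suc k], SV := [], SU := [i])" and k = "Suc k" and W = W and b = b and i = 0])
      show "run2 xs K (inc SU) (\<tau>, 0) 1 ((\<sigma>(SK := [Suc k], SV := [], SU := [Suc i]))(ST := \<tau> ST), 0)"
        if "\<And>s. s \<noteq> ST \<Longrightarrow> \<tau> s = (\<sigma>(SK := [Suc k], SV := [], SU := [i])) s" for i \<tau>
        by (rule runs_cong, rule run_Inc) (use that in \<open>auto simp: fun_eq_iff\<close>)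
    qed (use K k W in auto)
    have 5: "run2 xs K (diff SV SN SU) (\<sigma>(SK := [Suc k], SV := [], SU := [Suc k ^ d]), 0) (Suc k ^ d * 4 + 7)
       (\<sigma>(SK := [Suc k], SV := [?v], SU := [Suc k ^ d]), 0)"
      by (rule runs_cong, rule run_diff) (use K \<sigma> in \<open>auto simp: fun_eq_iff\<close>)
    have 6: "run2 xs K (drp SU) (\<sigma>(SK := [Suc k], SV := [?v], SU := [Suc k ^ d]), 0) 1 (\<sigma>(SK := [Suc k], SV := [?v]), 0)"
      by (rule runs_cong, rule run_Drop) (use \<sigma> in \<open>auto simp: fun_eq_iff\<close>)
    have R: "run2 xs K ?body x ?T (\<sigma>(SK := [Suc k], SV := [?v]), 0)"
      by (rule runs_mono[OF runs_Seq[OF 1 runs_Seq[OF 2 runs_Seq[OF 3 runs_Seq[OF 4 runs_Seq[OF 5 6]]]]]])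
        (use kd in linarith)
    have "\<forall>l<Suc k. l ^ d < n + 1" using lt kn less_Suc_eq by auto
    moreover have "if ?v = 0 then n + 1 \<le> Suc k ^ d else Suc k ^ d < n + 1" by auto
    ultimately have "I (\<sigma>(SK := [Suc k], SV := [?v]), 0)" unfolding I_def by blast
    moreover have "\<mu> (\<sigma>(SK := [Suc k], SV := [?v]), 0) < \<mu> x" unfolding x \<mu>_def using v0 k by auto
    ultimately show ?thesis using R by blast
  qed
  have I0: "I (\<sigma>(SK := [0], SV := [1]), 0)" unfolding I_def using d by (rule_tac exI[of _ 0], rule_tac exI[of _ 1]) (simp add: zero_power)
  have a: "run2 xs K (zero SK) (\<sigma>, 0) 1 (\<sigma>(SK := [0]), 0)"
    by (rule runs_cong, rule run_Zero) (use \<sigma> K in auto)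
  have b: "run2 xs K (one SV) (\<sigma>(SK := [0]), 0) 3 (\<sigma>(SK := [0], SV := [1]), 0)"
    by (rule runs_cong, rule run_one) (use \<sigma> K in auto)
  obtain y where y: "run2 xs K (Loop (NZ SV) ?body) (\<sigma>(SK := [0], SV := [1]), 0) ((n + 2) * (?T + 1) + 1) y" "I y" "\<not> holds2 xs (NZ SV) y"
    using runs_While[of I "holds2 xs" "NZ SV" "stp2 K" ?body ?T \<mu>, OF step I0] by (auto simp: \<mu>_def)
  then obtain k where k: "y = (\<sigma>(SK := [k], SV := [0]), 0)" "\<forall>l<k. l ^ d < n + 1" "n + 1 \<le> k ^ d"
    unfolding I_def by auto
  have k0: "0 < k" using k(3) d by (cases k) (auto simp: power_0_left)
  have k1: "(k - 1) ^ d < n + 1" using k(2) k0 by simp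
  then have kn: "k \<le> n + 1" using le_pow[of "k - 1"] by linarith
  have e: "run2 xs K (drp SV) y 1 (\<sigma>(SK := [k]), 0)"
    unfolding k(1) by (rule runs_cong, rule run_Drop) (use \<sigma> in \<open>auto simp: fun_eq_iff\<close>)
  have f: "run2 xs K (copy SK SJ) (\<sigma>(SK := [k]), 0) 1 (\<sigma>(SK := [k], SJ := [k]), 0)"
    by (rule runs_cong, rule run_Copy) (use \<sigma> K in auto)
  have g: "run2 xs K (dec SJ) (\<sigma>(SK := [k], SJ := [k]), 0) 1 (\<sigma>(SK := [k], SJ := [k - 1]), 0)"
    by (rule runs_cong, rule run_Dec) auto
  have "run2 xs K (root_prog d) (\<sigma>, 0) (b ^ (d + 3)) (\<sigma>(SK := [k], SJ := [k - 1]), 0)"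
    unfolding root_prog_def
  proof (rule runs_mono[OF runs_Seq[OF a runs_Seq[OF b runs_Seq[OF y(1) runs_Seq[OF e runs_Seq[OF f g]]]]]])
    let ?X = "b ^ Suc d"
    have "1 \<le> b ^ d" using W by simp
    then have bX: "b \<le> ?X" by simp
    have "?T + 1 \<le> 5 * ?X" using bX W by linarith
    then have "(n + 2) * (?T + 1) \<le> b * (5 * ?X)" using W by (intro mult_le_mono) auto
    moreover have "?X \<le> b * ?X" using W by simp
    ultimately have "1 + (3 + ((n + 2) * (?T + 1) + 1 + (1 + (1 + 1 + 1) + 1) + 1) + 1) + 1 \<le> 6 * (b * ?X)"
      using bX W by linarith
    also have "\<dots> \<le> b * (b * ?X)" using W by (intro mult_le_mono1) simp
    also have "\<dots> = b ^ (d + 3)" by (simp add: power_add numeral_3_eq_3)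
    finally show "1 + (3 + ((n + 2) * (?T + 1) + 1 + (1 + (1 + 1 + 1) + 1) + 1) + 1) + 1 \<le> b ^ (d + 3)" .
  qed
  then show ?thesis using k0 k(3) k1 kn by blast
qed

lemma run_input_prog:
  assumes xs: "xs = encode_instance n E (i, j) (it, jt)" and le: "i \<le> n" "j \<le> n" "it \<le> n" "jt \<le> n"
    and K: "5 \<le> K" and b: "n + 201 \<le> b"
  shows "run2 xs K input_prog (\<lambda>_. [], 0) (b ^ 3)
     ((\<lambda>_. [])(SP := [0], SN := [n + 1], SA := [i], SL := [j], SI := [it], SR := [jt + 1], SW := [jt]), 0)"
proof -
  let ?Z = "(\<lambda>_. []) :: stk \<Rightarrow> nat list"
  define q where "q = (n + 1) + (n + 1) * ((n + 1) * 2)"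
  have in0: "input_sym xs (0 + p) = Some (p < n)" if "p \<le> n" for p
    using input_sym_unary[OF that] by (simp add: xs encode_instance_eq)
  have len: "length (unary n @ edge_bits n E) = q" by (simp add: length_edge_bits q_def)
  have in1: "input_sym xs (q + p) = Some (p < i)" if "p \<le> i" for p
    by (rule input_sym_at[where us = "unary n @ edge_bits n E", OF _ _ that])
      (use len in \<open>auto simp: xs encode_instance_eq\<close>)
  have in2: "input_sym xs (Suc (q + i) + p) = Some (p < j)" if "p \<le> j" for p
    by (rule input_sym_at[where us = "unary n @ edge_bits n E @ unary i", OF _ _ that])
      (use len in \<open>auto simp: xs encode_instance_eq\<close>)
  have in3: "input_sym xs (Suc (Suc (q + i) + j) + p) = Some (p < it)" if "p \<le> it" for p
    by (rule input_sym_at[where us = "unary n @ edge_bits n E @ unary i @ unary j", OF _ _ that])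
      (use len in \<open>auto simp: xs encode_instance_eq\<close>)
  have in4: "input_sym xs (Suc (Suc (Suc (q + i) + j) + it) + p) = Some (p < jt)" if "p \<le> jt" for p
    by (rule input_sym_at[where us = "unary n @ edge_bits n E @ unary i @ unary j @ unary it" and vs = "[]", OF _ _ that])
      (use len in \<open>auto simp: xs encode_instance_eq\<close>)
  define q1 where "q1 = Suc (q + i)"
  define q2 where "q2 = Suc (q1 + j)"
  define q3 where "q3 = Suc (q2 + it)"
  define q4 where "q4 = Suc (q3 + jt)"
  have 1: "run2 xs K (zero SP) (?Z, 0) 1 (?Z(SP := [0]), 0)"
    by (rule runs_cong, rule run_Zero) (use K in auto)
  have 2: "run2 xs K (read SN) (?Z(SP := [0]), 0) (6 * n + 7) (?Z(SP := [n + 1], SN := [n]), n + 1)"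
    by (rule runs_cong, rule run_read[where m = n]) (use K in0 in \<open>auto simp: fun_eq_iff\<close>)
  have 3: "run2 xs K (inc SN) (?Z(SP := [n + 1], SN := [n]), n + 1) 1 (?Z(SP := [n + 1], SN := [n + 1]), n + 1)"
    by (rule runs_cong, rule run_Inc) (auto simp: fun_eq_iff)
  let ?\<sigma> = "?Z(SP := [n + 1], SN := [n + 1])"
  have m2: "mover xs K ?\<sigma> (moveR ;; moveR) 0 2 7"
    using mover_Seq[OF mover_moveR mover_moveR] by (simp add: numeral_eq_Suc)
  have "mover xs K ?\<sigma> (For SN (For SN (moveR ;; moveR))) (Suc (Suc 0)) (hd (?\<sigma> SN) * (hd (?\<sigma> SN) * 2))
     (hd (?\<sigma> SN) * (hd (?\<sigma> SN) * (7 + 3) + 5 + 3) + 5)"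
    by (intro mover_For m2) auto
  from this[unfolded mover_def, rule_format, of ?\<sigma> "n + 1"]
  have 4: "run2 xs K (For SN (For SN (moveR ;; moveR))) (?\<sigma>, n + 1) ((n + 1) * ((n + 1) * 10 + 8) + 5)
      (?Z(SP := [q], SN := [n + 1]), q)"
    by (rule runs_cong) (use K in \<open>auto simp: mv_def fun_eq_iff q_def\<close>)
  let ?R = "\<lambda>p a l u r w. (?Z(SP := [p], SN := [n + 1], SA := a, SL := l, SI := u, SR := r, SW := w), p)"
  have 5: "run2 xs K (read SA) (?Z(SP := [q], SN := [n + 1]), q) (6 * i + 7) (?R q1 [i] [] [] [] [])"
    by (rule runs_cong, rule run_read[where m = i]) (use K in1 in \<open>auto simp: fun_eq_iff q1_def\<close>)
  have 6: "run2 xs K (read SL) (?R q1 [i] [] [] [] []) (6 * j + 7) (?R q2 [i] [j] [] [] [])"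
    by (rule runs_cong, rule run_read[where m = j]) (use K in2 in \<open>auto simp: fun_eq_iff q2_def q1_def\<close>)
  have 7: "run2 xs K (read SI) (?R q2 [i] [j] [] [] []) (6 * it + 7) (?R q3 [i] [j] [it] [] [])"
    by (rule runs_cong, rule run_read[where m = it]) (use K in3 in \<open>auto simp: fun_eq_iff q3_def q2_def q1_def\<close>)
  have 8: "run2 xs K (read SR) (?R q3 [i] [j] [it] [] []) (6 * jt + 7) (?R q4 [i] [j] [it] [jt] [])"
    by (rule runs_cong, rule run_read[where m = jt])
      (use K in4 in \<open>auto simp: fun_eq_iff q4_def q3_def q2_def q1_def\<close>)
  have 9: "run2 xs K (copy SR SW) (?R q4 [i] [j] [it] [jt] []) 1 (?R q4 [i] [j] [it] [jt] [jt])"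
    by (rule runs_cong, rule run_Copy) (use K in auto)
  have 10: "run2 xs K (inc SR) (?R q4 [i] [j] [it] [jt] [jt]) 1 (?R q4 [i] [j] [it] [jt + 1] [jt])"
    by (rule runs_cong, rule run_Inc) (auto simp: fun_eq_iff)
  have 11: "run2 xs K rewind (?R q4 [i] [j] [it] [jt + 1] [jt]) (4 * q4 + 1) (?R 0 [i] [j] [it] [jt + 1] [jt])"
    by (rule runs_cong, rule run_rewind) (auto simp: fun_eq_iff)
  obtain Q where Q: "Q = (n + 1) * (n + 1)" by simp
  have q4: "q4 \<le> 2 * Q + 5 * (n + 1)"
    using le unfolding q4_def q3_def q2_def q1_def q_def Q by (simp add: algebra_simps)
  have t4: "(n + 1) * ((n + 1) * 10 + 8) = 10 * Q + 8 * (n + 1)" unfolding Q by (simp add: algebra_simps)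
  have nQ: "n + 1 \<le> Q" unfolding Q by simp
  have "(n + 1 + 1) ^ 2 = Q + 2 * (n + 1) + 1" unfolding Q by (simp add: power2_eq_square algebra_simps)
  then have b3: "200 * (Q + 2 * (n + 1) + 1) \<le> b ^ 3" using cube_bound[of "n + 1" b] b by simp
  show ?thesis unfolding input_prog_def
    by (rule runs_mono[OF runs_Seq[OF 1 runs_Seq[OF 2 runs_Seq[OF 3 runs_Seq[OF 4 runs_Seq[OF 5 runs_Seq[OF 6
      runs_Seq[OF 7 runs_Seq[OF 8 runs_Seq[OF 9 runs_Seq[OF 10 11]]]]]]]]]]], rule le_trans[OF _ b3], unfold t4)
      (use le q4 nQ in simp)
qed

end

text \<open>\<open>W\<close> bounds all column numbers: the start column and the padded width
  \<open>k ^ d\<close> are each at most \<open>(n + 1) ^ d\<close>. The extra entry in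
  \<open>K\<close> is there because each stack holds at most one number when the search is
  called.\<close>

lemma run_main_prog:
  assumes E: "E \<subseteq> grid_edges n" and le: "i \<le> n" "j \<le> n" "it \<le> n" "jt \<le> n" and d: "0 < d"
    and k: "n + 1 \<le> k ^ d" "(k - 1) ^ d < n + 1"
    and W: "W = 2 * (n + 1) ^ d" and b: "b = W + 200" and K: "K = (d + 1) * (k + 8) + 1"
    and xs: "xs = encode_instance n E (i, j) (it, jt)"
  shows "\<exists>\<tau>. run2 xs K (main_prog d) (\<lambda>_. [], 0) (b ^ (4 * d + 6)) (\<tau>, 0) \<and>
    (peek (\<tau> SZ) \<noteq> Some 0 \<longleftrightarrow> grid_reach E (i, j) (it, jt))"
proof -
  interpret instance_input E n it xs K
    unfolding xs using E le by (intro instance_input_encode)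
  have nW: "2 * (n + 1) \<le> W" using self_le_power[of "n + 1" d] d unfolding W by simp
  have dK: "d + 6 \<le> K"
  proof -
    have "(d + 1) * 8 \<le> (d + 1) * (k + 8)" by (intro mult_le_mono) auto
    then show ?thesis unfolding K by simp
  qed
  let ?A = "(\<lambda>_. [])(SP := [0], SN := [n + 1], SA := [i], SL := [j], SI := [it], SR := [jt + 1], SW := [jt])"
  have 1: "run input_prog (\<lambda>_. [], 0) (b ^ 3) (?A, 0)"
    by (rule run_input_prog[OF xs le]) (use dK b nW in auto)
  obtain k' where k': "0 < k'" "n + 1 \<le> k' ^ d" "(k' - 1) ^ d < n + 1" "k' \<le> n + 1"
    and 2: "run (root_prog d) (?A, 0) (b ^ (d + 3)) (?A(SK := [k'], SJ := [k' - 1]), 0)"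
    using run_root_prog[of ?A n d K W b xs] dK d nW W b by auto
  \<comment> \<open>The two inequalities determine the rounded root, so the value found by the
    machine is the given \<open>k\<close>.\<close>
  have "x \<le> y" if "(x - 1) ^ d < n + 1" "n + 1 \<le> y ^ d" for x y :: nat
  proof (rule ccontr)
    assume "\<not> x \<le> y"
    then have "y ^ d \<le> (x - 1) ^ d" by (intro power_mono) auto
    then show False using that by simp
  qed
  then have kk: "k' = k" using k k' by (meson le_antisym)
  let ?B = "?A(SK := [k], SJ := [k - 1], SC := [i - it])"
  have 3: "run (diff SC SA SI) (?A(SK := [k], SJ := [k - 1]), 0) (it * 4 + 7) (?B, 0)"
    by (rule runs_cong, rule run_diff) (use dK in auto)
  have spec: "search_spec k W (b ^ (4 * d + 3)) d"
    by (rule search_spec) (use k' kk nW b in auto)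
  have "k ^ d \<le> (n + 1) ^ d" using k'(4) kk by (intro power_mono) auto
  moreover have "i \<le> (n + 1) ^ d" using le(1) nW unfolding W by simp
  ultimately have kW: "i + k ^ d \<le> W" unfolding W by simp
  have "env k ?B" "?B SA = [i]" "?B SL = j # []" "?B SR = (jt + 1) # []" by (auto simp: env_def)
  note P = spec[unfolded search_spec_def, rule_format, OF this le(2)]
  have P1: "run (prog d) (?B, 0) (b ^ (4 * d + 3)) (?B(SL := [q, j], SR := [], SA := [i + k ^ d], SF := [1]), 0)"
    if "best (seg step i (k ^ d) j) (jt + 1) q" for q
    by (rule runs_cong, rule P[THEN conjunct1, rule_format]) (use that kW le in \<open>auto simp: K fun_eq_iff\<close>)
  have P0: "run (prog d) (?B, 0) (b ^ (4 * d + 3)) (?B(SF := [0]), 0)"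
    if "\<forall>z<jt + 1. \<not> seg step i (k ^ d) j z"
    by (rule runs_cong, rule P[THEN conjunct2, rule_format]) (use that kW le in \<open>auto simp: K fun_eq_iff\<close>)
  let ?tail = "Cond (NZ SF) (Cond (NZ SC) Skip (diff SU SW SL ;; Cond (NZ SU) Skip (inc SZ))) Skip"
  have reach: "grid_reach E (i, j) (it, jt) \<longleftrightarrow> i \<le> it \<and> seg step i (k ^ d) j jt"
    using grid_reach_iff[OF E le(3,4), of "k ^ d"] k(1) by simp
  have total: "run (main_prog d) (\<lambda>_. [], 0) (b ^ (4 * d + 6)) (\<tau>, 0)"
    if "run (prog d) (?B, 0) (b ^ (4 * d + 3)) (\<rho>, 0)" "\<rho> SZ = []" "run ?tail (\<rho>(SZ := [0]), 0) (4 * n + 30) (\<tau>, 0)" for \<rho> \<tau>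
  proof -
    have z: "run (zero SZ) (\<rho>, 0) 1 (\<rho>(SZ := [0]), 0)"
      by (rule runs_cong, rule run_Zero) (use that dK in auto)
    note R = runs_Seq[OF 1 runs_Seq[OF 2[unfolded kk] runs_Seq[OF 3 runs_Seq[OF that(1) runs_Seq[OF z that(3)]]]]]
    let ?X = "b ^ (4 * d + 3)"
    have b3: "b ^ 3 \<le> ?X" "b ^ (d + 3) \<le> ?X" using b by (auto intro: power_increasing)
    have "b * 1 \<le> b * b ^ 2" using b by (intro mult_le_mono) auto
    then have bX: "b \<le> ?X" using b3(1) by (simp add: numeral_eq_Suc)
    have "b ^ 3 + (b ^ (d + 3) + (it * 4 + 7 + (?X + (1 + (4 * n + 30) + 1) + 1) + 1) + 1) + 1 \<le> 3 * ?X + (8 * n + 45)"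
      using b3 le(3) by linarith
    also have "8 * n + 45 \<le> 5 * b" using b nW by simp
    also have "5 * b \<le> 5 * ?X" using bX by simp
    also have "3 * ?X + 5 * ?X \<le> b * ?X" using b by simp
    also have "\<dots> \<le> b ^ 3 * ?X" using b by (intro mult_le_mono1) (simp add: numeral_3_eq_3)
    also have "\<dots> = b ^ (4 * d + 6)" by (simp flip: power_add add: add.commute)
    finally show ?thesis unfolding main_prog_def by (intro runs_mono[OF R]) simp
  qed
  show ?thesis
  proof (cases "\<exists>z<jt + 1. seg step i (k ^ d) j z")
    case False
    then have no: "\<forall>z<jt + 1. \<not> seg step i (k ^ d) j z" by blast
    let ?\<rho> = "?B(SF := [0])"
    have t: "run ?tail (?\<rho>(SZ := [0]), 0) (4 * n + 30) (?\<rho>(SZ := [0]), 0)"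
      by (rule runs_mono[OF runs_CondF[OF _ runs_Skip]]) auto
    show ?thesis using total[OF P0[OF no] _ t] no reach by (intro exI[of _ "?\<rho>(SZ := [0])"]) auto
  next
    case True
    then obtain q where q: "best (seg step i (k ^ d) j) (jt + 1) q" using best_ex by blast
    let ?\<rho> = "?B(SL := [q, j], SR := [], SA := [i + k ^ d], SF := [1])"
    have nz: "holds2 xs (NZ SF) (?\<rho>(SZ := [0]), 0)" by simp
    show ?thesis
    proof (cases "i \<le> it")
      case False
      have t: "run ?tail (?\<rho>(SZ := [0]), 0) (4 * n + 30) (?\<rho>(SZ := [0]), 0)"
      proof -
        have v: "run (Cond (NZ SC) Skip (diff SU SW SL ;; Cond (NZ SU) Skip (inc SZ))) (?\<rho>(SZ := [0]), 0) (1 + 1) (?\<rho>(SZ := [0]), 0)"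
          by (rule runs_CondT[OF _ runs_Skip]) (use False in auto)
        show ?thesis by (rule runs_mono[OF runs_CondT[OF nz v]]) simp
      qed
      show ?thesis using total[OF P1[OF q] _ t] False reach by (intro exI[of _ "?\<rho>(SZ := [0])"]) auto
    next
      case True
      have z: "\<not> holds2 xs (NZ SC) (?\<rho>(SZ := [0]), 0)" using True by simp
      let ?\<upsilon> = "?\<rho>(SZ := [0], SU := [jt - q])"
      have qj: "q \<le> jt" using q by (simp add: best_def)
      have u: "run (diff SU SW SL) (?\<rho>(SZ := [0]), 0) (q * 4 + 7) (?\<upsilon>, 0)"
        by (rule runs_cong, rule run_diff) (use dK in auto)
      show ?thesis
      proof (cases "q = jt")
        case False
        have v: "run (Cond (NZ SU) Skip (inc SZ)) (?\<upsilon>, 0) (1 + 1) (?\<upsilon>, 0)"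
          by (rule runs_CondT[OF _ runs_Skip]) (use False qj in auto)
        have t: "run ?tail (?\<rho>(SZ := [0]), 0) (4 * n + 30) (?\<upsilon>, 0)"
          by (rule runs_mono[OF runs_CondT[OF nz runs_CondF[OF z runs_Seq[OF u v]]]]) (use qj le in auto)
        have "\<not> seg step i (k ^ d) j jt" using q False qj unfolding best_def by (meson le_antisym less_add_one)
        then show ?thesis using total[OF P1[OF q] _ t] reach by (intro exI[of _ ?\<upsilon>]) auto
      next
        case True
        have "run (inc SZ) (?\<upsilon>, 0) 1 (?\<upsilon>(SZ := [1]), 0)"
          by (rule runs_cong, rule run_Inc) (auto simp: fun_eq_iff)
        then have v: "run (Cond (NZ SU) Skip (inc SZ)) (?\<upsilon>, 0) (1 + 1) (?\<upsilon>(SZ := [1]), 0)"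
          by (intro runs_CondF) (use True in auto)
        have t: "run ?tail (?\<rho>(SZ := [0]), 0) (4 * n + 30) (?\<upsilon>(SZ := [1]), 0)"
          by (rule runs_mono[OF runs_CondT[OF nz runs_CondF[OF z runs_Seq[OF u v]]]]) (use qj le in auto)
        have "seg step i (k ^ d) j jt" using q True unfolding best_def by simp
        then show ?thesis using total[OF P1[OF q] _ t] reach \<open>i \<le> it\<close> by (intro exI[of _ "?\<upsilon>(SZ := [1])"]) auto
      qed
    qed
  qed
qed


section \<open>Choice of parameters and asymptotics\<close>

lemma root_exists:
  fixes n d :: nat
  assumes "0 < d"
  shows "\<exists>k. n + 1 \<le> k ^ d \<and> (k - 1) ^ d < n + 1"
proof -
  let ?k = "LEAST k. n + 1 \<le> k ^ d"
  have "n + 1 \<le> (n + 1) ^ d" using assms by (intro self_le_power) auto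
  then have 1: "n + 1 \<le> ?k ^ d" by (rule LeastI)
  have "?k \<noteq> 0" using 1 assms by (metis add_eq_0_iff_both_eq_0 le_zero_eq one_neq_zero zero_power)
  then have "(?k - 1) ^ d < n + 1" using not_less_Least[of "?k - 1" "\<lambda>k. n + 1 \<le> k ^ d"] by simp
  with 1 show ?thesis by blast
qed

lemma tm_decides_within_mono:
  "tm_decides_within M xs b T S \<Longrightarrow> T \<le> T' \<Longrightarrow> S \<le> S' \<Longrightarrow> tm_decides_within M xs b T' S'"
  unfolding tm_decides_within_def by (meson order_trans)

text \<open>A logarithm is below every positive power; the summand 2 in the constant pays for
  rounding up and for the added 1.\<close>

lemma log_ceiling_bound:
  assumes "0 < \<delta>"
  shows "\<exists>c\<ge>0. \<forall>N::nat. 1 \<le> N \<longrightarrow> (\<exists>L. N \<le> 2 ^ L \<and> real (L + 1) \<le> c * real N powr \<delta>)"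
proof (intro exI[of _ "1 / (\<delta> * ln 2) + 2"] conjI allI impI)
  show "0 \<le> 1 / (\<delta> * ln 2) + 2" using assms by simp
  fix N :: nat assume N: "1 \<le> N"
  let ?L = "nat \<lceil>log 2 (real N)\<rceil>"
  have lg: "0 \<le> log 2 (real N)" using N by simp
  show "\<exists>L. N \<le> 2 ^ L \<and> real (L + 1) \<le> (1 / (\<delta> * ln 2) + 2) * real N powr \<delta>"
  proof (intro exI[of _ ?L] conjI)
    have "real N = 2 powr (log 2 (real N))" using N by simp
    also have "\<dots> \<le> 2 powr real ?L" using lg by (intro powr_mono) linarith+
    also have "\<dots> = 2 ^ ?L" by (simp add: powr_realpow)
    finally show "N \<le> 2 ^ ?L" by (metis of_nat_le_iff of_nat_numeral of_nat_power)
    have "real (?L + 1) \<le> log 2 (real N) + 2" using lg by simp linarith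
    also have "log 2 (real N) \<le> (real N powr \<delta> / \<delta>) / ln 2"
      unfolding log_def using N assms by (intro divide_right_mono ln_powr_bound) auto
    also have "(real N powr \<delta> / \<delta>) / ln 2 + 2 \<le> (real N powr \<delta> / \<delta>) / ln 2 + 2 * real N powr \<delta>"
      using N assms ge_one_powr_ge_zero[of "real N" \<delta>] by simp
    also have "\<dots> = (1 / (\<delta> * ln 2) + 2) * real N powr \<delta>" by (simp add: field_simps)
    finally show "real (?L + 1) \<le> (1 / (\<delta> * ln 2) + 2) * real N powr \<delta>" by simp
  qed
qed

theorem theorem3:
  shows "\<forall>\<epsilon>::real. \<epsilon> > 0 \<longrightarrow>
    (\<exists>M c k. wf_tm M \<and> c > 0 \<and>
       (\<forall>n E s t. E \<subseteq> grid_edges n \<longrightarrow> s \<in> grid_vertices n \<longrightarrow> t \<in> grid_vertices n \<longrightarrow>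
          tm_decides_within M (encode_instance n E s t) (grid_reach E s t)
            (c * (real n + 1) ^ k) (c * (real n + 1) powr \<epsilon>)))"
proof (intro allI impI)
  fix \<epsilon> :: real assume \<epsilon>: "0 < \<epsilon>"
  \<comment> \<open>One half of the exponent bounds \<open>k\<close>, the other half the word length
    \<open>w\<close>; their product is the space.\<close>
  define \<delta> where "\<delta> = \<epsilon> / 2"
  have \<delta>: "0 < \<delta>" using \<epsilon> by (simp add: \<delta>_def)
  \<comment> \<open>With \<open>d\<close> at least the inverse of \<open>\<delta>\<close>, the
    \<open>d\<close>-th root of n is at most n to the power \<open>\<delta>\<close>.\<close>
  define d where "d = Suc (nat \<lceil>1 / \<delta>\<rceil>)"
  have d0: "0 < d" by (simp add: d_def)
  have "1 / \<delta> \<le> real d" unfolding d_def using \<delta> by (simp add: le_of_int_ceiling[of "1 / \<delta>"]) linarith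
  then have d\<delta>: "1 / real d \<le> \<delta>" using \<delta> d0 by (simp add: field_simps)
  define e where "e = 4 * d + 6"
  define A where "A = (8 + d) * e + 2"
  obtain c1 where c1: "0 \<le> c1"
    and L_ex: "\<And>N::nat. 1 \<le> N \<Longrightarrow> \<exists>L. N \<le> 2 ^ L \<and> real (L + 1) \<le> c1 * real N powr \<delta>"
    using log_ceiling_bound[OF \<delta>] by auto
  define c2 where "c2 = real (d + 1) * 10 + 3"
  define c3 where "c3 = c2 * (real A * c1) + 2"
  define p where "p = nat \<lceil>\<epsilon>\<rceil>"
  \<comment> \<open>The factor 128 is 16 times 8 from the simulation overhead, 202 comes from the
    bound \<open>b <= 202 * N ^ d\<close>, and the square of \<open>c3\<close> from the stack height
    entering twice: through the cost of a number operation and through the walks of the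
    head.\<close>
  define c where "c = 128 * 202 ^ e * c3 ^ 2"
  have c2: "0 \<le> c2" by (simp add: c2_def)
  have c3: "2 \<le> c3" unfolding c3_def using c1 c2 by simp
  have c3c: "c3 \<le> c"
  proof -
    have "1 * 1 \<le> 128 * (202 :: real) ^ e" by (intro mult_mono one_le_power) auto
    then have "1 * c3 * 1 \<le> (128 * 202 ^ e) * c3 * c3" using c3 by (intro mult_mono) auto
    then show ?thesis by (simp add: c_def power2_eq_square)
  qed
  obtain M where M: "wf_tm M" and dec: "\<And>xs K n \<sigma> h w. exec (stp2 K) (holds2 xs) (main_prog d) (\<lambda>_. [], 0) n (\<sigma>, h) \<Longrightarrow>
     n < 2 ^ w \<Longrightarrow> tm_decides_within M xs (peek (\<sigma> SZ) \<noteq> Some 0)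
       (real ((n * (12 * w + 12) + 4) * (2 * ((K + 2) * (w + 1)) + 6))) (real ((K + 2) * (w + 1) + 2))"
    using tm_of_com2[of "main_prog d" SZ] by blast
  have "tm_decides_within M (encode_instance n E s t) (grid_reach E s t)
      (c * (real n + 1) ^ (d * e + 2 * p)) (c * (real n + 1) powr \<epsilon>)"
    if E: "E \<subseteq> grid_edges n" and s: "s \<in> grid_vertices n" and t: "t \<in> grid_vertices n" for n E s t
  proof -
    obtain i j it jt where st: "s = (i, j)" "t = (it, jt)" by force
    have le: "i \<le> n" "j \<le> n" "it \<le> n" "jt \<le> n" using s t by (auto simp: st grid_vertices_def)
    define N where "N = n + 1"
    have N1: "1 \<le> N" by (simp add: N_def)
    obtain k where k: "n + 1 \<le> k ^ d" "(k - 1) ^ d < n + 1" using root_exists[OF d0] by blast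
    obtain L where L: "N \<le> 2 ^ L" "real (L + 1) \<le> c1 * real N powr \<delta>" using L_ex[OF N1] by blast
    define b where "b = 2 * (n + 1) ^ d + 200"
    define K where "K = (d + 1) * (k + 8) + 1"
    \<comment> \<open>From \<open>202 < 2 ^ 8\<close> and \<open>N <= 2 ^ L\<close>, the time bound
      \<open>T\<close> is at most \<open>2 ^ ((8 + d * L) * e)\<close>; one more bit makes the
      inequality strict.\<close>
    define w where "w = (8 + d * L) * e + 1"
    define T where "T = (202 * N ^ d) ^ e"
    obtain \<tau> where run: "runs (stp2 K) (holds2 (encode_instance n E s t)) (main_prog d) (\<lambda>_. [], 0) (b ^ e) (\<tau>, 0)"
      and acc: "peek (\<tau> SZ) \<noteq> Some 0 \<longleftrightarrow> grid_reach E s t"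
      using run_main_prog[OF E le d0 k refl b_def K_def refl] unfolding e_def st by blast
    have bT: "b ^ e \<le> T" unfolding T_def b_def N_def by (intro power_mono) auto
    have Tw: "T < 2 ^ w"
    proof -
      have "N ^ d \<le> (2 ^ L) ^ d" using L(1) by (intro power_mono) auto
      then have "202 * N ^ d \<le> 2 ^ 8 * (2 ^ L) ^ d" by (intro mult_le_mono) auto
      also have "\<dots> = 2 ^ (8 + d * L)" by (simp add: power_add power_mult mult.commute flip: power_mult)
      finally have "T \<le> (2 ^ (8 + d * L)) ^ e" unfolding T_def by (intro power_mono) auto
      also have "\<dots> = 2 ^ ((8 + d * L) * e)" by (simp add: power_mult)
      finally show ?thesis unfolding w_def by (simp add: less_le_trans[OF le_imp_less_Suc])
    qed
    obtain m where m: "m \<le> b ^ e" "exec (stp2 K) (holds2 (encode_instance n E s t)) (main_prog d) (\<lambda>_. [], 0) m (\<tau>, 0)"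
      using run unfolding runs_def by blast
    have mT: "m \<le> T" using m(1) bT by simp
    note D = dec[OF m(2) le_less_trans[OF mT Tw]]
    let ?N = "real N"
    have N\<delta>: "1 \<le> ?N powr \<delta>" using N1 \<delta> ge_one_powr_ge_zero[of ?N \<delta>] by simp
    define B where "B = (K + 2) * (w + 1)"
    \<comment> \<open>Minimality gives \<open>k - 1\<close> at most the \<open>d\<close>-th root of
      n + 1; the factor 2 covers the difference between \<open>k - 1\<close> and
      \<open>k\<close>.\<close>
    have kb: "real k \<le> 2 * ?N powr \<delta>"
    proof -
      have "real (k - 1) ^ d \<le> ?N" using k(2) unfolding N_def by (metis less_imp_le of_nat_le_iff of_nat_power)
      then have "real (k - 1) \<le> ?N powr (1 / real d)"
      proof (cases "k - 1 = 0")
        case False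
        have "real (k - 1) = (real (k - 1) powr real d) powr (1 / real d)" using d0 by (simp add: powr_powr)
        also have "\<dots> \<le> ?N powr (1 / real d)"
          using False \<open>real (k - 1) ^ d \<le> ?N\<close> by (intro powr_mono2) (auto simp: powr_realpow)
        finally show ?thesis .
      qed simp
      also have "\<dots> \<le> ?N powr \<delta>" using d\<delta> N1 by (intro powr_mono) auto
      finally show ?thesis using N\<delta> by simp
    qed
    have Kb: "real (K + 2) \<le> c2 * ?N powr \<delta>"
    proof -
      have "real (K + 2) = real (d + 1) * (real k + 8) + 3" by (simp add: K_def algebra_simps)
      also have "\<dots> \<le> real (d + 1) * (10 * ?N powr \<delta>) + 3 * ?N powr \<delta>"
        using kb N\<delta> by (intro add_mono mult_left_mono) auto
      also have "\<dots> = c2 * ?N powr \<delta>" by (simp add: c2_def algebra_simps)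
      finally show ?thesis .
    qed
    have wb: "real (w + 1) \<le> real A * c1 * ?N powr \<delta>"
    proof -
      have "w + 1 \<le> A * (L + 1)" unfolding w_def A_def by (simp add: algebra_simps)
      then have "real (w + 1) \<le> real A * real (L + 1)" by (metis of_nat_le_iff of_nat_mult)
      also have "\<dots> \<le> real A * (c1 * ?N powr \<delta>)" using L(2) by (intro mult_left_mono) auto
      finally show ?thesis by simp
    qed
    have S: "real (B + 2) \<le> c3 * ?N powr \<epsilon>"
    proof -
      have pp: "?N powr \<delta> * ?N powr \<delta> = ?N powr \<epsilon>" using N1 by (simp add: \<delta>_def flip: powr_add)
      have "real (B + 2) = real (K + 2) * real (w + 1) + 2" by (simp add: B_def algebra_simps)
      also have "\<dots> \<le> (c2 * ?N powr \<delta>) * (real A * c1 * ?N powr \<delta>) + 2"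
        using Kb wb c2 by (intro add_mono mult_mono) auto
      also have "\<dots> = c2 * (real A * c1) * (?N powr \<delta> * ?N powr \<delta>) + 2" by simp
      also have "\<dots> \<le> c2 * (real A * c1) * ?N powr \<epsilon> + 2 * ?N powr \<epsilon>"
        using N1 \<epsilon> ge_one_powr_ge_zero[of ?N \<epsilon>] by (simp add: pp)
      also have "\<dots> = c3 * ?N powr \<epsilon>" by (simp add: c3_def algebra_simps)
      finally show ?thesis .
    qed
    \<comment> \<open>The time bound has a natural exponent, so here the space bound is weakened to
      the next integer power \<open>p\<close>.\<close>
    have Sp: "real (B + 2) \<le> c3 * ?N ^ p"
    proof -
      have "?N powr \<epsilon> \<le> ?N powr real p" using N1 \<epsilon> unfolding p_def by (intro powr_mono) linarith+
      then have "?N powr \<epsilon> \<le> ?N ^ p" using N1 by (simp add: powr_realpow)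
      then show ?thesis using S c3 by (smt (verit) mult_left_mono)
    qed
    have time: "real ((m * (12 * w + 12) + 4) * (2 * B + 6)) \<le> c * ?N ^ (d * e + 2 * p)"
    proof -
      have wB: "w + 1 \<le> B" unfolding B_def by simp
      have T1: "1 \<le> T" unfolding T_def N_def by simp
      have "m * (12 * w + 12) + 4 \<le> T * (12 * (B + 2)) + 4 * (T * (B + 2))"
        using mT wB T1 by (intro add_mono mult_le_mono) auto
      then have "m * (12 * w + 12) + 4 \<le> 16 * T * (B + 2)" by (simp add: algebra_simps)
      then have "(m * (12 * w + 12) + 4) * (2 * B + 6) \<le> (16 * T * (B + 2)) * (8 * (B + 2))"
        by (intro mult_le_mono) auto
      then have "real ((m * (12 * w + 12) + 4) * (2 * B + 6)) \<le> real ((16 * T * (B + 2)) * (8 * (B + 2)))"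
        by (rule of_nat_mono)
      also have "\<dots> = 128 * real T * real (B + 2) ^ 2" by (simp add: power2_eq_square algebra_simps)
      also have "\<dots> \<le> 128 * real T * (c3 * ?N ^ p) ^ 2" using Sp by (intro mult_left_mono power_mono) auto
      also have "real T = 202 ^ e * ?N ^ (d * e)" by (simp add: T_def power_mult_distrib power_mult)
      finally show ?thesis by (simp add: c_def power_mult_distrib power_add power_mult mult.commute[of 2 p] mult.assoc mult.left_commute)
    qed
    have space: "real (B + 2) \<le> c * ?N powr \<epsilon>"
      using S c3c by (smt (verit) mult_right_mono powr_ge_zero)
    show ?thesis
      using tm_decides_within_mono[OF D[unfolded acc, folded B_def] time space] by (simp add: N_def add.commute)
  qed
  moreover have "c > 0" using c3 c3c by linarith
  ultimately show "\<exists>M c k. wf_tm M \<and> c > 0 \<and>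
       (\<forall>n E s t. E \<subseteq> grid_edges n \<longrightarrow> s \<in> grid_vertices n \<longrightarrow> t \<in> grid_vertices n \<longrightarrow>
          tm_decides_within M (encode_instance n E s t) (grid_reach E s t)
            (c * (real n + 1) ^ k) (c * (real n + 1) powr \<epsilon>))"
    using M by blast
qed

end
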